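(* Let $g>0$, let $m_{\mathcal I}\in\mathbb{R}^3$ be a constant vector with $m_{\mathcal I}\times e_3\neq 0$, and let $k_1^v,k_2^v,k_1^r,k_2^r$ be positive constants satisfying $$k_1^r\le \frac{k_1^v k_2^v}{g}.$$ Consider the system $$\dot v = v\times\omega + a_{\mathcal B} + gR^Te_3,\qquad \dot R = R\,\omega_\times$$ with state $(v,R)\in\mathbb{R}^3\times \mathrm{SO}(3)$ and measurements $(v,\omega,a_{\mathcal B},m_{\mathcal B})$, where $m_{\mathcal B}=R^Tm_{\mathcal I}$, and the observer (Observer 1) with state $(\hat v,\hat R)\in\mathbb{R}^3\times\mathrm{SO}(3)$, $$\dot{\hat v}=\hat v\times\omega+a_{\mathcal B}+g\hat R^Te_3+\sigma_v,\qquad \dot{\hat R}=\hat R(\omega+\sigma_R)_\times,$$ $$\sigma_v = k_1^v\tilde v-k_2^v\,\hat\gamma\times(\hat\gamma\times\tilde v),\qquad \sigma_R = k_1^r\,\tilde v\times\hat\gamma+k_2^r\big((m_{\mathcal B}\times\hat m_{\mathcal B})^T\hat\gamma\big)\hat\gamma,$$ where $\tilde v=v-\hat v$, $\hat\gamma=\hat R^Te_3$, $\hat m_{\mathcal B}=\hat R^Tm_{\mathcal I}$. Define the errors $\bar v=R(v-\hat v)$ and $\bar R=R\hat R^T$. Then: 1. The dynamics of the errors $(\bar v,\bar R)$ have only four isolated equilibria, one of which is $(\bar v,\bar R)=(0,I)$. 2. The equilibrium $(\bar v,\bar R)=(0,I)$ is locally exponentially stable and almost globally asymptotically stable, and the other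 three equilibria of $(\bar v,\bar R)$ are unstable. Thus, for almost all initial conditions $(\hat v(0),\hat R(0))$, the trajectory $(\hat v(t),\hat R(t))$ converges to the system trajectory $(v(t),R(t))$. 3. The dynamics of $(\hat v,\hat R^Te_3)$ are independent of $m_{\mathcal B}$.
   Context: $\{e_1,e_2,e_3\}$ is the canonical basis of $\mathbb{R}^3$; for $u\in\mathbb{R}^3$, $u_\times$ is the skew-symmetric matrix with $u_\times w=u\times w$ for all $w\in\mathbb{R}^3$; $I$ is the $3\times3$ identity matrix. $R$ is the attitude of a rigid vehicle (rotation from the body-fixed frame to the inertial frame), $v$ its linear velocity, $\omega$ its angular velocity and $a_{\mathcal B}$ its specific acceleration, all three expressed in the body frame (time-varying signals); $g$ is the gravitational acceleration constant and $m_{\mathcal I}$ the Earth's magnetic field in the inertial frame. The dynamics of the errors $(\bar v,\bar R)$ are the autonomous system on $\mathbb{R}^3\times\mathrm{SO}(3)$ $$\dot{\bar v}=g(I-\bar R)e_3-\bar\sigma_v,\qquad \dot{\bar R}=-(\bar\sigma_R)_\times\bar R,$$ $$\bar\sigma_v=k_1^v\bar v-k_2^v(\bar Re_3)\times((\bar Re_3)\times\bar v),\qquad \bar\sigma_R=k_1^r\,\bar v\times\bar Re_3+k_2^r\big((m_{\mathcal I}\times\bar Rm_{\mathcal I})^T\bar Re_3\big)\bar Re_3 .$$ An equilibrium is almost globally asymptotically stable if it is (Lyapunov) stable and attracts all trajectories except those starting in a set of measure zero. "The trajectory $(\hat v,\hat R)$ converges to $(v,R)$" means $(\bar v(t),\bar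 R(t))\to(0,I)$ as $t\to\infty$. "Independent of $m_{\mathcal B}$" means that the time derivatives of $\hat v$ and $\hat R^Te_3$ can be expressed as functions of $\hat v,\hat R^Te_3,v,\omega,a_{\mathcal B}$ (and the constants) in which $m_{\mathcal B}$ does not appear. *)

theory Defs
  imports "HOL-Analysis.Analysis"
begin

unbundle cross3_syntax

section \<open>Rotations\<close>

abbreviation e3 :: "real^3" where
  "e3 \<equiv> axis 3 1"

text \<open>The topology and the distance on rotations are those of the ambient space of matrices,
  where \<^term>\<open>norm :: real^3^3 \<Rightarrow> real\<close> is the Frobenius norm.\<close>

definition SO3 :: "(real^3^3) set" where
  "SO3 = {R. rotation_matrix R}"

definition skew :: "real^3 \<Rightarrow> real^3^3" where
  "skew u = matrix (\<lambda>w. u \<times> w)"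

lemma skew_mult_vec: "skew u *v w = u \<times> w"
proof -
  have "linear (\<lambda>w. u \<times> w)"
    by (rule linearI) (simp_all add: cross_add_right cross_mult_right)
  then show ?thesis
    unfolding skew_def by (simp add: matrix_works)
qed

type_synonym state = "(real^3) \<times> (real^3^3)"

definition state_space :: "state set" where
  "state_space = {(v, R). R \<in> SO3}"


section \<open>Sets of measure zero in the state space\<close>

definition cayley :: "real^3 \<Rightarrow> real^3^3" where
  "cayley b = (mat 1 + skew b) ** matrix_inv (mat 1 - skew b)"

text \<open>The Cayley transform is a diffeomorphism from the space of vectors onto the open set of
  rotations whose angle is not \<open>\<pi>\<close>. The maps \<open>b \<mapsto> cayley b ** Q\<close>, for \<open>Q\<close> in
  \<^const>\<open>SO3\<close>, are therefore the inverse charts of a smooth atlas, and a subset of the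
  manifold has measure zero iff it is Lebesgue null in each of these charts.\<close>

definition measure_zero :: "state set \<Rightarrow> bool" where
  "measure_zero N \<longleftrightarrow>
     (\<forall>Q\<in>SO3. negligible {(a, b). (a, cayley b ** Q) \<in> N})"


section \<open>Differential equations and stability\<close>

text \<open>\<open>ode_solution f M J x\<close>: on the time interval \<open>J\<close> the curve \<open>x\<close> stays in the state space
  \<open>M\<close> and solves \<open>x' = f t x\<close> (with one-sided derivatives at endpoints belonging to \<open>J\<close>).\<close>

definition ode_solution ::
  "(real \<Rightarrow> 'a \<Rightarrow> 'a) \<Rightarrow> 'a set \<Rightarrow> real set \<Rightarrow> (real \<Rightarrow> 'a::real_normed_vector) \<Rightarrow> bool" where
  "ode_solution f M J x \<longleftrightarrow>
     (\<forall>t\<in>J. x t \<in> M \<and> (x has_vector_derivative f t (x t)) (at t within J))"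

definition equilibria :: "('a \<Rightarrow> 'a) \<Rightarrow> 'a set \<Rightarrow> 'a::real_normed_vector set" where
  "equilibria f M = {p\<in>M. f p = 0}"

text \<open>The next two definitions quantify over solutions on arbitrary intervals \<open>[0, T)\<close>, so that
  solutions which are not known to exist for all times are constrained as well.\<close>

definition lyapunov_stable :: "('a \<Rightarrow> 'a) \<Rightarrow> 'a set \<Rightarrow> 'a::real_normed_vector \<Rightarrow> bool" where
  "lyapunov_stable f M p \<longleftrightarrow>
     (\<forall>\<epsilon>>0. \<exists>\<delta>>0. \<forall>T>0. \<forall>x.
        ode_solution (\<lambda>_. f) M {0..<T} x \<and> dist (x 0) p < \<delta> \<longrightarrow>
        (\<forall>t\<in>{0..<T}. dist (x t) p < \<epsilon>))"

definition locally_exponentially_stable ::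
  "('a \<Rightarrow> 'a) \<Rightarrow> 'a set \<Rightarrow> 'a::real_normed_vector \<Rightarrow> bool" where
  "locally_exponentially_stable f M p \<longleftrightarrow>
     (\<exists>\<delta>>0. \<exists>C>0. \<exists>r>0. \<forall>T>0. \<forall>x.
        ode_solution (\<lambda>_. f) M {0..<T} x \<and> dist (x 0) p < \<delta> \<longrightarrow>
        (\<forall>t\<in>{0..<T}. dist (x t) p \<le> C * exp (- r * t) * dist (x 0) p))"

definition almost_globally_asymptotically_stable :: "(state \<Rightarrow> state) \<Rightarrow> state \<Rightarrow> bool" where
  "almost_globally_asymptotically_stable f p \<longleftrightarrow>
     lyapunov_stable f state_space p \<and>
     (\<exists>N. measure_zero N \<and>
        (\<forall>p0 \<in> state_space - N.
           (\<exists>x. ode_solution (\<lambda>_. f) state_space {0..} x \<and> x 0 = p0) \<and>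
           (\<forall>x. ode_solution (\<lambda>_. f) state_space {0..} x \<and> x 0 = p0 \<longrightarrow>
              (x \<longlongrightarrow> p) at_top)))"


section \<open>The vehicle, the observer and the error dynamics\<close>

definition vehicle ::
  "real \<Rightarrow> (real \<Rightarrow> real^3) \<Rightarrow> (real \<Rightarrow> real^3) \<Rightarrow> real \<Rightarrow> state \<Rightarrow> state" where
  "vehicle g \<omega> aB t = (\<lambda>(v, R).
     (v \<times> \<omega> t + aB t + g *\<^sub>R (transpose R *v e3),
      R ** skew (\<omega> t)))"

text \<open>The innovation terms in the observer and the corresponding terms in the error dynamics
  are values of the same functions, in body and in inertial coordinates respectively.\<close>

definition sigma_v :: "real \<Rightarrow> real \<Rightarrow> real^3 \<Rightarrow> real^3 \<Rightarrow> real^3" where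
  "sigma_v k1v k2v u \<gamma> = k1v *\<^sub>R u - k2v *\<^sub>R (\<gamma> \<times> (\<gamma> \<times> u))"

definition sigma_R ::
  "real \<Rightarrow> real \<Rightarrow> real^3 \<Rightarrow> real^3 \<Rightarrow> real^3 \<Rightarrow> real^3 \<Rightarrow> real^3" where
  "sigma_R k1r k2r u \<gamma> m m' =
     k1r *\<^sub>R (u \<times> \<gamma>) + (k2r * ((m \<times> m') \<bullet> \<gamma>)) *\<^sub>R \<gamma>"

definition observer ::
  "real \<Rightarrow> real \<Rightarrow> real \<Rightarrow> real \<Rightarrow> real \<Rightarrow> real^3 \<Rightarrow>
   (real \<Rightarrow> real^3) \<Rightarrow> (real \<Rightarrow> real^3) \<Rightarrow> (real \<Rightarrow> real^3) \<Rightarrow> (real \<Rightarrow> real^3) \<Rightarrow>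
   real \<Rightarrow> state \<Rightarrow> state" where
  "observer g k1v k2v k1r k2r mI v \<omega> aB mB t = (\<lambda>(vh, Rh).
     let \<gamma> = transpose Rh *v e3;
         vt = v t - vh
     in (vh \<times> \<omega> t + aB t + g *\<^sub>R \<gamma> + sigma_v k1v k2v vt \<gamma>,
         Rh ** skew (\<omega> t + sigma_R k1r k2r vt \<gamma> (mB t) (transpose Rh *v mI))))"

definition observation_error :: "state \<Rightarrow> state \<Rightarrow> state" where
  "observation_error = (\<lambda>(v, R) (vh, Rh). (R *v (v - vh), R ** transpose Rh))"

definition error_dynamics ::
  "real \<Rightarrow> real \<Rightarrow> real \<Rightarrow> real \<Rightarrow> real \<Rightarrow> real^3 \<Rightarrow> state \<Rightarrow> state" where
  "error_dynamics g k1v k2v k1r k2r mI = (\<lambda>(v, R).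
     (g *\<^sub>R ((mat 1 - R) *v e3) - sigma_v k1v k2v v (R *v e3),
      (- skew (sigma_R k1r k2r v (R *v e3) mI (R *v mI))) ** R))"

text \<open>The time signals \<open>(v, R)\<close> solve the vehicle equations for all times \<open>t \<ge> 0\<close>, and
  \<open>(vh, Rh)\<close> those of the observer fed with the measurements \<open>v\<close>, \<open>\<omega>\<close>, \<open>aB\<close> and
  \<open>mB = R\<^sup>T mI\<close>.\<close>

definition vehicle_trajectory ::
  "real \<Rightarrow> (real \<Rightarrow> real^3) \<Rightarrow> (real \<Rightarrow> real^3) \<Rightarrow>
   (real \<Rightarrow> real^3) \<Rightarrow> (real \<Rightarrow> real^3^3) \<Rightarrow> bool" where
  "vehicle_trajectory g \<omega> aB v R \<longleftrightarrow>
     ode_solution (vehicle g \<omega> aB) state_space {0..} (\<lambda>t. (v t, R t))"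

definition observer_trajectory ::
  "real \<Rightarrow> real \<Rightarrow> real \<Rightarrow> real \<Rightarrow> real \<Rightarrow> real^3 \<Rightarrow>
   (real \<Rightarrow> real^3) \<Rightarrow> (real \<Rightarrow> real^3) \<Rightarrow> (real \<Rightarrow> real^3) \<Rightarrow> (real \<Rightarrow> real^3^3) \<Rightarrow>
   (real \<Rightarrow> real^3) \<Rightarrow> (real \<Rightarrow> real^3^3) \<Rightarrow> bool" where
  "observer_trajectory g k1v k2v k1r k2r mI \<omega> aB v R vh Rh \<longleftrightarrow>
     ode_solution (observer g k1v k2v k1r k2r mI v \<omega> aB (\<lambda>t. transpose (R t) *v mI))
       state_space {0..} (\<lambda>t. (vh t, Rh t))"

end

theory Submission
  imports Defs
begin

text \<open>Write \<open>\<gamma> = R e\<^sub>3\<close>, \<open>b = g / k\<^sub>1\<^sup>v\<close> and \<open>z = v + b (\<gamma> - e\<^sub>3)\<close>. The pair \<open>(z, \<gamma>)\<close> evolves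
  autonomously, with \<open>z' = - k\<^sub>1\<^sup>v z - d h\<close> and \<open>\<gamma>' = k\<^sub>1\<^sup>r h\<close>, where \<open>h\<close> is the component of
  \<open>v\<close> orthogonal to \<open>\<gamma>\<close> and \<open>d = k\<^sub>2\<^sup>v - b k\<^sub>1\<^sup>r\<close> is nonnegative by the gain condition. Hence
  \<open>V = |z|\<^sup>2 / 2 + \<mu> (1 - \<gamma> \<bullet> e\<^sub>3)\<close> decreases strictly for a suitable \<open>\<mu>\<close>, and \<open>z \<rightarrow> 0\<close>,
  \<open>\<gamma> \<rightarrow> \<plusminus> e\<^sub>3\<close>. If \<open>\<gamma> \<rightarrow> e\<^sub>3\<close>, then \<open>V\<close> decays exponentially and \<open>m \<bullet> R m\<close> is nondecreasing up
  to an integrable error, so that the yaw angle tends to \<open>0\<close> or \<open>\<pi>\<close>.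

  The quadratic form that \<open>V\<close> induces on differences of solutions, and its combination with the
  square of the yaw coordinate, are strictly monotone near each equilibrium. At the desired one the
  form is definite, which gives exponential stability. At the others it is indefinite: this gives
  instability, and confines the solutions that remain nearby to a Lipschitz graph of lower
  dimension. The flow is Lipschitz backwards in time, hence the basins of these equilibria are null.\<close>

section \<open>Differential inequalities\<close>

text \<open>The offset b (\<gamma> - e3) in z absorbs gravity, since k1v b = g, and the magnetic
  correction is parallel to \<gamma>, so yaw drops out of the equations for (z, \<gamma>). Yaw in
  turn is driven by this pair, with a coupling that need not be small. As the coupling is
  triangular, a large weight on the form in (z, \<gamma>) absorbs it.

  No linearisation is taken. The local estimates are made for the difference of two states near an
  equilibrium. Comparison with the equilibrium itself gives decay or escape; comparison of two
  solutions that both stay nearby gives a cone condition, and this makes their states a Lipschitz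
  graph.

  At \<gamma> = -e3 the form in (z, \<gamma>) alone is already indefinite. The behaviour of yaw is
  therefore not studied there, and the basins of both inverted equilibria are treated at once. Null
  sets are transported as Lipschitz images, backwards along the flow and through the inverse of the
  Cayley transform.\<close>

lemma derivative_nonneg_imp_mono:
  fixes \<phi> \<phi>' :: "real \<Rightarrow> real"
  assumes "\<And>t. t \<in> {a..b} \<Longrightarrow> (\<phi> has_real_derivative \<phi>' t) (at t within J)"
    and "\<And>t. t \<in> {a..b} \<Longrightarrow> 0 \<le> \<phi>' t" and "a \<le> b" "{a..b} \<subseteq> J"
  shows "\<phi> a \<le> \<phi> b"
proof -
  have "\<exists>t\<in>{a..b}. \<phi> b - \<phi> a = (*) (\<phi>' t) (b - a)"
    using assms(3) DERIV_subset[OF assms(1,4)]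
    by (intro mvt_very_simple) (auto simp: has_field_derivative_def)
  then obtain t where "t \<in> {a..b}" "\<phi> b - \<phi> a = \<phi>' t * (b - a)" by auto
  moreover have "0 \<le> \<phi>' t * (b - a)" using assms calculation(1) by simp
  ultimately show ?thesis by simp
qed

text \<open>The product \<open>\<phi> t * exp (- k * t)\<close> is nonincreasing. Neither
  \<open>\<phi>\<close> nor \<open>k\<close> has a prescribed sign: negative \<open>k\<close> gives
  decay, and negative \<open>\<phi>\<close> with positive \<open>k\<close> gives exponential growth
  of its absolute value.\<close>

lemma exponential_bound:
  fixes \<phi> \<phi>' :: "real \<Rightarrow> real"
  assumes "\<And>t. t \<in> {a..b} \<Longrightarrow> (\<phi> has_real_derivative \<phi>' t) (at t within J)"
    and "\<And>t. t \<in> {a..b} \<Longrightarrow> \<phi>' t \<le> k * \<phi> t" and "a \<le> b" "{a..b} \<subseteq> J"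
  shows "\<phi> b \<le> \<phi> a * exp (k * (b - a))"
proof -
  have "- (\<phi> a * exp (- k * a)) \<le> - (\<phi> b * exp (- k * b))"
  proof (rule derivative_nonneg_imp_mono[where \<phi> = "\<lambda>t. - (\<phi> t * exp (- k * t))"])
    fix t assume t: "t \<in> {a..b}"
    show "((\<lambda>t. - (\<phi> t * exp (- k * t))) has_real_derivative (k * \<phi> t - \<phi>' t) * exp (- k * t))
        (at t within J)"
      by (rule derivative_eq_intros assms(1)[OF t] refl)+ (simp add: algebra_simps)
    show "0 \<le> (k * \<phi> t - \<phi>' t) * exp (- k * t)" using assms(2)[OF t] by simp
  qed fact+
  then have "\<phi> b * exp (- k * b) * exp (k * b) \<le> \<phi> a * exp (- k * a) * exp (k * b)"
    by (intro mult_right_mono) auto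
  then show ?thesis by (simp add: mult.assoc flip: exp_add) (simp add: algebra_simps)
qed

text \<open>A value \<open>w t \<ge> e\<close> persists above \<open>e / 2\<close> for a time
  \<open>e / (2 * L')\<close>, during which \<open>V\<close> falls by a fixed amount. This is
  impossible once \<open>V\<close> is closer than that to its infimum. The limit of \<open>V\<close>
  is kept as a second conclusion because vanishing dissipation alone does not tell which zero of it
  is approached.\<close>

lemma Barbalat:
  fixes V V' w w' :: "real \<Rightarrow> real"
  assumes V: "\<And>t. 0 \<le> t \<Longrightarrow> (V has_real_derivative V' t) (at t within {0..})"
    and V': "\<And>t. 0 \<le> t \<Longrightarrow> V' t \<le> - w t" and low: "\<And>t. 0 \<le> t \<Longrightarrow> m \<le> V t"
    and w: "\<And>t. 0 \<le> t \<Longrightarrow> (w has_real_derivative w' t) (at t within {0..})"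
    and L: "\<And>t. 0 \<le> t \<Longrightarrow> \<bar>w' t\<bar> \<le> L" and pos: "\<And>t. 0 \<le> t \<Longrightarrow> 0 \<le> w t"
  shows "(w \<longlongrightarrow> 0) at_top" "\<exists>l. (V \<longlongrightarrow> l) at_top"
proof -
  have dec: "V b \<le> V a" if "0 \<le> a" "a \<le> b" for a b
  proof -
    have "- V a \<le> - V b"
    proof (rule derivative_nonneg_imp_mono[where J = "{0..}" and \<phi> = "\<lambda>t. - V t"])
      fix t assume "t \<in> {a..b}"
      then have t: "0 \<le> t" using that by auto
      show "((\<lambda>t. - V t) has_real_derivative - V' t) (at t within {0..})"
        by (intro DERIV_minus V t)
      show "0 \<le> - V' t" using V'[OF t] pos[OF t] by simp
    qed (use that in auto)
    then show ?thesis by simp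
  qed
  define l where "l = Inf (V ` {0..})"
  have bdd: "bdd_below (V ` {0..})" using low by (auto intro!: bdd_belowI)
  have ge: "l \<le> V t" if "0 \<le> t" for t
    unfolding l_def using bdd that by (intro cInf_lower) auto
  have ev: "\<exists>T\<ge>0. \<forall>t\<ge>T. V t < l + e" if "0 < e" for e
  proof -
    have "\<exists>x\<in>V ` {0..}. x < l + e"
      using that bdd unfolding l_def by (subst cInf_less_iff[symmetric]) auto
    then obtain T where "0 \<le> T" "V T < l + e" by auto
    then show ?thesis using dec by (intro exI[of _ T]) (auto dest: le_less_trans)
  qed
  have "(V \<longlongrightarrow> l) at_top"
  proof (rule tendstoI)
    fix e :: real assume "0 < e"
    then obtain T where T: "T \<ge> 0" "\<forall>t\<ge>T. V t < l + e" using ev by blast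
    show "\<forall>\<^sub>F t in at_top. dist (V t) l < e"
      using eventually_ge_at_top[of T]
    proof eventually_elim
      case (elim t)
      then show ?case using ge[of t] T by (auto simp: dist_real_def)
    qed
  qed
  then show "\<exists>l. (V \<longlongrightarrow> l) at_top" ..
  show "(w \<longlongrightarrow> 0) at_top"
  proof (rule tendstoI)
    fix e :: real assume e: "0 < e"
    \<comment> \<open>The bound \<open>L\<close> may be zero; the maximum with 1 allows the division
      by \<open>L'\<close>.\<close>
    define L' where "L' = max L 1"
    have L': "L' > 0" "L \<le> L'" by (auto simp: L'_def)
    define h where "h = e / (2 * L')"
    have h: "0 < h" "L' * h = e / 2" using e L' by (auto simp: h_def)
    then have "0 < e / 2 * h" using e by simp
    then obtain T where T: "T \<ge> 0" "\<forall>t\<ge>T. V t < l + e / 2 * h" using ev by blast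
    have "w t < e" if Tt: "T \<le> t" for t
    proof (rule ccontr)
      assume "\<not> w t < e"
      have lowb: "e / 2 \<le> w s" if s: "s \<in> {t..t+h}" for s
      proof -
        have "w t + L' * t \<le> w s + L' * s"
        proof (rule derivative_nonneg_imp_mono[where J = "{0..}" and \<phi> = "\<lambda>t. w t + L' * t"])
          fix r assume "r \<in> {t..s}"
          then have r: "0 \<le> r" using Tt T by auto
          show "((\<lambda>t. w t + L' * t) has_real_derivative w' r + L') (at r within {0..})"
            by (rule derivative_eq_intros w[OF r] refl)+ simp
          show "0 \<le> w' r + L'" using L[OF r] L' by linarith
        qed (use Tt T s in auto)
        moreover have "L' * (s - t) \<le> L' * h" using s L' by (intro mult_left_mono) auto
        ultimately show ?thesis using \<open>\<not> w t < e\<close> h by (simp add: algebra_simps)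
      qed
      have "- V t - e / 2 * t \<le> - V (t+h) - e / 2 * (t+h)"
      proof (rule derivative_nonneg_imp_mono[where J = "{0..}" and \<phi> = "\<lambda>t. - V t - e / 2 * t"])
        fix r assume r': "r \<in> {t..t+h}"
        then have r: "0 \<le> r" using Tt T by auto
        show "((\<lambda>t. - V t - e / 2 * t) has_real_derivative - V' r - e / 2) (at r within {0..})"
          by (rule derivative_eq_intros V[OF r] refl)+ simp
        show "0 \<le> - V' r - e / 2" using V'[OF r] lowb[OF r'] by linarith
      qed (use that T h in auto)
      then have "V (t+h) \<le> V t - e / 2 * h" by (simp add: field_simps)
      also have "\<dots> < l" using T that by auto
      also have "\<dots> \<le> V (t+h)" using T that h by (intro ge) auto
      finally show False by simp
    qed
    then show "\<forall>\<^sub>F t in at_top. dist (w t) 0 < e"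
      using T pos by (intro eventually_at_top_linorderI[of T]) (auto simp: dist_real_def)
  qed
qed

section \<open>Global solutions of Lipschitz equations\<close>

lemma integral_has_vector_derivative_atLeast:
  fixes h :: "real \<Rightarrow> 'a::banach"
  assumes "continuous_on UNIV h" "0 \<le> t"
  shows "((\<lambda>u. integral {0..u} h) has_vector_derivative h t) (at t within {0..})"
proof -
  have "((\<lambda>u. integral {0..u} h) has_vector_derivative h t) (at t within {0..t+1})"
    using assms by (intro integral_has_vector_derivative) (auto intro: continuous_on_subset)
  moreover have "at t within {0..t+1} = at t within {0..}"
    by (rule at_within_nhd[of _ "{..<t+1}"]) (use assms in auto)
  ultimately show ?thesis by simp
qed

text \<open>Picard iteration is a contraction on all of \<open>[0, \<infinity>)\<close> for the norm
  \<open>sup\<^sub>t exp (- 2 L t) |x t|\<close>; its fixed point is found as a bounded continuous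
  function after rescaling by this weight.\<close>

lemma global_solution_exists:
  fixes F :: "'a::euclidean_space \<Rightarrow> 'a"
  assumes lip: "\<And>x y. norm (F x - F y) \<le> L * norm (x - y)" and bound: "\<And>x. norm (F x) \<le> B"
    and L: "0 < L"
  shows "\<exists>x. x 0 = p \<and> (\<forall>t\<ge>0. (x has_vector_derivative F (x t)) (at t within {0..}))"
proof -
  have cF: "continuous_on UNIV F"
    by (rule lipschitz_on_continuous_on[of L]) (use lip L in \<open>auto intro!: lipschitz_onI simp: dist_norm\<close>)
  define w where "w t = exp (2 * L * t)" for t :: real
  have w_pos: "0 < w t" for t by (simp add: w_def)
  have cw: "continuous_on UNIV w" unfolding w_def by (intro continuous_intros)
  define h where "h y s = F (w s *\<^sub>R apply_bcontfun y s)" for y :: "real \<Rightarrow>\<^sub>C 'a" and s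
  have ch: "continuous_on S (h y)" for y S
    unfolding h_def
    by (rule continuous_on_compose2[OF cF])
      (auto intro!: continuous_intros continuous_on_subset[OF cw])
  \<comment> \<open>Bounded continuous functions live on the whole line, so for negative
    \<open>t\<close> the iterate is frozen at its value at time 0.\<close>
  define \<Phi> where "\<Phi> y t = (1 / w (max 0 t)) *\<^sub>R (p + integral {0..max 0 t} (h y))" for y t
  have \<Phi>_bcontfun: "\<Phi> y \<in> bcontfun" for y
  proof (rule bcontfun_normI)
    have c: "continuous_on {0..} (\<lambda>u. integral {0..u} (h y))"
      using integral_has_vector_derivative_atLeast[OF ch]
      by (intro continuous_on_vector_derivative) auto
    have "continuous_on UNIV (\<lambda>t. integral {0..max 0 t} (h y))"
      by (rule continuous_on_compose2[OF c]) (auto intro!: continuous_intros)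
    moreover have "continuous_on UNIV (\<lambda>t. w (max 0 t))"
      by (rule continuous_on_compose2[OF cw]) (auto intro!: continuous_intros)
    ultimately show "continuous_on UNIV (\<Phi> y)"
      unfolding \<Phi>_def using w_pos by (intro continuous_intros) (auto simp: less_le)
    fix t :: real
    define s where "s = max 0 t"
    have s: "0 \<le> s" by (simp add: s_def)
    have "norm (integral {0..s} (h y)) \<le> integral {0..s} (\<lambda>_. B)"
      by (intro integral_norm_bound_integral integrable_continuous_real ch continuous_intros)
        (auto simp: h_def bound)
    then have I: "norm (integral {0..s} (h y)) \<le> B * s" using s by (simp add: mult.commute)
    have B: "0 \<le> B" using bound[of 0] norm_ge_zero order_trans by blast
    have "0 \<le> 2 * L * s" using L s by simp
    then have ws: "1 \<le> w s" "2 * L * s \<le> w s"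
      using exp_ge_add_one_self[of "2 * L * s"] unfolding w_def by linarith+
    have "norm (\<Phi> y t) = norm (p + integral {0..s} (h y)) / w s"
      unfolding \<Phi>_def s_def[symmetric] using w_pos[of s] by (simp add: divide_simps)
    also have "\<dots> \<le> (norm p + B * s) / w s"
      using norm_triangle_ineq[of p "integral {0..s} (h y)"] I w_pos[of s]
      by (intro divide_right_mono) auto
    also have "\<dots> \<le> norm p + B / (2 * L)"
    proof -
      have "norm p * 1 \<le> norm p * w s" using ws by (intro mult_left_mono) auto
      moreover have "B / (2 * L) * (2 * L * s) \<le> B / (2 * L) * w s"
        using ws B L by (intro mult_left_mono) auto
      ultimately have "norm p + B * s \<le> (norm p + B / (2 * L)) * w s"
        using L by (simp add: distrib_right)
      then show ?thesis using w_pos[of s] by (simp add: pos_divide_le_eq)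
    qed
    finally show "norm (\<Phi> y t) \<le> norm p + B / (2 * L)" .
  qed
  define \<Psi> where "\<Psi> y = Bcontfun (\<Phi> y)" for y
  have \<Psi>: "apply_bcontfun (\<Psi> y) = \<Phi> y" for y
    unfolding \<Psi>_def by (rule Bcontfun_inverse[OF \<Phi>_bcontfun])
  have "dist (\<Psi> y1) (\<Psi> y2) \<le> 1 / 2 * dist y1 y2" for y1 y2
  proof (rule dist_bound)
    fix t :: real
    define s where "s = max 0 t"
    have s: "0 \<le> s" by (simp add: s_def)
    define D where "D = dist y1 y2"
    have "norm (integral {0..s} (\<lambda>r. h y1 r - h y2 r)) \<le> integral {0..s} (\<lambda>r. L * w r * D)"
    proof (intro integral_norm_bound_integral integrable_continuous_real continuous_intros ch
        continuous_on_subset[OF cw])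
      fix r assume "r \<in> {0..s}"
      have "norm (h y1 r - h y2 r) \<le> L * norm (w r *\<^sub>R apply_bcontfun y1 r - w r *\<^sub>R apply_bcontfun y2 r)"
        unfolding h_def by (rule lip)
      also have "\<dots> = L * w r * dist (apply_bcontfun y1 r) (apply_bcontfun y2 r)"
        using w_pos[of r] by (simp add: dist_norm flip: scaleR_diff_right)
      also have "\<dots> \<le> L * w r * D"
        unfolding D_def using L w_pos[of r] by (intro mult_left_mono dist_bounded) auto
      finally show "norm (h y1 r - h y2 r) \<le> L * w r * D" .
    qed auto
    \<comment> \<open>The rate \<open>2 * L\<close> of the weight makes \<open>w / 2\<close> a
      primitive of \<open>L * w\<close>, which is where the contraction factor 1/2 comes
      from.\<close>
    also have "((\<lambda>r. L * w r * D) has_integral (D / 2 * w s - D / 2 * w 0)) {0..s}"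
      by (rule fundamental_theorem_of_calculus)
        (use s in \<open>auto simp: w_def intro!: derivative_eq_intros simp flip: has_real_derivative_iff_has_vector_derivative\<close>)
    then have "integral {0..s} (\<lambda>r. L * w r * D) = D / 2 * w s - D / 2 * w 0"
      by (rule integral_unique)
    also have "\<dots> \<le> w s * (D / 2)"
      by (simp add: w_def D_def)
    finally have *: "norm (integral {0..s} (h y1) - integral {0..s} (h y2)) \<le> w s * (D / 2)"
      by (subst (asm) integral_diff) (auto intro!: integrable_continuous_real ch)
    have "dist (\<Phi> y1 t) (\<Phi> y2 t) = norm (integral {0..s} (h y1) - integral {0..s} (h y2)) / w s"
      unfolding \<Phi>_def s_def[symmetric] dist_norm scaleR_diff_right[symmetric]
      using w_pos[of s] by simp
    also have "\<dots> \<le> D / 2"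
      using * w_pos[of s] by (simp add: divide_le_eq mult.commute)
    finally show "dist (apply_bcontfun (\<Psi> y1) t) (apply_bcontfun (\<Psi> y2) t) \<le> 1 / 2 * dist y1 y2"
      by (simp add: \<Psi> D_def)
  qed
  then obtain y where y: "\<Psi> y = y"
    using banach_fix_type[of "1/2" \<Psi>] by auto
  define x where "x t = w t *\<^sub>R apply_bcontfun y t" for t
  have x: "x t = p + integral {0..t} (h y)" if "0 \<le> t" for t
    using \<Psi>[of y] w_pos[of t] that by (simp add: x_def y \<Phi>_def)
  have "(x has_vector_derivative F (x t)) (at t within {0..})" if "0 \<le> t" for t
  proof -
    have "((\<lambda>t. p + integral {0..t} (h y)) has_vector_derivative h y t) (at t within {0..})"
      using integral_has_vector_derivative_atLeast[OF ch that, of y]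
      by (auto intro!: derivative_eq_intros)
    then have "(x has_vector_derivative h y t) (at t within {0..})"
      by (rule has_vector_derivative_transform[rotated 2]) (use that x in auto)
    then show ?thesis by (simp add: h_def x_def)
  qed
  moreover have "x 0 = p" using x[of 0] by simp
  ultimately show ?thesis by blast
qed

text \<open>Global Lipschitz continuity is lost under products, and the error dynamics are
  polynomial. Lipschitz continuity on every bounded set survives bilinear operations, so it can be
  read off from the shape of the field.\<close>

definition bounded_lipschitz :: "('a::metric_space \<Rightarrow> 'b::metric_space) \<Rightarrow> bool" where
  "bounded_lipschitz f \<longleftrightarrow> (\<forall>S. bounded S \<longrightarrow> (\<exists>L. L-lipschitz_on S f))"

lemma bounded_lipschitz_linear:
  assumes "bounded_linear f"
  shows "bounded_lipschitz f"
  using bounded_linear.lipschitz_boundE[OF assms] unfolding bounded_lipschitz_def by metis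

lemma bounded_lipschitz_const: "bounded_lipschitz (\<lambda>x. c)"
  unfolding bounded_lipschitz_def by (metis lipschitz_on_constant)

lemma bounded_lipschitz_add:
  fixes f h :: "'a::metric_space \<Rightarrow> 'b::real_normed_vector"
  assumes "bounded_lipschitz f" "bounded_lipschitz h"
  shows "bounded_lipschitz (\<lambda>x. f x + h x)"
  using assms unfolding bounded_lipschitz_def by (metis lipschitz_on_add)

lemma bounded_lipschitz_minus:
  fixes f h :: "'a::metric_space \<Rightarrow> 'b::real_normed_vector"
  assumes "bounded_lipschitz f"
  shows "bounded_lipschitz (\<lambda>x. - f x)"
  using assms unfolding bounded_lipschitz_def by (metis lipschitz_on_minus)

lemma bounded_lipschitz_diff:
  fixes f h :: "'a::metric_space \<Rightarrow> 'b::real_normed_vector"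
  assumes "bounded_lipschitz f" "bounded_lipschitz h"
  shows "bounded_lipschitz (\<lambda>x. f x - h x)"
  using assms unfolding bounded_lipschitz_def by (metis lipschitz_on_diff)

lemma bounded_lipschitz_Pair:
  assumes "bounded_lipschitz f" "bounded_lipschitz h"
  shows "bounded_lipschitz (\<lambda>x. (f x, h x))"
  using assms unfolding bounded_lipschitz_def by (metis lipschitz_on_Pair)

text \<open>Supplies the bound on the undifferenced factor in the Lipschitz estimate for
  products.\<close>

lemma bounded_lipschitz_bound:
  fixes f :: "'a::metric_space \<Rightarrow> 'b::real_normed_vector"
  assumes "bounded_lipschitz f" "bounded S"
  obtains K where "0 \<le> K" "\<And>x. x \<in> S \<Longrightarrow> norm (f x) \<le> K"
proof -
  obtain L where L: "L-lipschitz_on S f" using assms unfolding bounded_lipschitz_def by blast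
  show ?thesis
  proof (cases "S = {}")
    case True
    then show ?thesis using that[of 0] by simp
  next
    case False
    then obtain a where a: "a \<in> S" by blast
    obtain r where r: "\<And>x. x \<in> S \<Longrightarrow> dist a x \<le> r"
      using assms(2) unfolding bounded_any_center[where a = a] by blast
    have "norm (f x) \<le> norm (f a) + L * r" if "x \<in> S" for x
    proof -
      have "dist (f x) (f a) \<le> L * dist x a" using L that a by (rule lipschitz_onD)
      also have "\<dots> \<le> L * r"
        using r[OF that] lipschitz_on_nonneg[OF L] by (intro mult_left_mono) (auto simp: dist_commute)
      finally show ?thesis using norm_triangle_sub[of "f x" "f a"] by (simp add: dist_norm)
    qed
    then have "norm (f x) \<le> max 0 (norm (f a) + L * r)" if "x \<in> S" for x
      using that by (simp add: le_max_iff_disj)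
    then show ?thesis using that[of "max 0 (norm (f a) + L * r)"] by simp
  qed
qed

lemma bounded_lipschitz_bilinear:
  fixes f :: "'d::metric_space \<Rightarrow> 'a::real_normed_vector" and h :: "'d \<Rightarrow> 'b::real_normed_vector"
    and pr :: "'a \<Rightarrow> 'b \<Rightarrow> 'c::real_normed_vector"
  assumes "bounded_bilinear pr" "bounded_lipschitz f" "bounded_lipschitz h"
  shows "bounded_lipschitz (\<lambda>x. pr (f x) (h x))"
  unfolding bounded_lipschitz_def
proof (intro allI impI)
  interpret bounded_bilinear pr by fact
  fix S :: "'d set" assume S: "bounded S"
  obtain Lf Lh where L: "Lf-lipschitz_on S f" "Lh-lipschitz_on S h"
    using assms S unfolding bounded_lipschitz_def by metis
  obtain Kf where Kf: "0 \<le> Kf" "\<And>x. x \<in> S \<Longrightarrow> norm (f x) \<le> Kf"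
    using bounded_lipschitz_bound[OF assms(2) S] by metis
  obtain Kh where Kh: "0 \<le> Kh" "\<And>x. x \<in> S \<Longrightarrow> norm (h x) \<le> Kh"
    using bounded_lipschitz_bound[OF assms(3) S] by metis
  obtain K where K: "0 \<le> K" "\<And>a b. norm (pr a b) \<le> norm a * norm b * K"
    using nonneg_bounded by blast
  have Lpos: "0 \<le> Lf" "0 \<le> Lh" using L lipschitz_on_nonneg by auto
  have "(Lf * Kh * K + Kf * Lh * K)-lipschitz_on S (\<lambda>x. pr (f x) (h x))"
  proof (rule lipschitz_onI)
    fix x y assume xy: "x \<in> S" "y \<in> S"
    have "pr (f x) (h x) - pr (f y) (h y) = pr (f x - f y) (h x) + pr (f y) (h x - h y)"
      by (simp add: diff_left diff_right)
    then have "dist (pr (f x) (h x)) (pr (f y) (h y)) \<le>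
        norm (pr (f x - f y) (h x)) + norm (pr (f y) (h x - h y))"
      by (simp add: dist_norm norm_triangle_ineq)
    also have "\<dots> \<le> (Lf * dist x y) * Kh * K + Kf * (Lh * dist x y) * K"
      using L[THEN lipschitz_onD, OF xy] Kf Kh K xy Lpos
      by (intro add_mono order.trans[OF K(2)] mult_mono mult_nonneg_nonneg)
        (auto simp: dist_norm)
    finally show "dist (pr (f x) (h x)) (pr (f y) (h y)) \<le> (Lf * Kh * K + Kf * Lh * K) * dist x y"
      by (simp add: algebra_simps)
  qed (use Lpos Kf Kh K in auto)
  then show "\<exists>L. L-lipschitz_on S (\<lambda>x. pr (f x) (h x))" ..
qed

text \<open>The field is multiplied by a factor that is 1 on the ball of radius \<open>r\<close> and
  0 outside radius \<open>2 * r\<close>, which makes it bounded and globally Lipschitz. The factor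
  stays visible as a nonnegative scalar \<open>c t\<close>, so that conserved quantities and
  decreasing functions of \<open>f\<close> can be followed before it is known that
  \<open>c t = 1\<close>.\<close>

lemma cutoff_solution_exists:
  fixes f :: "'a::euclidean_space \<Rightarrow> 'a"
  assumes f: "bounded_lipschitz f" and r: "0 < r"
  shows "\<exists>x c. x 0 = p \<and> (\<forall>t\<ge>0. 0 \<le> c t \<and> (norm (x t) \<le> r \<longrightarrow> c t = (1::real)) \<and>
    (x has_vector_derivative c t *\<^sub>R f (x t)) (at t within {0..}))"
proof -
  define \<kappa> where "\<kappa> x = max 0 (min 1 (2 - norm x / r))" for x :: 'a
  have \<kappa>: "0 \<le> \<kappa> x" "\<kappa> x \<le> 1" for x by (auto simp: \<kappa>_def)
  have \<kappa>_lip: "\<bar>\<kappa> x - \<kappa> y\<bar> \<le> norm (x - y) / r" for x y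
  proof -
    have "\<bar>\<kappa> x - \<kappa> y\<bar> \<le> \<bar>norm x / r - norm y / r\<bar>" by (auto simp: \<kappa>_def)
    also have "\<dots> = \<bar>norm x - norm y\<bar> / r" using r by (simp flip: diff_divide_distrib)
    also have "\<dots> \<le> norm (x - y) / r" using r by (intro divide_right_mono norm_triangle_ineq3) auto
    finally show ?thesis .
  qed
  define S where "S = cball (0::'a) (2 * r)"
  have S: "bounded S" by (simp add: S_def)
  have out: "\<kappa> x = 0" if "x \<notin> S" for x
    using that r by (auto simp: \<kappa>_def S_def field_simps)
  obtain L where "L-lipschitz_on S f" using f S unfolding bounded_lipschitz_def by blast
  then have L: "0 \<le> L" "\<And>x y. x \<in> S \<Longrightarrow> y \<in> S \<Longrightarrow> norm (f x - f y) \<le> L * norm (x - y)"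
    using lipschitz_on_nonneg lipschitz_on_normD by blast+
  obtain K where K: "0 \<le> K" "\<And>x. x \<in> S \<Longrightarrow> norm (f x) \<le> K"
    using bounded_lipschitz_bound[OF f S] by metis
  define F where "F x = \<kappa> x *\<^sub>R f x" for x
  \<comment> \<open>As \<open>\<kappa> y = 0\<close>, the difference \<open>F x - F y\<close> is the
    variation of \<open>\<kappa>\<close> times \<open>f x\<close>; no value of \<open>f\<close>
    outside \<open>S\<close> is involved.\<close>
  have one_out: "norm (F x - F y) \<le> K / r * norm (x - y)" if "x \<in> S" "y \<notin> S" for x y
  proof -
    have "norm (F x - F y) = \<bar>\<kappa> x - \<kappa> y\<bar> * norm (f x)" using out[OF that(2)] by (simp add: F_def)
    also have "\<dots> \<le> (norm (x - y) / r) * K" using K that r by (intro mult_mono \<kappa>_lip) auto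
    finally show ?thesis by (simp add: mult.commute)
  qed
  \<comment> \<open>The summand 1 keeps the Lipschitz constant positive even if \<open>L\<close> and
    \<open>K\<close> vanish.\<close>
  have "norm (F x - F y) \<le> (L + K / r + 1) * norm (x - y)" for x y
  proof (cases "x \<in> S"; cases "y \<in> S")
    assume xy: "x \<in> S" "y \<in> S"
    have "F x - F y = \<kappa> x *\<^sub>R (f x - f y) + (\<kappa> x - \<kappa> y) *\<^sub>R f y"
      by (simp add: F_def algebra_simps)
    then have "norm (F x - F y) \<le> \<kappa> x * norm (f x - f y) + \<bar>\<kappa> x - \<kappa> y\<bar> * norm (f y)"
      by (smt (verit) norm_triangle_ineq norm_scaleR \<kappa>)
    also have "\<dots> \<le> 1 * (L * norm (x - y)) + (norm (x - y) / r) * K"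
      using K L \<kappa> \<kappa>_lip xy r by (intro add_mono mult_mono) auto
    also have "\<dots> \<le> (L + K / r + 1) * norm (x - y)" by (simp add: algebra_simps)
    finally show ?thesis .
  next
    assume xy: "x \<in> S" "y \<notin> S"
    have "norm (F x - F y) \<le> K / r * norm (x - y)" by (rule one_out[OF xy])
    also have "\<dots> \<le> (L + K / r + 1) * norm (x - y)" using L by (intro mult_right_mono) auto
    finally show ?thesis .
  next
    assume xy: "x \<notin> S" "y \<in> S"
    have "norm (F y - F x) \<le> K / r * norm (y - x)" by (rule one_out[OF xy(2,1)])
    also have "\<dots> \<le> (L + K / r + 1) * norm (y - x)" using L by (intro mult_right_mono) auto
    finally show ?thesis by (simp add: norm_minus_commute)
  next
    assume xy: "x \<notin> S" "y \<notin> S"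
    then show ?thesis using out L K r by (auto simp: F_def)
  qed
  moreover have "norm (F x) \<le> K" for x
  proof (cases "x \<in> S")
    case True
    have "norm (F x) \<le> 1 * K" unfolding F_def norm_scaleR using \<kappa>[of x] K True by (intro mult_mono) auto
    then show ?thesis by simp
  qed (use out K in \<open>auto simp: F_def\<close>)
  moreover have "0 < L + K / r + 1" using L K r by (simp add: add_nonneg_pos)
  ultimately obtain x where x: "x 0 = p" "\<forall>t\<ge>0. (x has_vector_derivative F (x t)) (at t within {0..})"
    using global_solution_exists[of F "L + K / r + 1" K p] by blast
  have "\<kappa> (x t) = 1" if "norm (x t) \<le> r" for t using that r by (auto simp: \<kappa>_def field_simps)
  then show ?thesis using x \<kappa>(1) by (intro exI[of _ x] exI[of _ "\<lambda>t. \<kappa> (x t)"]) (auto simp: F_def)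
qed

text \<open>Keeps \<open>transpose R *v x\<close>, the inverse rotation applied to a column vector,
  in the form in which it is used throughout.\<close>

declare transpose_matrix_vector [simp del]

section \<open>Rotations and null sets\<close>

lemma bounded_bilinear_matrix_mult: "bounded_bilinear ((**) :: real^'n^'m \<Rightarrow> real^'k^'n \<Rightarrow> real^'k^'m)"
  unfolding bilinear_conv_bounded_bilinear[symmetric] bilinear_def
  by (intro conjI allI linearI)
    (simp_all add: matrix_add_ldistrib matrix_matrix_mult_def vec_eq_iff sum.distrib
      sum_distrib_left sum_distrib_right algebra_simps)

lemma bounded_bilinear_matrix_vector_mult: "bounded_bilinear ((*v) :: real^'n^'m \<Rightarrow> real^'n \<Rightarrow> real^'m)"
  unfolding bilinear_conv_bounded_bilinear[symmetric] bilinear_def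
  by (intro conjI allI linearI)
    (simp_all add: algebra_simps scaleR_matrix_vector_assoc)

lemma bounded_bilinear_cross: "bounded_bilinear ((\<times>) :: real^3 \<Rightarrow> real^3 \<Rightarrow> real^3)"
  using bilinear_cross bilinear_conv_bounded_bilinear by blast

interpretation matmul: bounded_bilinear "(**) :: real^3^3 \<Rightarrow> real^3^3 \<Rightarrow> real^3^3"
  by (rule bounded_bilinear_matrix_mult)

interpretation matvec: bounded_bilinear "(*v) :: real^3^3 \<Rightarrow> real^3 \<Rightarrow> real^3"
  by (rule bounded_bilinear_matrix_vector_mult)

interpretation cross: bounded_bilinear "(\<times>) :: real^3 \<Rightarrow> real^3 \<Rightarrow> real^3"
  by (rule bounded_bilinear_cross)

lemma matrix_eq3: "(\<And>w. A *v w = B *v w) \<Longrightarrow> A = B" for A B :: "real^3^3"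
  by (simp add: matrix_eq)

lemma bounded_linear_skew: "bounded_linear skew"
  unfolding linear_conv_bounded_linear[symmetric]
  by (intro linearI matrix_eq3)
    (simp_all add: skew_mult_vec matrix_vector_mult_add_rdistrib cross_add_left cross_mult_left
      flip: scaleR_matrix_vector_assoc)

lemmas skew_diff = linear_diff[OF bounded_linear.linear[OF bounded_linear_skew]]
  and skew_pos_bounded = bounded_linear.pos_bounded[OF bounded_linear_skew]

lemma bounded_linear_transpose: "bounded_linear (transpose :: real^3^3 \<Rightarrow> real^3^3)"
  unfolding linear_conv_bounded_linear[symmetric]
  by (intro linearI) (simp_all add: transpose_def vec_eq_iff)

lemma transpose_mult_dot: "(transpose A *v x) \<bullet> y = x \<bullet> (A *v y)" for A :: "real^3^3"
  by (simp add: transpose_matrix_vector dot_lmul_matrix)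

lemma transpose_skew: "transpose (skew u) = - skew u"
proof (rule matrix_eq3, rule vector_eq_rdot[THEN iffD1], rule allI)
  fix w y
  have "(transpose (skew u) *v w) \<bullet> y = w \<bullet> (u \<times> y)" by (simp add: transpose_mult_dot skew_mult_vec)
  also have "\<dots> = - (u \<times> w) \<bullet> y" by (simp add: cross3_simps)
  finally show "(transpose (skew u) *v w) \<bullet> y = ((- skew u) *v w) \<bullet> y"
    by (simp add: matvec.minus_left skew_mult_vec)
qed

section \<open>Rotations as isometries\<close>

lemma
  assumes "R \<in> SO3"
  shows SO3_transpose_mult: "transpose R ** R = mat 1"
    and SO3_mult_transpose: "R ** transpose R = mat 1"
    and SO3_cross: "(R *v x) \<times> (R *v y) = R *v (x \<times> y)"
  using assms cross_rotation_matrix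
  by (auto simp: SO3_def rotation_matrix_def orthogonal_matrix_def)

lemma SO3_transpose: "R \<in> SO3 \<Longrightarrow> transpose R \<in> SO3"
  by (simp add: SO3_def rotation_matrix_def)

lemma SO3_mult: "R \<in> SO3 \<Longrightarrow> S \<in> SO3 \<Longrightarrow> R ** S \<in> SO3"
  by (simp add: SO3_def rotation_matrix_def orthogonal_matrix_mul det_mul)

lemma SO3_mat1: "mat 1 \<in> SO3"
  by (simp add: SO3_def rotation_matrix_def orthogonal_matrix_def)

lemma
  assumes "R \<in> SO3"
  shows SO3_dot: "(R *v x) \<bullet> (R *v y) = x \<bullet> y"
    and SO3_norm: "norm (R *v x) = norm x"
    and SO3_transpose_cancel: "transpose R *v (R *v x) = x"
    and SO3_cancel: "R *v (transpose R *v x) = x"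
proof -
  show *: "transpose R *v (R *v x) = x" for x
    using SO3_transpose_mult[OF assms] by (simp add: matrix_vector_mul_assoc)
  show "R *v (transpose R *v x) = x"
    using SO3_mult_transpose[OF assms] by (simp add: matrix_vector_mul_assoc)
  show "(R *v x) \<bullet> (R *v y) = x \<bullet> y" for x y
    using transpose_mult_dot[of R "R *v x" y] by (simp add: *)
  then show "norm (R *v x) = norm x" by (simp add: norm_eq_sqrt_inner)
qed

text \<open>Rotations preserve the cross product, so conjugating by \<open>R\<close> amounts to
  rotating the axis.\<close>

lemma SO3_skew_conj: "R \<in> SO3 \<Longrightarrow> R ** skew u ** transpose R = skew (R *v u)"
  by (rule matrix_eq3)
    (metis SO3_cancel SO3_cross matrix_vector_mul_assoc skew_mult_vec)

section \<open>The Cayley chart\<close>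

lemma norm_matrix_mult_le:
  obtains K where "0 < K" "\<And>(A::real^3^3) (B::real^3^3). norm (A ** B) \<le> norm A * norm B * K"
  using matmul.pos_bounded by blast

text \<open>A vector in the kernel satisfies \<open>x = b \<times> x\<close> and is thus orthogonal
  to itself. The Cayley transform is therefore defined at every \<open>b\<close>.\<close>

lemma mat1_minus_skew_inverse: "matrix_inv (mat 1 - skew b) ** (mat 1 - skew b) = mat 1"
    "(mat 1 - skew b) ** matrix_inv (mat 1 - skew b) = mat 1"
proof -
  have "x = 0" if "(mat 1 - skew b) *v x = 0" for x
  proof -
    have "x = b \<times> x" using that by (simp add: matvec.diff_left skew_mult_vec)
    then have "x \<bullet> x = 0" by (metis dot_cross_self(2))
    then show ?thesis by simp
  qed
  then obtain B where "B ** (mat 1 - skew b) = mat 1"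
    using matrix_left_invertible_ker by blast
  then have "invertible (mat 1 - skew b)"
    unfolding invertible_def using matrix_left_right_inverse by blast
  then have "\<exists>A'. (mat 1 - skew b) ** A' = mat 1 \<and> A' ** (mat 1 - skew b) = mat 1"
    by (simp add: invertible_def)
  from someI_ex[OF this, folded matrix_inv_def]
  show "matrix_inv (mat 1 - skew b) ** (mat 1 - skew b) = mat 1"
    "(mat 1 - skew b) ** matrix_inv (mat 1 - skew b) = mat 1" by auto
qed

text \<open>The outer factors clear both inverses, since \<open>mat 1 + skew c\<close> commutes with
  the inverse of \<open>mat 1 - skew c\<close>. The difference of parameters is thus expressed
  exactly through the difference of rotations.\<close>

lemma skew_diff_eq_cayley_diff:
  "2 *\<^sub>R (skew b - skew c) =
    (mat 1 - skew c) ** (cayley b - cayley c) ** (mat 1 - skew b)"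
proof -
  define Ib Ic where "Ib = matrix_inv (mat 1 - skew b)" and "Ic = matrix_inv (mat 1 - skew c)"
  have I: "Ib ** (mat 1 - skew b) = mat 1" "(mat 1 - skew c) ** Ic = mat 1"
      "Ic ** (mat 1 - skew c) = mat 1"
    unfolding Ib_def Ic_def by (rule mat1_minus_skew_inverse)+
  have "(mat 1 - skew c) ** (mat 1 + skew c) = (mat 1 + skew c) ** (mat 1 - skew c)"
    by (simp add: matmul.diff_left matmul.diff_right matmul.add_left matmul.add_right)
  then have comm: "(mat 1 - skew c) ** (mat 1 + skew c) ** Ic = mat 1 + skew c"
    by (metis I(2) matrix_mul_assoc matrix_mul_rid)
  have "(mat 1 - skew c) ** (cayley b - cayley c) ** (mat 1 - skew b) =
      (mat 1 - skew c) ** (mat 1 + skew b) ** (Ib ** (mat 1 - skew b)) -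
      (mat 1 - skew c) ** (mat 1 + skew c) ** Ic ** (mat 1 - skew b)"
    unfolding cayley_def Ib_def[symmetric] Ic_def[symmetric]
    by (simp add: matmul.diff_left matmul.diff_right matmul.add_left matmul.add_right
        matrix_mul_assoc algebra_simps)
  also have "\<dots> = (mat 1 - skew c) ** (mat 1 + skew b) - (mat 1 + skew c) ** (mat 1 - skew b)"
    by (simp only: I comm matrix_mul_rid)
  also have "\<dots> = 2 *\<^sub>R (skew b - skew c)"
    by (simp add: matmul.diff_left matmul.diff_right matmul.add_left matmul.add_right scaleR_2)
  finally show ?thesis by simp
qed

lemma norm_le_skew: obtains K where "0 < K" "\<And>u. norm u \<le> K * norm (skew u)"
proof -
  have "inj skew"
  proof (rule injI)
    fix u w assume "skew u = skew w"
    then have *: "u \<times> y = w \<times> y" for y by (metis skew_mult_vec)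
    have "(u - w) \<times> axis 1 1 = 0" "(u - w) \<times> axis 2 1 = 0" "(u - w) \<times> axis 3 1 = 0"
      using * by (simp_all add: cross.diff_left)
    then show "u = w" using cross_basis_nonzero[of "u - w"] by auto
  qed
  then obtain B where "0 < B" "\<And>u. norm u * B \<le> norm (skew u)"
    using linear_inj_bounded_below_pos[OF bounded_linear.linear[OF bounded_linear_skew]] by (metis mult.commute)
  then show ?thesis using that[of "1 / B"] by (simp add: field_simps)
qed

text \<open>On a ball the outer factors in \<open>skew_diff_eq_cayley_diff\<close> are bounded by
  \<open>E\<close>, and \<open>skew\<close> is injective. Control of parameters by matrices is the
  direction needed to pull null sets back into the chart.\<close>

lemma cayley_chart_inverse_lipschitz:
  assumes "Q \<in> SO3"
  shows "\<exists>K. \<forall>b\<in>cball 0 r. \<forall>c\<in>cball 0 r. norm (b - c) \<le> K * norm (cayley b ** Q - cayley c ** Q)"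
proof -
  obtain K1 where K1: "0 < K1" "\<And>(A::real^3^3) (B::real^3^3). norm (A ** B) \<le> norm A * norm B * K1"
    using norm_matrix_mult_le by blast
  obtain K2 where K2: "0 < K2" "\<And>u. norm u \<le> K2 * norm (skew u)" using norm_le_skew by blast
  obtain K3 where K3: "\<And>u. norm (skew u) \<le> norm u * K3" "0 < K3" using skew_pos_bounded by blast
  define E where "E = norm (mat 1 :: real^3^3) + r * K3"
  have E: "norm (mat 1 - skew b) \<le> E" if "b \<in> cball 0 r" for b
  proof -
    have "norm (skew b) \<le> r * K3"
      using that K3(2) by (intro order.trans[OF K3(1)] mult_right_mono) auto
    then show ?thesis unfolding E_def using norm_triangle_ineq4[of "mat 1" "skew b"] by linarith
  qed
  have "norm (b - c) \<le> K2 * (E * E * norm Q * K1 * K1 * K1) * norm (cayley b ** Q - cayley c ** Q)"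
    if bc: "b \<in> cball 0 r" "c \<in> cball 0 r" for b c
  proof -
    define D where "D = cayley b ** Q - cayley c ** Q"
    have "cayley b - cayley c = D ** transpose Q"
      unfolding D_def using SO3_mult_transpose[OF assms]
      by (simp add: matmul.diff_left flip: matrix_mul_assoc)
    then have "2 *\<^sub>R skew (b - c) = ((mat 1 - skew c) ** (D ** transpose Q)) ** (mat 1 - skew b)"
      using skew_diff_eq_cayley_diff[of b c] by (simp add: skew_diff)
    moreover have "norm (((mat 1 - skew c) ** (D ** transpose Q)) ** (mat 1 - skew b)) \<le> (E * (norm D * norm Q * K1) * K1) * E * K1"
    proof -
      have t: "norm (transpose Q) = norm Q"
        by (simp add: norm_vec_def L2_set_def transpose_def sum_3 real_sqrt_pow2 algebra_simps)
      have E0: "0 \<le> E" using E[OF bc(1)] norm_ge_zero order_trans by blast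
      have 1: "norm (D ** transpose Q) \<le> norm D * norm Q * K1"
        using K1(2)[of D "transpose Q"] by (simp add: t)
      have 2: "norm ((mat 1 - skew c) ** (D ** transpose Q)) \<le> E * (norm D * norm Q * K1) * K1"
        using 1 E[OF bc(2)] E0 K1(1)
        by (intro order.trans[OF K1(2)[of "mat 1 - skew c"]] mult_mono mult_nonneg_nonneg) auto
      show ?thesis
        using 2 E[OF bc(1)] E0 K1(1)
        by (intro order.trans[OF K1(2)[of _ "mat 1 - skew b"]] mult_mono mult_nonneg_nonneg) auto
    qed
    ultimately have "norm (2 *\<^sub>R skew (b - c)) \<le> (E * (norm D * norm Q * K1) * K1) * E * K1"
      by (simp only:)
    then have "2 * norm (skew (b - c)) \<le> (E * E * norm Q * K1 * K1 * K1) * norm D"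
      by (simp add: ac_simps)
    then have "norm (skew (b - c)) \<le> (E * E * norm Q * K1 * K1 * K1) * norm D"
      using norm_ge_zero[of "skew (b - c)"] by linarith
    then have "K2 * norm (skew (b - c)) \<le> K2 * ((E * E * norm Q * K1 * K1 * K1) * norm D)"
      using K2(1) by (intro mult_left_mono) auto
    then show ?thesis using K2(2)[of "b - c"] by (simp add: D_def mult.assoc)
  qed
  then show ?thesis by blast
qed

section \<open>Null sets in the state space\<close>

lemma measure_zero_UN:
  assumes "\<And>n::nat. measure_zero (N n)"
  shows "measure_zero (\<Union>n. N n)"
  unfolding measure_zero_def
proof
  fix Q assume Q: "Q \<in> SO3"
  have "negligible (\<Union>n. {(a, b). (a, cayley b ** Q) \<in> N n})"
    using assms Q unfolding measure_zero_def by (intro negligible_Union_nat) auto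
  moreover have "(\<Union>n. {(a, b). (a, cayley b ** Q) \<in> N n}) = {(a, b). (a, cayley b ** Q) \<in> (\<Union>n. N n)}"
    by auto
  ultimately show "negligible {(a, b). (a, cayley b ** Q) \<in> (\<Union>n. N n)}" by simp
qed

lemma measure_zero_Un:
  assumes "measure_zero A" "measure_zero B"
  shows "measure_zero (A \<union> B)"
  unfolding measure_zero_def
proof
  fix Q assume "Q \<in> SO3"
  then have "negligible ({(a, b). (a, cayley b ** Q) \<in> A} \<union> {(a, b). (a, cayley b ** Q) \<in> B})"
    using assms by (simp add: measure_zero_def)
  then show "negligible {(a, b). (a, cayley b ** Q) \<in> A \<union> B}"
    by (rule negligible_subset) auto
qed

text \<open>\<open>J\<close> has a Lipschitz inverse on its image, and the image lies in a
  hyperplane. Hence \<open>T\<close> is a Lipschitz image of a null set in a space of the same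
  dimension.\<close>

lemma negligible_lipschitz_graph:
  fixes J :: "'a::euclidean_space \<Rightarrow> 'a"
  assumes "a \<noteq> 0" and hyp: "\<And>x. x \<in> T \<Longrightarrow> a \<bullet> J x = 0"
    and J: "\<And>x y. x \<in> T \<Longrightarrow> y \<in> T \<Longrightarrow> norm (x - y) \<le> B * norm (J x - J y)"
  shows "negligible T"
proof -
  have inj: "inj_on J T"
    using J by (intro inj_onI) (metis diff_self mult_zero_right norm_le_zero_iff norm_zero eq_iff_diff_eq_0)
  have "negligible (J ` T)"
    by (rule negligible_subset[OF negligible_hyperplane[of a 0]]) (use assms in auto)
  then have "negligible (inv_into T J ` (J ` T))"
  proof (rule negligible_locally_Lipschitz_image[rotated])
    fix y assume "y \<in> J ` T"
    then have "norm (inv_into T J z - inv_into T J y) \<le> B * norm (z - y)" if "z \<in> J ` T" for z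
      using J inj that by auto
    then show "\<exists>U B. open U \<and> y \<in> U \<and>
        (\<forall>z\<in>J ` T \<inter> U. norm (inv_into T J z - inv_into T J y) \<le> B * norm (z - y))"
      by (intro exI[of _ UNIV]) auto
  qed simp
  then show ?thesis using inj by simp
qed

text \<open>Chart parameters and values of \<open>G\<close> both have six real coordinates, so the
  preceding criterion applies to \<open>G\<close> composed with the chart. The Cayley bound is
  uniform only on balls, hence the exhaustion by the sets \<open>T n\<close>.\<close>

lemma measure_zero_if_lipschitz_graph:
  fixes G :: "state \<Rightarrow> (real^3) \<times> (real^3)"
  assumes "a \<noteq> 0" and hyp: "\<And>p. p \<in> N \<Longrightarrow> a \<bullet> G p = 0"
    and G: "\<And>p q. p \<in> N \<Longrightarrow> q \<in> N \<Longrightarrow> norm (p - q) \<le> B * norm (G p - G q)"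
  shows "measure_zero N"
  unfolding measure_zero_def
proof
  fix Q assume Q: "Q \<in> SO3"
  define c where "c x = (fst x, cayley (snd x) ** Q)" for x :: "(real^3) \<times> (real^3)"
  define T where "T n = {x. c x \<in> N \<and> snd x \<in> cball 0 (real n)}" for n
  have "negligible (T n)" for n
  proof -
    obtain K where K: "\<And>b b'. b \<in> cball 0 (real n) \<Longrightarrow> b' \<in> cball 0 (real n) \<Longrightarrow>
        norm (b - b') \<le> K * norm (cayley b ** Q - cayley b' ** Q)"
      using cayley_chart_inverse_lipschitz[OF Q] by blast
    have "norm (x - y) \<le> ((1 + \<bar>K\<bar>) * \<bar>B\<bar>) * norm (G (c x) - G (c y))" if "x \<in> T n" "y \<in> T n" for x y
    proof -
      have "norm (x - y) \<le> norm (fst x - fst y) + norm (snd x - snd y)"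
        by (metis norm_Pair_le prod.collapse fst_diff snd_diff)
      moreover have "norm (snd x - snd y) \<le> \<bar>K\<bar> * norm (snd (c x - c y))"
      proof -
        have "norm (snd x - snd y) \<le> K * norm (snd (c x - c y))"
          using that K[of "snd x" "snd y"] by (simp add: T_def c_def)
        also have "\<dots> \<le> \<bar>K\<bar> * norm (snd (c x - c y))" by (intro mult_right_mono) auto
        finally show ?thesis .
      qed
      moreover have "norm (snd (c x - c y)) \<le> norm (c x - c y)" "norm (fst (c x - c y)) \<le> norm (c x - c y)"
        by (metis norm_snd_le prod.collapse, metis norm_fst_le prod.collapse)
      then have "norm (fst x - fst y) \<le> norm (c x - c y)"
        "\<bar>K\<bar> * norm (snd (c x - c y)) \<le> \<bar>K\<bar> * norm (c x - c y)"
        by (auto simp: c_def intro!: mult_left_mono)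
      ultimately have "norm (x - y) \<le> (1 + \<bar>K\<bar>) * norm (c x - c y)" by (simp add: algebra_simps)
      also have "\<dots> \<le> (1 + \<bar>K\<bar>) * (\<bar>B\<bar> * norm (G (c x) - G (c y)))"
      proof (intro mult_left_mono)
        have "norm (c x - c y) \<le> B * norm (G (c x) - G (c y))"
          using that by (intro G) (auto simp: T_def)
        also have "\<dots> \<le> \<bar>B\<bar> * norm (G (c x) - G (c y))" by (intro mult_right_mono) auto
        finally show "norm (c x - c y) \<le> \<bar>B\<bar> * norm (G (c x) - G (c y))" .
      qed simp
      finally show ?thesis by (simp add: mult.assoc)
    qed
    then show ?thesis
      using assms(1) hyp by (intro negligible_lipschitz_graph[of a "T n" "\<lambda>x. G (c x)"]) (auto simp: T_def)
  qed
  then have "negligible (\<Union>n. T n)" by (intro negligible_Union_nat)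
  moreover have "{(a, b). (a, cayley b ** Q) \<in> N} = (\<Union>n. T n)"
    by (auto simp: T_def c_def real_arch_simple)
  ultimately show "negligible {(a, b). (a, cayley b ** Q) \<in> N}" by simp
qed

section \<open>The reduced error dynamics\<close>

lemma inner_e3: "e3 \<bullet> e3 = 1" by (simp add: inner_axis')

lemma sum_sq_le: "2 * \<bar>x * y\<bar> \<le> x\<^sup>2 + y\<^sup>2" for x y :: real
  using sum_squares_bound[of "\<bar>x\<bar>" "\<bar>y\<bar>"] by (simp add: abs_mult)

locale error_system =
  fixes g k1v k2v k1r k2r :: real and mI :: "real^3"
  assumes g: "g > 0" and mI: "mI \<times> e3 \<noteq> 0"
    and k1v: "k1v > 0" and k2v: "k2v > 0" and k1r: "k1r > 0" and k2r: "k2r > 0"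
    and gain: "k1r \<le> k1v * k2v / g"
begin

abbreviation f :: "state \<Rightarrow> state" where
  "f \<equiv> error_dynamics g k1v k2v k1r k2r mI"

abbreviation solution :: "(real \<Rightarrow> state) \<Rightarrow> bool" where
  "solution \<equiv> ode_solution (\<lambda>_. f) state_space {0..}"

definition b where "b = g / k1v"
definition d where "d = k2v - b * k1r"
text \<open>Chosen so that, in the derivative of \<open>V\<close>, the squared projections of z and
  of b e3 orthogonal to \<gamma> both get the coefficient \<open>k1v + d\<close>, while their inner
  product gets \<open>k1v + 2 * d\<close>, less than twice as much.\<close>

definition \<mu> where "\<mu> = b * (k1v + d) / k1r"
text \<open>The strength of the horizontal magnetic field, nonzero because \<open>mI\<close> is not
  vertical. The frame \<open>north\<close>, \<open>east\<close>, \<open>e3\<close> is adapted to it,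
  so that the yaw error becomes a single coordinate.\<close>

definition \<rho> where "\<rho> = norm (mI - (mI \<bullet> e3) *\<^sub>R e3)"
definition north where "north = (1 / \<rho>) *\<^sub>R (mI - (mI \<bullet> e3) *\<^sub>R e3)"
definition east where "east = e3 \<times> north"

lemma b: "b > 0" using g k1v by (simp add: b_def)

lemma d: "d \<ge> 0"
  using gain g k1v by (simp add: d_def b_def field_simps)

lemma \<mu>: "\<mu> > 0" using b d k1v k1r by (simp add: \<mu>_def)

lemma \<mu>_k1r: "\<mu> * k1r = b * (k1v + d)" using k1r by (simp add: \<mu>_def)

lemma \<rho>: "\<rho> > 0"
proof -
  have "mI \<noteq> (mI \<bullet> e3) *\<^sub>R e3" using mI by (metis cross_mult_left cross_refl scaleR_zero_right)
  then show ?thesis by (simp add: \<rho>_def)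
qed

lemma mI_eq: "mI = \<rho> *\<^sub>R north + (mI \<bullet> e3) *\<^sub>R e3"
  using \<rho> by (simp add: north_def)

lemma frame:
  "north \<bullet> north = 1" "e3 \<bullet> north = 0" "north \<bullet> e3 = 0"
  "east \<bullet> east = 1" "e3 \<bullet> east = 0" "east \<bullet> e3 = 0" "north \<bullet> east = 0" "east \<bullet> north = 0"
  "e3 \<times> north = east" "north \<times> east = e3" "east \<times> e3 = north"
proof -
  have "norm north = 1" unfolding north_def using \<rho> by (simp add: \<rho>_def)
  then show nn: "north \<bullet> north = 1" by (simp add: norm_eq_1)
  show ne: "e3 \<bullet> north = 0" "north \<bullet> e3 = 0"
    by (simp_all add: north_def inner_diff_right inner_diff_left inner_e3 inner_commute)
  show "east \<bullet> east = 1" by (simp add: east_def dot_cross nn ne inner_e3)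
  show "e3 \<bullet> east = 0" "east \<bullet> e3 = 0" "north \<bullet> east = 0" "east \<bullet> north = 0"
    by (simp_all add: east_def dot_cross_self)
  show "e3 \<times> north = east" by (simp add: east_def)
  show "north \<times> east = e3" "east \<times> e3 = north"
    by (simp_all add: east_def Lagrange cross_skew[of "e3 \<times> north"] nn ne inner_e3)
qed

lemma frame_norm: "norm e3 = 1" "norm north = 1" "norm east = 1"
  by (simp_all add: norm_eq_1 frame inner_e3)

text \<open>The remainder \<open>y\<close> is orthogonal to the frame. Writing \<open>e3\<close> as
  \<open>north \<times> east\<close> gives \<open>y \<times> e3 = 0\<close>, and a vector both
  orthogonal and parallel to \<open>e3\<close> vanishes.\<close>

lemma frame_expansion: "x = (x \<bullet> north) *\<^sub>R north + (x \<bullet> east) *\<^sub>R east + (x \<bullet> e3) *\<^sub>R e3"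
proof -
  define y where "y = x - ((x \<bullet> north) *\<^sub>R north + (x \<bullet> east) *\<^sub>R east + (x \<bullet> e3) *\<^sub>R e3)"
  have y: "y \<bullet> north = 0" "y \<bullet> east = 0" "y \<bullet> e3 = 0"
    by (simp_all add: y_def inner_diff_left inner_add_left frame inner_e3)
  have "y \<times> e3 = y \<times> (north \<times> east)" by (simp add: frame)
  also have "\<dots> = 0" by (simp add: Lagrange y)
  finally have "y = 0" using y(3) norm_and_cross_eq_0[of y e3] frame_norm(1) by auto
  then show ?thesis by (simp add: y_def)
qed

lemma frame_norm_le: "norm x \<le> \<bar>x \<bullet> north\<bar> + \<bar>x \<bullet> east\<bar> + \<bar>x \<bullet> e3\<bar>"
proof -
  have "norm x \<le> norm ((x \<bullet> north) *\<^sub>R north + (x \<bullet> east) *\<^sub>R east) + norm ((x \<bullet> e3) *\<^sub>R e3)"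
    by (subst frame_expansion[of x]) (rule norm_triangle_ineq)
  also have "\<dots> \<le> norm ((x \<bullet> north) *\<^sub>R north) + norm ((x \<bullet> east) *\<^sub>R east) + norm ((x \<bullet> e3) *\<^sub>R e3)"
    by (intro add_mono norm_triangle_ineq) simp
  finally show ?thesis by (simp add: frame_norm)
qed

text \<open>The header's \<open>z\<close> is \<open>zl p - b e\<^sub>3\<close>: dropping the constant makes \<open>zl\<close> linear in the
  state, so that it commutes with differences and time derivatives. The vectors \<open>gam\<close>, \<open>nor\<close> and
  \<open>eas\<close> are the images of \<open>e\<^sub>3\<close>, \<open>north\<close> and \<open>east\<close>.\<close>

definition gam :: "state \<Rightarrow> real^3" where "gam p = snd p *v e3"
definition nor :: "state \<Rightarrow> real^3" where "nor p = snd p *v north"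
definition eas :: "state \<Rightarrow> real^3" where "eas p = snd p *v east"
definition zl :: "state \<Rightarrow> real^3" where "zl p = fst p + b *\<^sub>R gam p"
definition hh :: "state \<Rightarrow> real^3" where "hh p = zl p - (gam p \<bullet> zl p) *\<^sub>R gam p"
definition yaw :: "state \<Rightarrow> real" where "yaw p = nor p \<bullet> east"

lemma bounded_linear_coords:
  "bounded_linear gam" "bounded_linear nor" "bounded_linear eas" "bounded_linear zl" "bounded_linear yaw"
proof -
  have *: "bounded_linear (\<lambda>p::state. snd p *v w)" for w
    by (rule bounded_linear_compose[OF matvec.bounded_linear_left bounded_linear_snd])
  show 1: "bounded_linear gam" "bounded_linear nor" "bounded_linear eas"
    unfolding gam_def nor_def eas_def by (rule *)+
  show "bounded_linear zl" unfolding zl_def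
    by (intro bounded_linear_add bounded_linear_fst bounded_linear_compose[OF bounded_linear_scaleR_right 1(1)])
  show "bounded_linear yaw" unfolding yaw_def
    by (rule bounded_linear_compose[OF bounded_linear_inner_left 1(2)])
qed

lemmas coords_diff = bounded_linear_coords[THEN bounded_linear.linear, THEN linear_diff]
  and coords_zero = bounded_linear_coords[THEN bounded_linear.linear, THEN linear_0]
  and coords_scale = bounded_linear_coords[THEN bounded_linear.linear, THEN linear_scale]

lemma state_spaceD: "p \<in> state_space \<Longrightarrow> snd p \<in> SO3"
  by (auto simp: state_space_def)

lemma coords_inner:
  assumes "p \<in> state_space"
  shows "gam p \<bullet> gam p = 1" "nor p \<bullet> nor p = 1" "eas p \<bullet> eas p = 1" "gam p \<bullet> nor p = 0"
    "nor p \<bullet> gam p = 0" "gam p \<bullet> eas p = 0" "eas p \<bullet> gam p = 0" "nor p \<bullet> eas p = 0" "eas p \<bullet> nor p = 0"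
    "gam p \<times> nor p = eas p" "nor p \<times> eas p = gam p" "eas p \<times> gam p = nor p"
  using SO3_dot[OF state_spaceD[OF assms]] SO3_cross[OF state_spaceD[OF assms]]
  by (simp_all add: gam_def nor_def eas_def frame inner_e3)

lemma coords_norm:
  assumes "p \<in> state_space"
  shows "norm (gam p) = 1" "norm (nor p) = 1" "norm (eas p) = 1"
  using coords_inner[OF assms] by (simp_all add: norm_eq_1)

lemma mult_mI: "snd p *v mI = \<rho> *\<^sub>R nor p + (mI \<bullet> e3) *\<^sub>R gam p"
  by (subst mI_eq) (simp add: nor_def gam_def algebra_simps)

text \<open>The attitude correction after simplification: the component of
  \<open>snd p *v mI\<close> along \<open>gam p\<close> drops out of the triple product, and the
  rest, \<open>\<rho> *\<^sub>R nor p\<close>, enters through \<open>eas p\<close>.\<close>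

definition sig :: "state \<Rightarrow> real^3" where
  "sig p = k1r *\<^sub>R (fst p \<times> gam p) - (k2r * (\<rho> * (eas p \<bullet> mI))) *\<^sub>R gam p"

lemma sigma_R_eq:
  assumes "p \<in> state_space"
  shows "sigma_R k1r k2r (fst p) (gam p) mI (snd p *v mI) = sig p"
proof -
  have "(mI \<times> (snd p *v mI)) \<bullet> gam p = \<rho> * ((mI \<times> nor p) \<bullet> gam p)"
    by (simp add: mult_mI cross_add_right cross_mult_right inner_add_left dot_cross_self)
  also have "(mI \<times> nor p) \<bullet> gam p = (nor p \<times> gam p) \<bullet> mI" by (rule cross_triple)
  also have "nor p \<times> gam p = - eas p" by (subst cross_skew) (simp add: coords_inner[OF assms])
  finally show ?thesis by (simp add: sigma_R_def sig_def)
qed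

lemma error_dynamics_rotation:
  "p \<in> state_space \<Longrightarrow> snd (f p) *v w = - (sig p \<times> (snd p *v w))"
  using sigma_R_eq[of p]
  by (simp add: error_dynamics_def case_prod_beta gam_def matvec.minus_left skew_mult_vec
      flip: matrix_vector_mul_assoc)

text \<open>Adding a multiple of \<open>gam p\<close> to the velocity does not change the component
  orthogonal to \<open>gam p\<close>, so \<open>hh\<close>, although computed from
  \<open>zl\<close>, is that of the velocity.\<close>

lemma hh_eq: 
  assumes "p \<in> state_space"
  shows "hh p = fst p - (gam p \<bullet> fst p) *\<^sub>R gam p" "gam p \<bullet> hh p = 0"
  by (simp_all add: hh_def zl_def inner_add_right inner_diff_right coords_inner[OF assms] algebra_simps)

text \<open>The magnetic part of \<open>sig p\<close> is parallel to \<open>gam p\<close> and cannot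
  move it; the remaining double cross product is the projection of the velocity orthogonal to
  \<open>gam p\<close>.\<close>

lemma gam_f: assumes "p \<in> state_space" shows "gam (f p) = k1r *\<^sub>R hh p"
proof -
  have "gam (f p) = - (sig p \<times> gam p)"
    unfolding gam_def by (rule error_dynamics_rotation[OF assms])
  also have "\<dots> = k1r *\<^sub>R - ((fst p \<times> gam p) \<times> gam p)"
    by (simp add: sig_def cross.diff_left cross_mult_left)
  also have "- ((fst p \<times> gam p) \<times> gam p) = hh p"
    by (simp add: hh_eq[OF assms] cross_skew[of "fst p \<times> gam p"] Lagrange coords_inner[OF assms] inner_commute)
  finally show ?thesis .
qed

lemma nor_f:
  assumes "p \<in> state_space"
  shows "nor (f p) = - (k1r * (fst p \<bullet> nor p)) *\<^sub>R gam p + (k2r * (\<rho> * (eas p \<bullet> mI))) *\<^sub>R eas p"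
proof -
  have "nor (f p) = - (sig p \<times> nor p)"
    unfolding nor_def by (rule error_dynamics_rotation[OF assms])
  also have "\<dots> = - (k1r *\<^sub>R ((fst p \<times> gam p) \<times> nor p)) + (k2r * (\<rho> * (eas p \<bullet> mI))) *\<^sub>R eas p"
    by (simp add: sig_def cross.diff_left cross_mult_left coords_inner[OF assms])
  also have "(fst p \<times> gam p) \<times> nor p = (fst p \<bullet> nor p) *\<^sub>R gam p"
    by (simp add: cross_skew[of "fst p \<times> gam p"] Lagrange coords_inner[OF assms] inner_commute)
  finally show ?thesis by simp
qed

lemma yaw_f:
  assumes "p \<in> state_space"
  shows "yaw (f p) = - (k1r * ((fst p \<bullet> nor p) * (gam p \<bullet> east))) + k2r * (\<rho> * ((eas p \<bullet> mI) * (eas p \<bullet> east)))"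
  by (simp add: yaw_def nor_f[OF assms] inner_add_left inner_diff_left)

lemma fst_f:
  assumes "p \<in> state_space"
  shows "fst (f p) = g *\<^sub>R (e3 - gam p) - k1v *\<^sub>R fst p - k2v *\<^sub>R hh p"
proof -
  have "gam p \<times> (gam p \<times> fst p) = - hh p"
    by (simp add: hh_eq[OF assms] Lagrange coords_inner[OF assms])
  then show ?thesis
    by (simp add: error_dynamics_def case_prod_beta sigma_v_def matvec.diff_left gam_def[symmetric])
qed

text \<open>The choice of \<open>b\<close> turns gravity into \<open>k1v * b\<close> times
  \<open>e3 - gam p\<close>, which merges with the damping. The motion of \<open>gam\<close> then
  reduces the coefficient of \<open>hh p\<close> from \<open>k2v\<close> to
  \<open>d\<close>.\<close>

lemma zl_f:
  assumes "p \<in> state_space"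
  shows "zl (f p) = - k1v *\<^sub>R (zl p - b *\<^sub>R e3) - d *\<^sub>R hh p"
proof -
  have "g = k1v * b" using k1v by (simp add: b_def)
  then show ?thesis
    unfolding zl_def[of "f p"] fst_f[OF assms] gam_f[OF assms] d_def
    by (simp add: zl_def algebra_simps)
qed

text \<open>Young's inequality \<open>2 * (s * b * x) \<le> q + b\<^sup>2 * r\<close>, taken with
  weight \<open>k1v / 2 + d\<close>, absorbs the cross term and leaves half of \<open>k1v\<close>.
  The sign \<open>s\<close> lets the estimate serve for the global Lyapunov function and for
  differences near either pole.\<close>

lemma quadratic_estimate:
  assumes "x\<^sup>2 \<le> q * r" "0 \<le> q" "q \<le> z" "0 \<le> r" "\<bar>s\<bar> = 1"
  shows "- k1v * z - d * q + s * b * (k1v + 2 * d) * x - b\<^sup>2 * (k1v + d) * r \<le> - (k1v / 2) * (z + b\<^sup>2 * r)"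
proof -
  define a where "a = k1v / 2 + d"
  have a: "a > 0" using k1v d by (simp add: a_def)
  have "(2 * (s * b * x))\<^sup>2 = 4 * b\<^sup>2 * x\<^sup>2"
    using assms(5) by (simp add: power_mult_distrib abs_square_eq_1)
  also have "\<dots> \<le> 4 * b\<^sup>2 * (q * r)" using assms(1) by (intro mult_left_mono) auto
  also have "\<dots> \<le> (q + b\<^sup>2 * r)\<^sup>2"
    using zero_le_power2[of "q - b\<^sup>2 * r"] by (simp add: power2_eq_square algebra_simps)
  finally have "2 * (s * b * x) \<le> q + b\<^sup>2 * r"
    by (rule power2_le_imp_le) (simp add: assms)
  then have "a * (2 * (s * b * x)) \<le> a * (q + b\<^sup>2 * r)" using a by (intro mult_left_mono) auto
  moreover have "k1v * q \<le> k1v * z" using assms k1v by (intro mult_left_mono) auto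
  ultimately show ?thesis unfolding a_def by (simp add: algebra_simps)
qed

section \<open>A Lyapunov function for the reduced dynamics\<close>

definition V :: "state \<Rightarrow> real" where
  "V p = (norm (zl p - b *\<^sub>R e3))\<^sup>2 / 2 + \<mu> * (1 - gam p \<bullet> e3)"

text \<open>A lower bound of the dissipation. Its second term vanishes at both poles, whereas that
  of \<open>V\<close> vanishes at the desired one only, so vanishing dissipation does not tell the
  poles apart.\<close>

definition W :: "state \<Rightarrow> real" where
  "W p = (k1v / 2) * ((norm (zl p - b *\<^sub>R e3))\<^sup>2 + b\<^sup>2 * (1 - (gam p \<bullet> e3)\<^sup>2))"

text \<open>The left-hand side is the derivative of \<open>V\<close> along \<open>f\<close>. Since
  \<open>hh p\<close> is the projection of z + b e3 orthogonal to \<gamma>, everything reduces to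
  the squared norms and the inner product of the projections of z and e3, to which
  \<open>quadratic_estimate\<close> applies with sign -1.\<close>

lemma V_decrease:
  assumes "p \<in> state_space"
  shows "(zl p - b *\<^sub>R e3) \<bullet> zl (f p) - \<mu> * (gam (f p) \<bullet> e3) \<le> - W p"
proof -
  define z \<gamma> c where "z = zl p - b *\<^sub>R e3" and "\<gamma> = gam p" and "c = gam p \<bullet> e3"
  define q where "q = e3 - c *\<^sub>R \<gamma>"
  have \<gamma>: "\<gamma> \<bullet> \<gamma> = 1" unfolding \<gamma>_def by (rule coords_inner[OF assms])
  have c: "e3 \<bullet> \<gamma> = c" "\<gamma> \<bullet> e3 = c" by (simp_all add: c_def \<gamma>_def inner_commute)
  have h: "hh p = z + b *\<^sub>R e3 - (\<gamma> \<bullet> (z + b *\<^sub>R e3)) *\<^sub>R \<gamma>"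
    by (simp add: hh_def z_def \<gamma>_def)
  define Q where "Q = z \<bullet> z - (\<gamma> \<bullet> z)\<^sup>2"
  have qq: "q \<bullet> q = 1 - c\<^sup>2"
    by (simp add: q_def inner_diff_left inner_diff_right c \<gamma> inner_e3 power2_eq_square)
  have PP: "(z - (\<gamma> \<bullet> z) *\<^sub>R \<gamma>) \<bullet> (z - (\<gamma> \<bullet> z) *\<^sub>R \<gamma>) = Q"
    by (simp add: Q_def inner_diff_left inner_diff_right \<gamma> power2_eq_square inner_commute)
  have Pq: "(z - (\<gamma> \<bullet> z) *\<^sub>R \<gamma>) \<bullet> q = z \<bullet> q"
    by (simp add: q_def inner_diff_left inner_diff_right \<gamma> c inner_commute)
  have "(z \<bullet> q)\<^sup>2 \<le> Q * (1 - c\<^sup>2)"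
    using Cauchy_Schwarz_ineq[of "z - (\<gamma> \<bullet> z) *\<^sub>R \<gamma>" q] unfolding PP Pq qq .
  moreover have "0 \<le> Q" using PP inner_ge_zero by metis
  moreover have "Q \<le> z \<bullet> z" by (simp add: Q_def)
  moreover have "0 \<le> 1 - c\<^sup>2" using qq inner_ge_zero by metis
  ultimately have "- k1v * (z \<bullet> z) - d * Q + (-1) * b * (k1v + 2 * d) * (z \<bullet> q) - b\<^sup>2 * (k1v + d) * (1 - c\<^sup>2)
      \<le> - (k1v / 2) * (z \<bullet> z + b\<^sup>2 * (1 - c\<^sup>2))"
    by (intro quadratic_estimate) auto
  also have "- k1v * (z \<bullet> z) - d * Q + (-1) * b * (k1v + 2 * d) * (z \<bullet> q) - b\<^sup>2 * (k1v + d) * (1 - c\<^sup>2)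
      = z \<bullet> zl (f p) - \<mu> * (gam (f p) \<bullet> e3)"
  proof -
    have "z \<bullet> hh p = Q + b * (z \<bullet> q)"
      by (simp add: h Q_def q_def inner_diff_right inner_add_right c power2_eq_square inner_commute algebra_simps)
    moreover have "hh p \<bullet> e3 = z \<bullet> q + b * (1 - c\<^sup>2)"
      by (simp add: h q_def inner_diff_left inner_diff_right inner_add_left inner_add_right c inner_e3
          power2_eq_square inner_commute algebra_simps)
    moreover have "\<mu> * (k1r * (hh p \<bullet> e3)) = b * (k1v + d) * (hh p \<bullet> e3)"
      by (simp only: mult.assoc[symmetric] \<mu>_k1r)
    moreover have "z \<bullet> zl (f p) = - k1v * (z \<bullet> z) - d * (z \<bullet> hh p)"
      by (simp add: zl_f[OF assms] z_def[symmetric] inner_diff_right)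
    ultimately show ?thesis
      by (simp only: gam_f[OF assms] inner_scaleR_left power2_eq_square) (simp add: algebra_simps)
  qed
  finally show ?thesis
    by (simp add: W_def z_def c_def power2_norm_eq_inner)
qed

end

section \<open>Criteria for stability, instability and null basins\<close>

lemma inner_self_derivative:
  assumes "bounded_linear S" "(x has_vector_derivative x') (at t within J)"
  shows "((\<lambda>t. S (x t) \<bullet> S (x t)) has_real_derivative 2 * (S (x t) \<bullet> S x')) (at t within J)"
proof -
  have "((\<lambda>t. S (x t)) has_vector_derivative S x') (at t within J)"
    by (rule bounded_linear.has_vector_derivative[OF assms])
  from bounded_bilinear.has_vector_derivative[OF bounded_bilinear_inner this this]
  show ?thesis
    by (simp add: has_real_derivative_iff_has_vector_derivative inner_commute)
qed

text \<open>The squared distance of two solutions decreases at most at rate \<open>2 * L\<close>.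
  Initial states thus depend in a Lipschitz way on the states at time \<open>T\<close>, which
  carries a graph property found at a late time back to time 0.\<close>

lemma backward_gronwall:
  fixes f :: "'a::real_inner \<Rightarrow> 'a"
  assumes L: "L-lipschitz_on S f" and T: "0 \<le> T" "{0..T} \<subseteq> J"
    and x: "\<And>t. t \<in> {0..T} \<Longrightarrow> x t \<in> S \<and> (x has_vector_derivative f (x t)) (at t within J)"
    and y: "\<And>t. t \<in> {0..T} \<Longrightarrow> y t \<in> S \<and> (y has_vector_derivative f (y t)) (at t within J)"
  shows "norm (x 0 - y 0) \<le> exp (L * T) * norm (x T - y T)"
proof -
  define \<phi> where "\<phi> t = (x t - y t) \<bullet> (x t - y t)" for t
  have "- \<phi> T \<le> - \<phi> 0 * exp (- 2 * L * (T - 0))"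
  proof (rule exponential_bound[where J = J and \<phi> = "\<lambda>t. - \<phi> t"])
    fix t assume t: "t \<in> {0..T}"
    have "((\<lambda>t. x t - y t) has_vector_derivative f (x t) - f (y t)) (at t within J)"
      using x[OF t] y[OF t] by (intro has_vector_derivative_diff) auto
    from inner_self_derivative[OF bounded_linear_ident this]
    show "((\<lambda>t. - \<phi> t) has_real_derivative - (2 * ((x t - y t) \<bullet> (f (x t) - f (y t))))) (at t within J)"
      unfolding \<phi>_def by (rule DERIV_minus)
    have "\<bar>(x t - y t) \<bullet> (f (x t) - f (y t))\<bar> \<le> norm (x t - y t) * norm (f (x t) - f (y t))"
      by (rule Cauchy_Schwarz_ineq2)
    also have "\<dots> \<le> norm (x t - y t) * (L * norm (x t - y t))"
      using x[OF t] y[OF t] by (intro mult_left_mono lipschitz_on_normD[OF L]) auto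
    also have "\<dots> = L * \<phi> t" by (simp add: \<phi>_def power2_eq_square flip: power2_norm_eq_inner)
    finally show "- (2 * ((x t - y t) \<bullet> (f (x t) - f (y t)))) \<le> - 2 * L * - \<phi> t" by simp
  qed (use T in auto)
  then have "\<phi> 0 * exp (- 2 * L * T) * exp (2 * L * T) \<le> \<phi> T * exp (2 * L * T)"
    by (intro mult_right_mono) auto
  then have "\<phi> 0 \<le> \<phi> T * (exp (L * T))\<^sup>2"
    by (simp add: mult.assoc flip: exp_add exp_double)
  then have "(norm (x 0 - y 0))\<^sup>2 \<le> (exp (L * T) * norm (x T - y T))\<^sup>2"
    by (simp add: \<phi>_def power2_norm_eq_inner power_mult_distrib mult.commute)
  then show ?thesis by (rule power2_le_imp_le) simp
qed

text \<open>Where the indefinite form \<open>|S|\<^sup>2 - |U|\<^sup>2\<close> of the difference of two solutions decreases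
  strictly, a negative value would grow exponentially.\<close>

lemma trapped_imp_cone:
  fixes S :: "'a::real_normed_vector \<Rightarrow> 'b::real_inner" and U :: "'a \<Rightarrow> 'c::real_inner"
  assumes S: "bounded_linear S" and U: "bounded_linear U" and a: "0 \<le> a" and r: "0 < r"
    and x: "\<And>t. a \<le> t \<Longrightarrow> (x has_vector_derivative x' t) (at t within {0..})"
    and decr: "\<And>t. a \<le> t \<Longrightarrow> S (x t) \<bullet> S (x' t) - U (x t) \<bullet> U (x' t) \<le> - r * (norm (U (x t)))\<^sup>2"
    and bound: "\<And>t. a \<le> t \<Longrightarrow> norm (U (x t)) \<le> K"
  shows "norm (U (x a)) \<le> norm (S (x a))"
proof (rule ccontr)
  define D where "D t = S (x t) \<bullet> S (x t) - U (x t) \<bullet> U (x t)" for t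
  assume "\<not> norm (U (x a)) \<le> norm (S (x a))"
  then have "(norm (S (x a)))\<^sup>2 < (norm (U (x a)))\<^sup>2" by (intro power_strict_mono) auto
  then have Da: "D a < 0" by (simp add: D_def power2_norm_eq_inner)
  have exp_growth: "D t \<le> D a * exp (2 * r * (t - a))" if t: "a \<le> t" for t
  proof (rule exponential_bound[where J = "{0..}"])
    fix s assume "s \<in> {a..t}"
    then have s: "a \<le> s" by simp
    show "(D has_real_derivative 2 * (S (x s) \<bullet> S (x' s)) - 2 * (U (x s) \<bullet> U (x' s))) (at s within {0..})"
      unfolding D_def by (intro DERIV_diff inner_self_derivative S U x[OF s])
    have "- D s \<le> (norm (U (x s)))\<^sup>2" by (simp add: D_def power2_norm_eq_inner)
    then have "r * - D s \<le> r * (norm (U (x s)))\<^sup>2" using r by (intro mult_left_mono) auto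
    then show "2 * (S (x s) \<bullet> S (x' s)) - 2 * (U (x s) \<bullet> U (x' s)) \<le> 2 * r * D s"
      using decr[OF s] by simp
  qed (use a t in auto)
  \<comment> \<open>A linear lower bound of the exponential is enough: at time \<open>a + n\<close>
    it already forces \<open>norm (U (x t))\<close> beyond \<open>K\<close>.\<close>
  obtain n :: nat where n: "K\<^sup>2 / (- D a * (2 * r)) < real n" using reals_Archimedean2 by blast
  define t where "t = a + real n"
  have t: "a \<le> t" by (simp add: t_def)
  have "2 * r * real n \<le> exp (2 * r * (t - a))"
    unfolding t_def by (rule order.trans[OF _ exp_ge_add_one_self]) simp
  then have "- D a * (2 * r * real n) \<le> - D a * exp (2 * r * (t - a))"
    using Da by (intro mult_left_mono) auto
  also have "\<dots> \<le> - D t" using exp_growth[OF t] by simp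
  also have "\<dots> \<le> (norm (U (x t)))\<^sup>2" by (simp add: D_def power2_norm_eq_inner)
  also have "\<dots> \<le> K\<^sup>2" using bound[OF t] by (intro power_mono) auto
  finally have "- D a * (2 * r) * real n \<le> K\<^sup>2" by (simp add: mult.assoc)
  moreover have "0 < - D a * (2 * r)" using Da r by (simp add: mult_neg_pos)
  then have "K\<^sup>2 < real n * (- D a * (2 * r))" using n by (simp only: pos_divide_less_eq)
  ultimately show False by (simp add: mult.commute)
qed

text \<open>The map \<open>E\<close> is the identity when initial errors are considered, and the observation error when
  initial observer states are.\<close>

lemma trapped_measure_zero:
  fixes f :: "state \<Rightarrow> state" and G :: "state \<Rightarrow> (real^3) \<times> (real^3)"
    and S :: "state \<Rightarrow> 'b::real_inner" and U :: "state \<Rightarrow> 'c::real_inner"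
  assumes S: "bounded_linear S" and U: "bounded_linear U" and f: "bounded_lipschitz f" and r: "0 < r"
    and sol_bound: "\<And>k. \<exists>K. \<forall>x. ode_solution (\<lambda>_. f) state_space {0..} x \<and> norm (x 0) \<le> k \<longrightarrow>
        (\<forall>t\<ge>0. norm (x t) \<le> K)"
    and decr: "\<And>p q. p \<in> W \<Longrightarrow> q \<in> W \<Longrightarrow>
        S (p - q) \<bullet> S (f p - f q) - U (p - q) \<bullet> U (f p - f q) \<le> - r * (norm (U (p - q)))\<^sup>2"
    and W: "\<And>p. p \<in> W \<Longrightarrow> norm (U p) \<le> K0"
    and G: "\<And>p q. p \<in> W \<Longrightarrow> q \<in> W \<Longrightarrow> norm (U (p - q)) \<le> norm (S (p - q)) \<Longrightarrow>
        norm (p - q) \<le> B * norm (G p - G q)"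
    and a: "a \<noteq> 0" "\<And>p. p \<in> W \<Longrightarrow> a \<bullet> G p = 0"
    and E: "\<And>p q. p \<in> state_space \<Longrightarrow> q \<in> state_space \<Longrightarrow> norm (p - q) \<le> c * norm (E p - E q)"
  shows "measure_zero {p \<in> state_space. \<exists>x. ode_solution (\<lambda>_. f) state_space {0..} x \<and> x 0 = E p \<and>
    (\<exists>T. \<forall>t\<ge>T. x t \<in> W)}" (is "measure_zero ?N")
proof -
  \<comment> \<open>One integer bounds both the size of the initial state and the time of entry into
    \<open>W\<close>, so that one ball, one Lipschitz constant and one time serve all of
    \<open>N n\<close>.\<close>
  define N where "N n = {p \<in> state_space. norm (E p) \<le> real n \<and>
    (\<exists>x. ode_solution (\<lambda>_. f) state_space {0..} x \<and> x 0 = E p \<and> (\<forall>t\<ge>real n. x t \<in> W))}" for n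
  have "measure_zero (N n)" for n
  proof -
    obtain K where K: "\<And>x t. ode_solution (\<lambda>_. f) state_space {0..} x \<Longrightarrow> norm (x 0) \<le> real n \<Longrightarrow> 0 \<le> t \<Longrightarrow>
        norm (x t) \<le> K"
      using sol_bound[of "real n"] by blast
    obtain L where L: "L-lipschitz_on (cball 0 K) f"
      using f bounded_cball unfolding bounded_lipschitz_def by blast
    have "\<forall>p. \<exists>x. p \<in> N n \<longrightarrow> ode_solution (\<lambda>_. f) state_space {0..} x \<and> x 0 = E p \<and> (\<forall>t\<ge>real n. x t \<in> W)"
      by (auto simp: N_def)
    then obtain X where X: "\<And>p. p \<in> N n \<Longrightarrow> ode_solution (\<lambda>_. f) state_space {0..} (X p)"
        "\<And>p. p \<in> N n \<Longrightarrow> X p 0 = E p" "\<And>p t. p \<in> N n \<Longrightarrow> real n \<le> t \<Longrightarrow> X p t \<in> W"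
      by metis
    have deriv: "(X p has_vector_derivative f (X p t)) (at t within {0..})" if "p \<in> N n" "0 \<le> t" for p t
      using X(1)[OF that(1)] that(2) by (auto simp: ode_solution_def)
    have Kb: "norm (X p t) \<le> K" if "p \<in> N n" "0 \<le> t" for p t
      using that X(2) by (intro K X(1)) (auto simp: N_def)
    \<comment> \<open>The graph coordinates are read at time \<open>n\<close>, when both solutions
      are already trapped; the estimate is then transported to time 0 and through
      \<open>E\<close>.\<close>
    show ?thesis
    proof (rule measure_zero_if_lipschitz_graph[where a = a and G = "\<lambda>p. G (X p (real n))"])
      fix p q assume p: "p \<in> N n" and q: "q \<in> N n"
      define xp xq where "xp = X p (real n)" and "xq = X q (real n)"
      have "norm (U (X p (real n) - X q (real n))) \<le> norm (S (X p (real n) - X q (real n)))"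
      proof (rule trapped_imp_cone[OF S U _ r])
        fix t assume t: "real n \<le> t"
        show "((\<lambda>t. X p t - X q t) has_vector_derivative f (X p t) - f (X q t)) (at t within {0..})"
          using t by (intro has_vector_derivative_diff deriv p q) auto
        show "norm (U (X p t - X q t)) \<le> K0 + K0"
          using norm_triangle_ineq4[of "U (X p t)" "U (X q t)"] W[OF X(3)[OF p t]] W[OF X(3)[OF q t]]
          by (simp add: linear_diff[OF bounded_linear.linear[OF U]])
        show "S (X p t - X q t) \<bullet> S (f (X p t) - f (X q t)) - U (X p t - X q t) \<bullet> U (f (X p t) - f (X q t))
            \<le> - r * (norm (U (X p t - X q t)))\<^sup>2"
          by (intro decr X t p q)
      qed simp
      then have G': "norm (xp - xq) \<le> B * norm (G xp - G xq)"
        unfolding xp_def xq_def by (intro G X p q) auto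
      have "norm (X p 0 - X q 0) \<le> exp (L * real n) * norm (xp - xq)"
        unfolding xp_def xq_def
        by (rule backward_gronwall[OF L, where J = "{0..}"]) (use p q in \<open>auto intro: deriv Kb\<close>)
      also have "\<dots> \<le> exp (L * real n) * (B * norm (G xp - G xq))" using G' by simp
      finally have 1: "norm (E p - E q) \<le> exp (L * real n) * (B * norm (G xp - G xq))"
        using X(2) p q by simp
      have "norm (p - q) \<le> c * norm (E p - E q)" using p q by (intro E) (auto simp: N_def)
      also have "\<dots> \<le> \<bar>c\<bar> * norm (E p - E q)" by (intro mult_right_mono) auto
      also have "\<dots> \<le> \<bar>c\<bar> * (exp (L * real n) * (B * norm (G xp - G xq)))"
        using 1 by (intro mult_left_mono) auto
      finally show "norm (p - q) \<le>
          (\<bar>c\<bar> * exp (L * real n) * B) * norm (G (X p (real n)) - G (X q (real n)))"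
        by (simp add: xp_def xq_def mult.assoc)
    qed (use a X in auto)
  qed
  then have null: "measure_zero (\<Union>n. N n)" by (rule measure_zero_UN)
  have "?N \<subseteq> (\<Union>n. N n)"
  proof safe
    fix p x T assume p: "p \<in> state_space" and x: "ode_solution (\<lambda>_. f) state_space {0..} x" "x 0 = E p"
      and T: "\<forall>t\<ge>T. x t \<in> W"
    obtain n where "max T (norm (E p)) \<le> real n" using real_arch_simple by blast
    then have "p \<in> N n" unfolding N_def using p x T by auto
    then show "p \<in> (\<Union>n. N n)" by blast
  qed
  moreover have "(\<Union>n. N n) \<subseteq> ?N" unfolding N_def by blast
  ultimately have "?N = (\<Union>n. N n)" by (rule subset_antisym)
  with null show ?thesis by (simp only:)
qed

text \<open>The squared norm of \<open>S (y - p)\<close> is a Lyapunov function comparable to the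
  squared distance, but the hypotheses hold only in the ball of radius \<open>\<rho>\<close>. Decay
  is available only while the solution stays there, which a first-exit argument secures.\<close>

lemma locally_exponentially_stableI:
  fixes f :: "'a::real_normed_vector \<Rightarrow> 'a" and S :: "'a \<Rightarrow> 'b::real_inner"
  assumes S: "bounded_linear S" and rho: "0 < \<rho>" and r: "0 < r" and B: "0 < B"
    and decr: "\<And>y. y \<in> M \<Longrightarrow> dist y p < \<rho> \<Longrightarrow> S (y - p) \<bullet> S (f y) \<le> - r * (norm (S (y - p)))\<^sup>2"
    and below: "\<And>y. y \<in> M \<Longrightarrow> dist y p < \<rho> \<Longrightarrow> norm (y - p) \<le> B * norm (S (y - p))"
  shows "locally_exponentially_stable f M p"
proof -
  obtain K where K: "0 < K" "\<And>y. norm (S y) \<le> norm y * K"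
    using bounded_linear.pos_bounded[OF S] by blast
  \<comment> \<open>The second bound keeps the decay estimate below
    \<open>B * K * \<delta> \<le> \<rho> / 2\<close>; the first one places the start below the level
    \<open>\<rho> / 2\<close>.\<close>
  define \<delta> where "\<delta> = min (\<rho> / 2) (\<rho> / (2 * B * K))"
  have \<delta>: "0 < \<delta>" "\<delta> \<le> \<rho> / 2" "\<delta> * (B * K) \<le> \<rho> / 2"
    using rho B K by (auto simp: \<delta>_def min_def field_simps)
  have "dist (x t) p \<le> B * K * exp (- r * t) * dist (x 0) p"
    if T: "0 < T" and x: "ode_solution (\<lambda>_. f) M {0..<T} x" and x0: "dist (x 0) p < \<delta>" and t: "t \<in> {0..<T}"
    for T x t
  proof -
    have decay: "dist (x t) p \<le> B * K * exp (- r * t) * dist (x 0) p"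
      if t: "t \<in> {0..<T}" and near: "\<And>s. s \<in> {0..t} \<Longrightarrow> dist (x s) p < \<rho>" for t
    proof -
      define \<phi> where "\<phi> s = S (x s - p) \<bullet> S (x s - p)" for s
      have "\<phi> t \<le> \<phi> 0 * exp (- 2 * r * (t - 0))"
      proof (rule exponential_bound[where J = "{0..<T}"])
        fix s assume s: "s \<in> {0..t}"
        then have s': "s \<in> {0..<T}" using t by auto
        have "(x has_vector_derivative f (x s)) (at s within {0..<T})" "x s \<in> M"
          using x s' by (auto simp: ode_solution_def)
        then have "((\<lambda>s. x s - p) has_vector_derivative f (x s)) (at s within {0..<T})" "x s \<in> M"
          by (auto intro!: derivative_eq_intros)
        then show "(\<phi> has_real_derivative 2 * (S (x s - p) \<bullet> S (f (x s)))) (at s within {0..<T})"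
          unfolding \<phi>_def by (intro inner_self_derivative S)
        show "2 * (S (x s - p) \<bullet> S (f (x s))) \<le> - 2 * r * \<phi> s"
          using decr[OF \<open>x s \<in> M\<close> near[OF s]] by (simp add: \<phi>_def power2_norm_eq_inner)
      qed (use t in auto)
      then have "(norm (S (x t - p)))\<^sup>2 \<le> (norm (S (x 0 - p)) * exp (- r * t))\<^sup>2"
        by (simp add: \<phi>_def power2_norm_eq_inner power_mult_distrib mult.assoc flip: exp_double)
      then have "norm (S (x t - p)) \<le> norm (S (x 0 - p)) * exp (- r * t)"
        by (rule power2_le_imp_le) simp
      also have "\<dots> \<le> (norm (x 0 - p) * K) * exp (- r * t)" by (intro mult_right_mono K) simp
      finally have "B * norm (S (x t - p)) \<le> B * ((norm (x 0 - p) * K) * exp (- r * t))"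
        using B by (intro mult_left_mono) auto
      moreover have "norm (x t - p) \<le> B * norm (S (x t - p))"
        using x t near[of t] by (intro below) (auto simp: ode_solution_def)
      ultimately show ?thesis by (simp add: dist_norm mult_ac)
    qed
    have cont: "continuous_on {0..<T} (\<lambda>s. dist (x s) p)"
      using x unfolding ode_solution_def
      by (intro continuous_intros continuous_on_vector_derivative) auto
    have "dist (x s) p < \<rho>" if s: "s \<in> {0..t}" for s
    proof (rule ccontr)
      assume "\<not> dist (x s) p < \<rho>"
      \<comment> \<open>\<open>H\<close> collects the times at which the distance is exactly
        \<open>\<rho> / 2\<close>. Up to the first of them the solution has not reached
        \<open>\<rho>\<close>, so decay applies and gives a distance strictly below
        \<open>\<rho> / 2\<close> at that very time.\<close>
      define H where "H = {u \<in> {0..s}. dist (x u) p = \<rho> / 2}"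
      have cs: "continuous_on {0..s} (\<lambda>s. dist (x s) p)"
        by (rule continuous_on_subset[OF cont]) (use s t in auto)
      have "\<exists>u\<ge>0. u \<le> s \<and> dist (x u) p = \<rho> / 2"
        using \<open>\<not> dist (x s) p < \<rho>\<close> x0 \<delta> rho s cs by (intro IVT') auto
      then have "H \<noteq> {}" by (auto simp: H_def)
      moreover have "compact H"
      proof -
        have "closed H" unfolding H_def
          by (intro continuous_closed_preimage_constant cs) auto
        moreover have "H = {0..s} \<inter> H" by (auto simp: H_def)
        ultimately show ?thesis by (metis compact_Icc compact_Int_closed)
      qed
      ultimately obtain u where u: "u \<in> H" "\<And>u'. u' \<in> H \<Longrightarrow> u \<le> u'"
        using compact_attains_inf[of H] by metis
      have before: "dist (x u') p < \<rho>" if u': "u' \<in> {0..u}" for u'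
      proof (rule ccontr)
        assume "\<not> dist (x u') p < \<rho>"
        then have "\<exists>w\<ge>0. w \<le> u' \<and> dist (x w) p = \<rho> / 2"
          using x0 \<delta> rho u' u(1)
          by (intro IVT' continuous_on_subset[OF cs]) (auto simp: H_def)
        then obtain w where "0 \<le> w" "w \<le> u'" "dist (x w) p = \<rho> / 2" by blast
        then have "w \<in> H" using u' u(1) by (auto simp: H_def)
        then have "w = u'" using u(2) u' \<open>w \<le> u'\<close> by fastforce
        then show False using \<open>dist (x w) p = \<rho> / 2\<close> \<open>\<not> dist (x u') p < \<rho>\<close> rho by simp
      qed
      have "dist (x u) p \<le> B * K * exp (- r * u) * dist (x 0) p"
        using u(1) s t before by (intro decay) (auto simp: H_def)
      also have "\<dots> \<le> B * K * 1 * dist (x 0) p"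
        using B K r u(1) by (intro mult_right_mono mult_left_mono) (auto simp: H_def)
      also have "\<dots> < B * K * \<delta>" using x0 B K by simp
      also have "\<dots> \<le> \<rho> / 2" using \<delta>(3) by (simp add: mult.commute)
      finally show False using u(1) by (simp add: H_def)
    qed
    then show ?thesis using t by (intro decay)
  qed
  then show ?thesis
    unfolding locally_exponentially_stable_def
    using \<delta>(1) B K(1) r by (intro exI[of _ \<delta>] conjI exI[of _ "B * K"] exI[of _ r]) auto
qed

lemma locally_exponentially_stable_imp_lyapunov_stable:
  assumes "locally_exponentially_stable f M p"
  shows "lyapunov_stable f M p"
  unfolding lyapunov_stable_def
proof (intro allI impI)
  obtain \<delta> C r where C: "0 < \<delta>" "0 < C" "0 < r" and
    *: "\<And>T x t. 0 < T \<Longrightarrow> ode_solution (\<lambda>_. f) M {0..<T} x \<Longrightarrow> dist (x 0) p < \<delta> \<Longrightarrow> t \<in> {0..<T} \<Longrightarrow>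
        dist (x t) p \<le> C * exp (- r * t) * dist (x 0) p"
    using assms unfolding locally_exponentially_stable_def by metis
  fix e :: real assume e: "0 < e"
  have "dist (x t) p < e" if "0 < T" "ode_solution (\<lambda>_. f) M {0..<T} x" "dist (x 0) p < min \<delta> (e / C)"
    "t \<in> {0..<T}" for T x t
  proof -
    have "dist (x t) p \<le> C * exp (- r * t) * dist (x 0) p" using that by (intro *) auto
    also have "\<dots> \<le> C * 1 * dist (x 0) p"
      using C that by (intro mult_right_mono mult_left_mono) auto
    also have "\<dots> < C * (e / C)" using that C by (subst mult_1_right, intro mult_strict_left_mono) auto
    finally show ?thesis using C by simp
  qed
  then show "\<exists>\<delta>>0. \<forall>T>0. \<forall>x. ode_solution (\<lambda>_. f) M {0..<T} x \<and> dist (x 0) p < \<delta> \<longrightarrow>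
      (\<forall>t\<in>{0..<T}. dist (x t) p < e)"
    using C e by (intro exI[of _ "min \<delta> (e / C)"]) auto
qed

text \<open>Arbitrarily near \<open>p\<close> there are states outside the cone. Stability would
  trap the solution starting there, and comparison with the constant solution would put its initial
  state into the cone.\<close>

lemma not_lyapunov_stableI:
  fixes f :: "'a::real_normed_vector \<Rightarrow> 'a" and S :: "'a \<Rightarrow> 'b::real_inner" and U :: "'a \<Rightarrow> 'c::real_inner"
  assumes S: "bounded_linear S" and U: "bounded_linear U" and rho: "0 < \<rho>" and r: "0 < r"
    and decr: "\<And>y. y \<in> M \<Longrightarrow> dist y p < \<rho> \<Longrightarrow>
      S (y - p) \<bullet> S (f y) - U (y - p) \<bullet> U (f y) \<le> - r * (norm (U (y - p)))\<^sup>2"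
    and ex: "\<And>q. q \<in> M \<Longrightarrow> \<exists>x. ode_solution (\<lambda>_. f) M {0..} x \<and> x 0 = q"
    and near: "\<And>e. 0 < e \<Longrightarrow> \<exists>q\<in>M. dist q p < e \<and> norm (S (q - p)) < norm (U (q - p))"
  shows "\<not> lyapunov_stable f M p"
proof
  assume "lyapunov_stable f M p"
  then obtain \<delta> where \<delta>: "0 < \<delta>" "\<And>T x t. 0 < T \<Longrightarrow> ode_solution (\<lambda>_. f) M {0..<T} x \<Longrightarrow>
      dist (x 0) p < \<delta> \<Longrightarrow> t \<in> {0..<T} \<Longrightarrow> dist (x t) p < \<rho>"
    using rho unfolding lyapunov_stable_def by metis
  obtain q where q: "q \<in> M" "dist q p < \<delta>" "norm (S (q - p)) < norm (U (q - p))"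
    using near[OF \<delta>(1)] by blast
  obtain x where x: "ode_solution (\<lambda>_. f) M {0..} x" "x 0 = q" using ex[OF q(1)] by blast
  have x': "x t \<in> M" "(x has_vector_derivative f (x t)) (at t within {0..})" if "0 \<le> t" for t
    using x(1)[unfolded ode_solution_def, rule_format, of t] that by simp_all
  have close: "dist (x t) p < \<rho>" if "0 \<le> t" for t
  proof (rule \<delta>(2))
    \<comment> \<open>Stability speaks of solutions on half-open intervals; the bound
      \<open>t + 1\<close> makes the interval contain \<open>t\<close>.\<close>
    show "ode_solution (\<lambda>_. f) M {0..<t+1} x"
      unfolding ode_solution_def
    proof
      fix s assume "s \<in> {0..<t+1}"
      then show "x s \<in> M \<and> (x has_vector_derivative f (x s)) (at s within {0..<t+1})"
        by (auto intro!: x' has_vector_derivative_within_subset[OF x'(2)])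
    qed
    show "0 < t + 1" "t \<in> {0..<t+1}" using that by auto
    show "dist (x 0) p < \<delta>" by (simp only: x(2) q(2))
  qed
  obtain K where K: "0 < K" "\<And>y. norm (U y) \<le> norm y * K"
    using bounded_linear.pos_bounded[OF U] by blast
  have "norm (U (x 0 - p)) \<le> norm (S (x 0 - p))"
  proof (rule trapped_imp_cone[OF S U _ r])
    fix t :: real assume t: "0 \<le> t"
    show "((\<lambda>t. x t - p) has_vector_derivative f (x t)) (at t within {0..})"
      using x'(2)[OF t] by (auto intro!: derivative_eq_intros)
    show "S (x t - p) \<bullet> S (f (x t)) - U (x t - p) \<bullet> U (f (x t)) \<le> - r * (norm (U (x t - p)))\<^sup>2"
      using t by (intro decr x' close)
    have "norm (x t - p) * K \<le> \<rho> * K"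
      using close[OF t] K by (intro mult_right_mono) (auto simp: dist_norm)
    then show "norm (U (x t - p)) \<le> \<rho> * K" by (rule order.trans[OF K(2)])
  qed simp
  then show False using q(3) x(2) by simp
qed

section \<open>Contraction and expansion near the equilibria\<close>

lemma abs_inner_le: "norm x \<le> a \<Longrightarrow> norm y \<le> c \<Longrightarrow> \<bar>x \<bullet> y\<bar> \<le> a * c"
  by (rule order.trans[OF Cauchy_Schwarz_ineq2]) (intro mult_mono, auto intro: order.trans[OF norm_ge_zero])

lemma norm_cross_le: "norm x \<le> a \<Longrightarrow> norm y \<le> c \<Longrightarrow> norm (x \<times> y) \<le> a * c"
proof -
  assume *: "norm x \<le> a" "norm y \<le> c"
  have "(norm (x \<times> y))\<^sup>2 \<le> (norm x * norm y)\<^sup>2"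
    using norm_cross_dot[of x y] zero_le_power2[of "x \<bullet> y"] by linarith
  then have "norm (x \<times> y) \<le> norm x * norm y" by (rule power2_le_imp_le) simp
  also have "\<dots> \<le> a * c" using * by (intro mult_mono) (auto intro: order.trans[OF norm_ge_zero])
  finally show ?thesis .
qed

lemma norm_mean_le:
  fixes x y c :: "'a::real_normed_vector"
  assumes "norm (x - c) \<le> e" "norm (y - c) \<le> e"
  shows "norm ((1/2) *\<^sub>R (x + y) - c) \<le> e"
proof -
  have "(1/2) *\<^sub>R (x + y) - c = (1/2) *\<^sub>R ((x - c) + (y - c))"
    by (simp add: algebra_simps flip: scaleR_add_left)
  then have "norm ((1/2) *\<^sub>R (x + y) - c) = norm ((x - c) + (y - c)) / 2" by simp
  also have "\<dots> \<le> e" using norm_triangle_ineq[of "x - c" "y - c"] assms by linarith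
  finally show ?thesis .
qed

text \<open>A product rule for differences without second-order term. Applied to the constant inner
  products of frame vectors, it yields exact linear relations between their differences.\<close>

lemma inner_diff_mean:
  fixes x y :: "'a::real_inner"
  shows "x \<bullet> y - x' \<bullet> y' = (x - x') \<bullet> ((1/2) *\<^sub>R (y + y')) + ((1/2) *\<^sub>R (x + x')) \<bullet> (y - y')"
  by (simp add: inner_diff_left inner_diff_right inner_add_left inner_add_right field_simps)

lemma scaleR_diff_mean:
  fixes x y :: "'a::real_vector"
  shows "\<alpha> *\<^sub>R x - \<beta> *\<^sub>R y = ((\<alpha> + \<beta>) / 2) *\<^sub>R (x - y) + (\<alpha> - \<beta>) *\<^sub>R ((1/2) *\<^sub>R (x + y))"
proof -
  have *: "(c / 2) *\<^sub>R z + (c / 2) *\<^sub>R z = c *\<^sub>R z" for c and z :: 'a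
    by (simp flip: scaleR_add_left)
  show ?thesis
    by (simp add: add_divide_distrib diff_divide_distrib algebra_simps *)
qed

context error_system
begin

text \<open>\<open>s = 1\<close> is the upright and \<open>s = -1\<close> the inverted pole. Yaw is
  left free, since the reduced dynamics do not see it.\<close>

definition near_axis :: "real \<Rightarrow> real \<Rightarrow> state \<Rightarrow> bool" where
  "near_axis s e p \<longleftrightarrow> p \<in> state_space \<and> norm (zl p - b *\<^sub>R e3) \<le> e \<and> norm (gam p - s *\<^sub>R e3) \<le> e"

text \<open>The computation for \<open>V\<close> is repeated for two states, with half of
  \<open>s * \<mu> * (norm (gam p - gam q))\<^sup>2\<close> as second term: on unit vectors
  \<open>1 - gam p \<bullet> e3\<close> equals
  \<open>1 - s + s / 2 * (norm (gam p - s *\<^sub>R e3))\<^sup>2\<close>. The extra terms measure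
  the distance to the equilibrium and are small with \<open>e\<close>.\<close>

lemma axis_difference:
  assumes s: "s = 1 \<or> s = -1"
  obtains e where "0 < e"
    "\<And>p q. near_axis s e p \<Longrightarrow> near_axis s e q \<Longrightarrow>
      (zl p - zl q) \<bullet> (zl (f p) - zl (f q)) + s * (\<mu> * ((gam p - gam q) \<bullet> (gam (f p) - gam (f q))))
      \<le> - (k1v / 4) * ((norm (zl p - zl q))\<^sup>2 + b\<^sup>2 * (norm (gam p - gam q))\<^sup>2)"
proof -
  define A where "A = k1v + d"
  have A: "A > 0" using k1v d by (simp add: A_def)
  have s1: "\<bar>s\<bar> = 1" "s * s = 1" using s by auto
  \<comment> \<open>The two bounds limit the perturbations to \<open>k1v / 4\<close> and
    \<open>k1v * b\<^sup>2 / 4\<close>, half of the margin left by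
    \<open>quadratic_estimate\<close>.\<close>
  define e where "e = min (k1v / (4 * (1 + b) * (d + 1))) (k1v * b\<^sup>2 / (4 * (1 + b) * (d + b * A)))"
  have e: "0 < e" using k1v b d A unfolding e_def by (simp add: add_nonneg_pos)
  define e1 where "e1 = (1 + b) * e"
  have e1: "0 < e1" using e b by (simp add: e1_def)
  have e1d: "e1 * d \<le> k1v / 4"
  proof -
    have "e1 * d \<le> e1 * (d + 1)" using e1 by simp
    also have "\<dots> = e * ((1 + b) * (d + 1))" by (simp add: e1_def)
    also have "\<dots> \<le> k1v / (4 * (1 + b) * (d + 1)) * ((1 + b) * (d + 1))"
      using b d unfolding e_def by (intro mult_right_mono) auto
    also have "\<dots> = k1v / 4"
    proof -
      have "(1 + b) * (d + 1) \<noteq> 0" using b d by auto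
      then show ?thesis by (simp only: mult.assoc) simp
    qed
    finally show ?thesis .
  qed
  have e1dA: "e1 * (d + b * A) \<le> k1v * b\<^sup>2 / 4"
  proof -
    have p: "0 < d + b * A" using d b A by (simp add: add_nonneg_pos)
    have "e1 * (d + b * A) = e * ((1 + b) * (d + b * A))" by (simp add: e1_def)
    also have "\<dots> \<le> k1v * b\<^sup>2 / (4 * (1 + b) * (d + b * A)) * ((1 + b) * (d + b * A))"
      using b p unfolding e_def by (intro mult_right_mono) auto
    also have "\<dots> = k1v * b\<^sup>2 / 4"
    proof -
      have "(1 + b) * (d + b * A) \<noteq> 0" using b p by auto
      then show ?thesis by (simp only: mult.assoc) simp
    qed
    finally show ?thesis .
  qed
  show ?thesis
  proof (rule that[OF e])
    fix p q assume near: "near_axis s e p" "near_axis s e q"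
    then have M: "p \<in> state_space" "q \<in> state_space" by (auto simp: near_axis_def)
    txt \<open>With the means \<open>w\<close> and \<open>\<gamma>\<close> as second factors, differences of products need no
      remainder term, and \<open>\<eta>\<close> is exactly orthogonal to \<open>\<gamma>\<close>.\<close>
    define w where "w = (1/2) *\<^sub>R (zl p + zl q)"
    define \<gamma> where "\<gamma> = (1/2) *\<^sub>R (gam p + gam q)"
    define \<zeta> where "\<zeta> = zl p - zl q"
    define \<eta> where "\<eta> = gam p - gam q"
    define \<tau> where "\<tau> = (gam p \<bullet> zl p + gam q \<bullet> zl q) / 2"
    define r where "r = \<eta> \<bullet> \<eta>"
    define x where "x = \<zeta> \<bullet> \<eta>"
    define y where "y = \<gamma> \<bullet> \<zeta>"
    define Z where "Z = \<zeta> \<bullet> \<zeta>"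
    define Q where "Q = Z - y\<^sup>2"
    have gg: "gam p \<bullet> gam p = 1" "gam q \<bullet> gam q = 1" using coords_inner M by auto
    have \<eta>\<gamma>: "\<eta> \<bullet> \<gamma> = 0"
      by (simp add: \<eta>_def \<gamma>_def inner_diff_left inner_diff_right inner_add_right gg inner_commute)
    have w_near: "norm (w - b *\<^sub>R e3) \<le> e"
      unfolding w_def using near by (intro norm_mean_le) (auto simp: near_axis_def)
    have \<gamma>_near: "norm (\<gamma> - s *\<^sub>R e3) \<le> e"
      unfolding \<gamma>_def using near by (intro norm_mean_le) (auto simp: near_axis_def)
    have \<gamma>1: "norm \<gamma> \<le> 1"
      using norm_mean_le[of "gam p" 0 1 "gam q"] coords_norm M by (simp add: \<gamma>_def)
    have hd: "hh p - hh q = \<zeta> - \<tau> *\<^sub>R \<eta> - (y + \<eta> \<bullet> w) *\<^sub>R \<gamma>"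
    proof -
      have "y + \<eta> \<bullet> w = gam p \<bullet> zl p - gam q \<bullet> zl q"
        by (simp add: y_def \<gamma>_def \<zeta>_def \<eta>_def w_def inner_diff_left inner_diff_right
            inner_add_left inner_add_right field_simps)
      moreover have "hh p - hh q = \<zeta> - ((gam p \<bullet> zl p) *\<^sub>R gam p - (gam q \<bullet> zl q) *\<^sub>R gam q)"
        by (simp add: hh_def \<zeta>_def)
      ultimately show ?thesis
        unfolding scaleR_diff_mean[of "gam p \<bullet> zl p"] by (simp add: \<tau>_def \<eta>_def \<gamma>_def)
    qed
    have X: "\<eta> \<bullet> (hh p - hh q) = x - \<tau> * r"
      unfolding hd by (simp add: inner_diff_right \<eta>\<gamma> x_def r_def inner_commute)
    have Y: "\<zeta> \<bullet> (hh p - hh q) = Q - \<tau> * x - y * (\<eta> \<bullet> w)"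
      unfolding hd Q_def
      by (simp add: inner_diff_right x_def Z_def y_def inner_commute power2_eq_square algebra_simps)
    have lhs: "\<zeta> \<bullet> (zl (f p) - zl (f q)) + s * (\<mu> * (\<eta> \<bullet> (gam (f p) - gam (f q))))
        = - k1v * Z - d * (Q - \<tau> * x - y * (\<eta> \<bullet> w)) + s * (b * A * (x - \<tau> * r))"
    proof -
      have "zl (f p) - zl (f q) = - k1v *\<^sub>R \<zeta> - d *\<^sub>R (hh p - hh q)"
        by (simp add: zl_f M \<zeta>_def algebra_simps)
      then have "\<zeta> \<bullet> (zl (f p) - zl (f q)) = - k1v * Z - d * (\<zeta> \<bullet> (hh p - hh q))"
        by (simp add: inner_diff_right Z_def)
      moreover have "gam (f p) - gam (f q) = k1r *\<^sub>R (hh p - hh q)"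
        by (simp add: gam_f M algebra_simps)
      then have "\<mu> * (\<eta> \<bullet> (gam (f p) - gam (f q))) = (\<mu> * k1r) * (\<eta> \<bullet> (hh p - hh q))" by simp
      ultimately show ?thesis by (simp only: X Y \<mu>_k1r A_def)
    qed
    \<comment> \<open>As \<open>\<eta>\<close> is orthogonal to \<open>\<gamma>\<close>, a multiple
      of \<open>\<gamma>\<close> can be subtracted from \<open>\<zeta>\<close> first. The mean of
      two unit vectors has norm at most 1, so \<open>Q\<close> bounds the square of what
      remains.\<close>
    have xQ: "x\<^sup>2 \<le> Q * r"
    proof -
      have "x = (\<zeta> - y *\<^sub>R \<gamma>) \<bullet> \<eta>" 
        using \<eta>\<gamma> by (simp add: x_def inner_diff_left inner_diff_right inner_commute)
      then have "x\<^sup>2 \<le> ((\<zeta> - y *\<^sub>R \<gamma>) \<bullet> (\<zeta> - y *\<^sub>R \<gamma>)) * r"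
        using Cauchy_Schwarz_ineq[of "\<zeta> - y *\<^sub>R \<gamma>" \<eta>] by (simp add: r_def)
      also have "(\<zeta> - y *\<^sub>R \<gamma>) \<bullet> (\<zeta> - y *\<^sub>R \<gamma>) = Q - y\<^sup>2 * (1 - \<gamma> \<bullet> \<gamma>)"
        by (simp add: inner_diff_left inner_diff_right Q_def Z_def y_def inner_commute power2_eq_square algebra_simps)
      also have "\<dots> * r \<le> Q * r"
        using \<gamma>1 power_le_one[of "norm \<gamma>" 2]
        by (intro mult_right_mono) (auto simp: power2_norm_eq_inner r_def)
      finally show ?thesis .
    qed
    have r: "0 \<le> r" by (simp add: r_def)
    have yZ: "\<bar>y\<bar> \<le> 1 * norm \<zeta>" unfolding y_def using \<gamma>1 by (intro abs_inner_le) auto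
    then have "y\<^sup>2 \<le> Z"
      by (simp add: Z_def flip: power2_norm_eq_inner) (metis abs_le_square_iff abs_norm_cancel)
    then have Q: "0 \<le> Q" by (simp add: Q_def)
    have main: "- k1v * Z - d * Q + s * b * (k1v + 2 * d) * x - b\<^sup>2 * A * r \<le> - (k1v / 2) * (Z + b\<^sup>2 * r)"
      unfolding A_def by (rule quadratic_estimate[OF xQ Q _ r s1(1)]) (simp add: Q_def)
    have \<tau>: "\<bar>\<tau> - s * b\<bar> \<le> e1"
    proof -
      have "\<bar>gam p' \<bullet> zl p' - s * b\<bar> \<le> e1" if p': "near_axis s e p'" for p'
      proof -
        have M': "p' \<in> state_space" using p' by (simp add: near_axis_def)
        have "gam p' \<bullet> zl p' - s * b = gam p' \<bullet> (zl p' - b *\<^sub>R e3) + b * ((gam p' - s *\<^sub>R e3) \<bullet> e3)"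
          by (simp add: inner_diff_left inner_diff_right inner_e3 algebra_simps)
        moreover have "\<bar>gam p' \<bullet> (zl p' - b *\<^sub>R e3)\<bar> \<le> 1 * e" "\<bar>(gam p' - s *\<^sub>R e3) \<bullet> e3\<bar> \<le> e * 1"
          using p' coords_norm[OF M'] frame_norm unfolding near_axis_def by (intro abs_inner_le; simp)+
        then have "\<bar>gam p' \<bullet> (zl p' - b *\<^sub>R e3)\<bar> \<le> e" "\<bar>b * ((gam p' - s *\<^sub>R e3) \<bullet> e3)\<bar> \<le> b * e"
          using b by (auto simp: abs_mult)
        ultimately show ?thesis unfolding e1_def by (simp add: distrib_right)
      qed
      from norm_mean_le[OF this[OF near(1), folded real_norm_def] this[OF near(2), folded real_norm_def]]
      show ?thesis by (simp add: \<tau>_def)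
    qed
    \<comment> \<open>At the equilibrium \<open>w\<close> is parallel to \<open>\<gamma>\<close>, to
      which \<open>\<eta>\<close> is orthogonal. Subtracting \<open>s * b\<close> times
      \<open>\<gamma>\<close> from \<open>w\<close> leaves a vector of norm at most
      \<open>e + b * e\<close>.\<close>
    have \<eta>w: "\<bar>\<eta> \<bullet> w\<bar> \<le> e1 * norm \<eta>"
    proof -
      have "\<eta> \<bullet> w = \<eta> \<bullet> ((w - b *\<^sub>R e3) - (s * b) *\<^sub>R (\<gamma> - s *\<^sub>R e3))"
        using s1 by (simp add: inner_diff_right \<eta>\<gamma> mult.assoc algebra_simps)
      moreover have "norm ((w - b *\<^sub>R e3) - (s * b) *\<^sub>R (\<gamma> - s *\<^sub>R e3)) \<le> e + b * e"
        by (rule order.trans[OF norm_triangle_ineq4 add_mono])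
          (use s1 b w_near \<gamma>_near in \<open>auto simp: abs_mult\<close>)
      ultimately have "\<bar>\<eta> \<bullet> w\<bar> \<le> norm \<eta> * (e + b * e)"
        by (simp only:) (intro abs_inner_le order.refl)
      then show ?thesis by (simp add: e1_def algebra_simps)
    qed
    have nr: "(norm \<zeta>)\<^sup>2 = Z" "(norm \<eta>)\<^sup>2 = r" by (simp_all add: Z_def r_def power2_norm_eq_inner)
    have prod: "norm \<zeta> * norm \<eta> \<le> (Z + r) / 2"
      using sum_sq_le[of "norm \<zeta>" "norm \<eta>"] by (simp add: nr)
    have t1: "(\<tau> - s * b) * x \<le> e1 * ((Z + r) / 2)"
    proof -
      have "\<bar>x\<bar> \<le> norm \<zeta> * norm \<eta>" unfolding x_def by (rule Cauchy_Schwarz_ineq2)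
      then have "\<bar>x\<bar> \<le> (Z + r) / 2" using prod by linarith
      then have "\<bar>(\<tau> - s * b) * x\<bar> \<le> e1 * ((Z + r) / 2)"
        unfolding abs_mult using \<tau> e1 by (intro mult_mono) auto
      then show ?thesis by linarith
    qed
    have t2: "y * (\<eta> \<bullet> w) \<le> e1 * ((Z + r) / 2)"
    proof -
      have "\<bar>y * (\<eta> \<bullet> w)\<bar> \<le> norm \<zeta> * (e1 * norm \<eta>)"
        unfolding abs_mult using yZ \<eta>w by (intro mult_mono) auto
      also have "\<dots> = e1 * (norm \<zeta> * norm \<eta>)" by simp
      also have "\<dots> \<le> e1 * ((Z + r) / 2)" using prod e1 by (intro mult_left_mono) auto
      finally show ?thesis by linarith
    qed
    have t3: "- (s * (\<tau> - s * b)) \<le> e1" using \<tau> s by auto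
    have "- k1v * Z - d * (Q - \<tau> * x - y * (\<eta> \<bullet> w)) + s * (b * A * (x - \<tau> * r))
      = (- k1v * Z - d * Q + s * b * (k1v + 2 * d) * x - b\<^sup>2 * A * r)
        + d * ((\<tau> - s * b) * x) + d * (y * (\<eta> \<bullet> w)) + - (s * (\<tau> - s * b)) * (b * A * r)"
    proof -
      have "s * (s * b) = b" using s1 by (metis mult.assoc mult_1)
      then have "- (s * (\<tau> - s * b)) = b - s * \<tau>" by (simp add: right_diff_distrib)
      then show ?thesis by (simp only: A_def) (simp add: power2_eq_square algebra_simps)
    qed
    also have "\<dots> \<le> - (k1v / 2) * (Z + b\<^sup>2 * r) + d * (e1 * ((Z + r) / 2)) + d * (e1 * ((Z + r) / 2))
        + e1 * (b * A * r)"
      using main t1 t2 t3 d b A r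
      by (intro add_mono mult_left_mono mult_right_mono) auto
    also have "\<dots> = - (k1v / 2) * (Z + b\<^sup>2 * r) + e1 * d * Z + e1 * (d + b * A) * r"
      by (simp add: field_simps)
    also have "\<dots> \<le> - (k1v / 2) * (Z + b\<^sup>2 * r) + k1v / 4 * Z + k1v * b\<^sup>2 / 4 * r"
      using e1d e1dA r by (intro add_mono mult_right_mono order.refl) (auto simp: Z_def)
    also have "\<dots> = - (k1v / 4) * (Z + b\<^sup>2 * r)" by (simp add: field_simps)
    finally show "(zl p - zl q) \<bullet> (zl (f p) - zl (f q)) + s * (\<mu> * ((gam p - gam q) \<bullet> (gam (f p) - gam (f q))))
      \<le> - (k1v / 4) * ((norm (zl p - zl q))\<^sup>2 + b\<^sup>2 * (norm (gam p - gam q))\<^sup>2)"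
      unfolding lhs[symmetric] \<zeta>_def[symmetric] \<eta>_def[symmetric] nr .
  qed
qed

section \<open>Yaw near the two upright equilibria\<close>

definition near_upright :: "real \<Rightarrow> real \<Rightarrow> state \<Rightarrow> bool" where
  "near_upright s e p \<longleftrightarrow> near_axis 1 e p \<and> norm (nor p - s *\<^sub>R north) \<le> e"

text \<open>The orthonormality relations, differenced with \<open>inner_diff_mean\<close>, control
  the components of \<open>nor p - nor q\<close> along \<open>north\<close> and \<open>e3\<close> by
  a small multiple of its norm and by \<open>gam p - gam q\<close>. Only the component along
  \<open>east\<close>, the yaw coordinate, is free. With \<open>e \<le> 1/4\<close> the small
  multiples are absorbed.\<close>

lemma upright_coords_difference:
  assumes s: "s = 1 \<or> s = -1" and e: "e \<le> 1/4"
    and near: "near_upright s e p" "near_upright s e q"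
  shows "norm (nor p - nor q) \<le> 2 * \<bar>yaw p - yaw q\<bar> + 2 * norm (gam p - gam q)" (is ?N)
    and "norm (eas p - eas q) \<le> 2 * \<bar>yaw p - yaw q\<bar> + 3 * norm (gam p - gam q)" (is ?X)
    and "\<bar>(eas p - eas q) \<bullet> e3\<bar> \<le> e * norm (eas p - eas q) + norm (gam p - gam q)" (is ?E)
    and "\<bar>(eas p - eas q) \<bullet> north + (yaw p - yaw q)\<bar> \<le> e * norm (eas p - eas q) + 2 * e * norm (nor p - nor q)" (is ?Y)
    and "norm (eas p - s *\<^sub>R east) \<le> 2 * e"
proof -
  have s1: "\<bar>s\<bar> = 1" using s by auto
  have M: "p \<in> state_space" "q \<in> state_space" using near by (auto simp: near_upright_def near_axis_def)
  define n \<gamma> a where "n = (1/2) *\<^sub>R (nor p + nor q)" and "\<gamma> = (1/2) *\<^sub>R (gam p + gam q)"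
    and "a = (1/2) *\<^sub>R (eas p + eas q)"
  define \<nu> \<eta> \<xi> where "\<nu> = nor p - nor q" and "\<eta> = gam p - gam q" and "\<xi> = eas p - eas q"
  have n1: "norm n \<le> 1" "norm \<gamma> \<le> 1" "norm a \<le> 1"
    unfolding n_def \<gamma>_def a_def
    using coords_norm[OF M(1)] coords_norm[OF M(2)]
    by (intro norm_mean_le[where c = 0, unfolded diff_zero]; simp)+
  have n_near: "norm (n - s *\<^sub>R north) \<le> e" and \<gamma>_near: "norm (\<gamma> - e3) \<le> e"
    unfolding n_def \<gamma>_def using near by (auto intro!: norm_mean_le simp: near_upright_def near_axis_def)
  have eas_near: "norm (eas p' - s *\<^sub>R east) \<le> 2 * e" if p': "near_upright s e p'" for p'
  proof -
    have M': "p' \<in> state_space" using p' by (auto simp: near_upright_def near_axis_def)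
    have "eas p' - s *\<^sub>R east = (gam p' - e3) \<times> nor p' + e3 \<times> (nor p' - s *\<^sub>R north)"
      by (simp add: coords_inner[OF M'] cross.diff_left cross.diff_right cross_mult_right frame)
    also have "norm \<dots> \<le> e * 1 + 1 * e"
      using p' coords_norm[OF M'] frame_norm
      by (intro order.trans[OF norm_triangle_ineq] add_mono norm_cross_le)
        (auto simp: near_upright_def near_axis_def)
    finally show ?thesis by simp
  qed
  from this[OF near(1)] show "norm (eas p - s *\<^sub>R east) \<le> 2 * e" .
  have a_near: "norm (a - s *\<^sub>R east) \<le> 2 * e"
    unfolding a_def by (intro norm_mean_le eas_near near)
  have orth: "\<nu> \<bullet> n = 0" "\<nu> \<bullet> \<gamma> + n \<bullet> \<eta> = 0" "\<xi> \<bullet> \<gamma> + a \<bullet> \<eta> = 0" "\<xi> \<bullet> n + a \<bullet> \<nu> = 0"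
    using inner_diff_mean[of "nor p" "nor p" "nor q" "nor q"] inner_diff_mean[of "nor p" "gam p" "nor q" "gam q"]
      inner_diff_mean[of "eas p" "gam p" "eas q" "gam q"] inner_diff_mean[of "eas p" "nor p" "eas q" "nor q"]
    unfolding n_def[symmetric] \<gamma>_def[symmetric] a_def[symmetric] \<nu>_def[symmetric] \<eta>_def[symmetric] \<xi>_def[symmetric]
    by (simp_all add: coords_inner M inner_commute)
  have yaw: "\<nu> \<bullet> east = yaw p - yaw q" by (simp add: \<nu>_def yaw_def inner_diff_left)
  have "\<bar>\<nu> \<bullet> north\<bar> = \<bar>\<nu> \<bullet> (n - s *\<^sub>R north)\<bar>"
    using orth(1) s1 by (simp add: inner_diff_right abs_mult)
  also have "\<dots> \<le> norm \<nu> * e" using n_near by (intro abs_inner_le) auto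
  finally have north: "\<bar>\<nu> \<bullet> north\<bar> \<le> norm \<nu> * e" .
  have "\<nu> \<bullet> e3 = - (\<nu> \<bullet> (\<gamma> - e3)) - n \<bullet> \<eta>"
    using orth(2) by (simp add: inner_diff_right algebra_simps)
  moreover have "\<bar>\<nu> \<bullet> (\<gamma> - e3)\<bar> \<le> norm \<nu> * e" "\<bar>n \<bullet> \<eta>\<bar> \<le> 1 * norm \<eta>"
    using n1 \<gamma>_near by (intro abs_inner_le; simp)+
  ultimately have down: "\<bar>\<nu> \<bullet> e3\<bar> \<le> norm \<nu> * e + norm \<eta>" by linarith
  have e4: "4 * (norm \<nu> * e) \<le> norm \<nu>" using mult_left_mono[OF e, of "norm \<nu>"] by simp
  have N: "norm \<nu> \<le> 2 * \<bar>yaw p - yaw q\<bar> + 2 * norm \<eta>"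
  proof -
    define u U where "u = norm \<nu> * e" and "U = \<bar>yaw p - yaw q\<bar>"
    have "norm \<nu> \<le> u + U + (u + norm \<eta>)"
      using frame_norm_le[of \<nu>] north down unfolding yaw u_def[symmetric] U_def[symmetric]
      by linarith
    then show ?thesis using e4 unfolding u_def[symmetric] U_def[symmetric] by linarith
  qed
  then show ?N by (simp add: \<nu>_def \<eta>_def)
  have "\<xi> = \<eta> \<times> n + \<gamma> \<times> \<nu>"
  proof -
    have "\<eta> \<times> n + \<gamma> \<times> \<nu> = (1/2) *\<^sub>R ((gam p - gam q) \<times> (nor p + nor q) + (gam p + gam q) \<times> (nor p - nor q))"
      by (simp add: \<eta>_def n_def \<gamma>_def \<nu>_def cross_mult_left cross_mult_right flip: scaleR_add_right)
    also have "\<dots> = (1/2) *\<^sub>R (2 *\<^sub>R (gam p \<times> nor p) - 2 *\<^sub>R (gam q \<times> nor q))"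
      by (simp add: cross.diff_left cross.diff_right cross.add_left cross.add_right scaleR_2)
    finally show ?thesis by (simp add: \<xi>_def coords_inner M scaleR_diff_right)
  qed
  also have "norm \<dots> \<le> norm \<eta> * 1 + 1 * norm \<nu>"
    using n1 by (intro order.trans[OF norm_triangle_ineq] add_mono norm_cross_le) auto
  finally show ?X using N by (simp add: \<xi>_def \<eta>_def)
  have "\<xi> \<bullet> e3 = - (\<xi> \<bullet> (\<gamma> - e3)) - a \<bullet> \<eta>"
    using orth(3) by (simp add: inner_diff_right algebra_simps)
  moreover have "\<bar>\<xi> \<bullet> (\<gamma> - e3)\<bar> \<le> norm \<xi> * e" "\<bar>a \<bullet> \<eta>\<bar> \<le> 1 * norm \<eta>"
    using n1 \<gamma>_near by (intro abs_inner_le; simp)+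
  ultimately have "\<bar>\<xi> \<bullet> e3\<bar> \<le> e * norm \<xi> + norm \<eta>" by (simp add: mult.commute)
  then show ?E by (simp add: \<xi>_def \<eta>_def)
  have "s * (\<xi> \<bullet> north + \<nu> \<bullet> east) = - (\<xi> \<bullet> (n - s *\<^sub>R north)) - (a - s *\<^sub>R east) \<bullet> \<nu>"
    using orth(4) by (simp add: inner_diff_right inner_diff_left inner_commute algebra_simps)
  moreover have "\<bar>\<xi> \<bullet> (n - s *\<^sub>R north)\<bar> \<le> norm \<xi> * e" "\<bar>(a - s *\<^sub>R east) \<bullet> \<nu>\<bar> \<le> 2 * e * norm \<nu>"
    using n_near a_near by (auto intro!: abs_inner_le)
  ultimately have "\<bar>s * (\<xi> \<bullet> north + \<nu> \<bullet> east)\<bar> \<le> e * norm \<xi> + 2 * e * norm \<nu>" by (simp add: mult.commute)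
  then show ?Y by (simp add: abs_mult s1 yaw) (simp add: \<xi>_def \<nu>_def)
qed


lemma near_axis_mono: "near_axis s e p \<Longrightarrow> e \<le> e' \<Longrightarrow> near_axis s e' p"
  by (auto simp: near_axis_def)

text \<open>Near the equilibrium \<open>eas p\<close> is close to \<open>s *\<^sub>R east\<close>,
  and the north component of its difference is close to minus the yaw difference, so the magnetic
  correction contributes the rate \<open>- s * k2r * \<rho>\<^sup>2\<close>. Errors proportional to
  the yaw difference are made small by \<open>e\<close>; the coupling to \<open>zl\<close> and
  \<open>gam\<close> only has to be bounded, by \<open>C\<close>.\<close>

lemma yaw_difference:
  assumes s: "s = 1 \<or> s = -1"
  obtains e C where "0 < e" "e \<le> 1/4" "0 \<le> C"
    "\<And>p q. near_upright s e p \<Longrightarrow> near_upright s e q \<Longrightarrow>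
      \<bar>(yaw (f p) - yaw (f q)) + s * (k2r * \<rho>\<^sup>2) * (yaw p - yaw q)\<bar>
      \<le> C * (norm (zl p - zl q) + norm (gam p - gam q)) + (k2r * \<rho>\<^sup>2 / 2) * \<bar>yaw p - yaw q\<bar>"
proof -
  define m h3 where "m = norm mI" and "h3 = \<bar>mI \<bullet> e3\<bar>"
  have mh: "0 \<le> m" "0 \<le> h3" by (simp_all add: m_def h3_def)
  \<comment> \<open>\<open>\<kappa>\<close> is the coefficient of
    \<open>e * \<bar>yaw p - yaw q\<bar>\<close> that the estimates of \<open>T1\<close> and
    \<open>T2\<close> below produce, \<open>c2\<close> the share of \<open>T2\<close>. The choice of
    \<open>e\<close> limits this error to half of the rate
    \<open>k2r * \<rho>\<^sup>2\<close>.\<close>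
  define c2 where "c2 = 8 * m + 6 * \<rho> + 2 * h3"
  define \<kappa> where "\<kappa> = 2 * k1r * (1 + b) + k2r * \<rho> * c2"
  have \<kappa>: "0 < \<kappa>"
    using k1r b k2r \<rho> mh unfolding \<kappa>_def c2_def by (intro add_pos_nonneg mult_pos_pos mult_nonneg_nonneg) auto
  define e where "e = min (1/4) (k2r * \<rho>\<^sup>2 / (2 * \<kappa>))"
  have e: "0 < e" "e \<le> 1/4" using k2r \<rho> \<kappa> by (auto simp: e_def)
  have e\<kappa>: "e * \<kappa> \<le> k2r * \<rho>\<^sup>2 / 2"
  proof -
    have "e * \<kappa> \<le> k2r * \<rho>\<^sup>2 / (2 * \<kappa>) * \<kappa>" using \<kappa> unfolding e_def by (intro mult_right_mono) auto
    then show ?thesis using \<kappa> by simp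
  qed
  define D1 where "D1 = 4 * (1 + b)"
  define D2 where "D2 = 12 * m + 7 * \<rho> + 4 * h3"
  define C where "C = k1r * D1 + k2r * \<rho> * D2"
  have C: "0 \<le> C" using k1r b k2r \<rho> mh by (simp add: C_def D1_def D2_def)
  show ?thesis
  proof (rule that[OF e C])
    fix p q assume near: "near_upright s e p" "near_upright s e q"
    have s1: "\<bar>s\<bar> = 1" "s * s = 1" using s by auto
    have M: "p \<in> state_space" "q \<in> state_space" using near by (auto simp: near_upright_def near_axis_def)
    define Z H N X U where "Z = norm (zl p - zl q)" and "H = norm (gam p - gam q)"
      and "N = norm (nor p - nor q)" and "X = norm (eas p - eas q)" and "U = \<bar>yaw p - yaw q\<bar>"
    have pos: "0 \<le> Z" "0 \<le> H" "0 \<le> N" "0 \<le> X" "0 \<le> U" by (simp_all add: Z_def H_def N_def X_def U_def)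
    note cd = upright_coords_difference[OF s e(2) near]
      upright_coords_difference(5)[OF s e(2) near(2,1)]
    have NX: "N \<le> 2 * U + 2 * H" "X \<le> 2 * U + 3 * H" using cd by (simp_all add: N_def X_def U_def H_def)
    have mult_e: "e * y \<le> y" if "0 \<le> y" for y using mult_right_mono[OF e(2) that] that by simp
    have eN: "e * N \<le> 2 * (e * U) + 2 * H"
      using mult_left_mono[OF NX(1), of e] mult_e[OF pos(2)] e by (simp add: algebra_simps)
    have eX: "e * X \<le> 2 * (e * U) + 3 * H"
      using mult_left_mono[OF NX(2), of e] mult_e[OF pos(2)] e by (simp add: algebra_simps)

    define T1 where "T1 = (fst p \<bullet> nor p) * (gam p \<bullet> east) - (fst q \<bullet> nor q) * (gam q \<bullet> east)"
    define T2 where "T2 = (eas p \<bullet> mI) * (eas p \<bullet> east) - (eas q \<bullet> mI) * (eas q \<bullet> east)"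

    have v: "norm (fst p') \<le> 1 + b" if p': "near_upright s e p'" for p'
    proof -
      have "fst p' = (zl p' - b *\<^sub>R e3) - b *\<^sub>R (gam p' - e3)" by (simp add: zl_def algebra_simps)
      also have "norm \<dots> \<le> e + b * e"
        by (rule order.trans[OF norm_triangle_ineq4 add_mono])
          (use p' b in \<open>auto simp: near_upright_def near_axis_def\<close>)
      also have "\<dots> \<le> 1 + b" using e b by (intro add_mono mult_left_le) auto
      finally show ?thesis .
    qed
    have g_east: "\<bar>gam p' \<bullet> east\<bar> \<le> e" if p': "near_upright s e p'" for p'
    proof -
      have "gam p' \<bullet> east = (gam p' - e3) \<bullet> east" by (simp add: inner_diff_left frame)
      also have "\<bar>\<dots>\<bar> \<le> e * 1"
        using p' frame_norm unfolding near_upright_def near_axis_def by (intro abs_inner_le) auto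
      finally show ?thesis by simp
    qed
    have T1: "\<bar>T1\<bar> \<le> 2 * (1 + b) * (e * U) + D1 * (Z + H)"
    proof -
      have T1_eq: "T1 = ((fst p - fst q) \<bullet> nor p + fst q \<bullet> (nor p - nor q)) * (gam p \<bullet> east)
          + (fst q \<bullet> nor q) * ((gam p - gam q) \<bullet> east)"
        by (simp add: T1_def inner_diff_left inner_diff_right algebra_simps)
      have b1: "\<bar>((fst p - fst q) \<bullet> nor p + fst q \<bullet> (nor p - nor q)) * (gam p \<bullet> east)\<bar>
          \<le> ((Z + b * H) * 1 + (1 + b) * N) * e"
        unfolding abs_mult
      proof (intro mult_mono g_east near)
        have "fst p - fst q = (zl p - zl q) - b *\<^sub>R (gam p - gam q)" by (simp add: zl_def algebra_simps)
        also have "norm \<dots> \<le> Z + b * H"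
          by (rule order.trans[OF norm_triangle_ineq4 add_mono]) (use b in \<open>auto simp: Z_def H_def\<close>)
        finally have "\<bar>(fst p - fst q) \<bullet> nor p\<bar> \<le> (Z + b * H) * 1"
          using coords_norm[OF M(1)] by (intro abs_inner_le) auto
        moreover have "\<bar>fst q \<bullet> (nor p - nor q)\<bar> \<le> (1 + b) * N"
          using v[OF near(2)] unfolding N_def by (intro abs_inner_le) auto
        ultimately show "\<bar>(fst p - fst q) \<bullet> nor p + fst q \<bullet> (nor p - nor q)\<bar> \<le> (Z + b * H) * 1 + (1 + b) * N"
          by (rule order.trans[OF abs_triangle_ineq add_mono])
      qed (use b pos in auto)
      have b2: "\<bar>(fst q \<bullet> nor q) * ((gam p - gam q) \<bullet> east)\<bar> \<le> ((1 + b) * 1) * (H * 1)"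
        unfolding abs_mult H_def
        using v[OF near(2)] coords_norm[OF M(2)] frame_norm b by (intro mult_mono abs_inner_le) auto
      have "\<bar>T1\<bar> \<le> ((Z + b * H) * 1 + (1 + b) * N) * e + ((1 + b) * 1) * (H * 1)"
        unfolding T1_eq by (rule order.trans[OF abs_triangle_ineq add_mono[OF b1 b2]])
      also have "\<dots> = e * Z + b * (e * H) + (1 + b) * (e * N) + (1 + b) * H" by (simp add: algebra_simps)
      also have "\<dots> \<le> Z + b * H + (1 + b) * (2 * (e * U) + 2 * H) + (1 + b) * H"
        using b pos by (intro add_mono mult_left_mono mult_e eN) auto
      also have "\<dots> = 2 * (1 + b) * (e * U) + D1 * (Z + H) - H - (3 + 4 * b) * Z"
        by (simp add: D1_def algebra_simps)
      also have "\<dots> \<le> 2 * (1 + b) * (e * U) + D1 * (Z + H)"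
        using pos mult_nonneg_nonneg[of "3 + 4 * b" Z] b by linarith
      finally show ?thesis .
    qed
    have T2: "\<bar>T2 + s * \<rho> * (yaw p - yaw q)\<bar> \<le> c2 * (e * U) + D2 * H"
    proof -
      define \<xi> where "\<xi> = eas p - eas q"
      have XX: "X = norm \<xi>" by (simp add: X_def \<xi>_def)
      have ea: "\<bar>eas p \<bullet> east - s\<bar> \<le> 2 * e"
      proof -
        have "eas p \<bullet> east - s = (eas p - s *\<^sub>R east) \<bullet> east" by (simp add: inner_diff_left frame)
        also have "\<bar>\<dots>\<bar> \<le> (2 * e) * 1" using cd(5) frame_norm by (intro abs_inner_le) auto
        finally show ?thesis by simp
      qed
      have em: "\<bar>eas q \<bullet> mI\<bar> \<le> 2 * e * m"
      proof -
        have "east \<bullet> mI = 0" by (subst mI_eq) (simp add: inner_add_right frame)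
        then have "eas q \<bullet> mI = (eas q - s *\<^sub>R east) \<bullet> mI" by (simp add: inner_diff_left)
        also have "\<bar>\<dots>\<bar> \<le> (2 * e) * m" using cd(6) unfolding m_def by (intro abs_inner_le) auto
        finally show ?thesis by simp
      qed
      have "\<xi> \<bullet> mI = \<rho> * (\<xi> \<bullet> north) + (mI \<bullet> e3) * (\<xi> \<bullet> e3)"
        by (subst mI_eq) (simp add: inner_add_right)
      then have "s * (\<xi> \<bullet> mI) = s * \<rho> * (\<xi> \<bullet> north) + s * (mI \<bullet> e3) * (\<xi> \<bullet> e3)"
        by (simp add: distrib_left mult.assoc)
      moreover have "T2 = (\<xi> \<bullet> mI) * (eas p \<bullet> east) + (eas q \<bullet> mI) * (\<xi> \<bullet> east)"
        by (simp add: T2_def \<xi>_def inner_diff_left algebra_simps)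
      \<comment> \<open>Every summand is of order \<open>e\<close> relative to the differences, up
        to a multiple of \<open>norm (gam p - gam q)\<close> in the last one.\<close>
      ultimately have split: "T2 + s * \<rho> * (yaw p - yaw q) =
          (((\<xi> \<bullet> mI) * (eas p \<bullet> east - s) + (eas q \<bullet> mI) * (\<xi> \<bullet> east))
          + (s * \<rho>) * (\<xi> \<bullet> north + (yaw p - yaw q))) + (s * (mI \<bullet> e3)) * (\<xi> \<bullet> e3)"
        by (simp add: algebra_simps)
      have b1: "\<bar>(\<xi> \<bullet> mI) * (eas p \<bullet> east - s)\<bar> \<le> (X * m) * (2 * e)"
        unfolding abs_mult XX m_def using ea by (intro mult_mono abs_inner_le order.refl) auto
      have b2: "\<bar>(eas q \<bullet> mI) * (\<xi> \<bullet> east)\<bar> \<le> (2 * e * m) * (X * 1)"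
        unfolding abs_mult XX by (rule mult_mono[OF em abs_inner_le]) (use frame_norm e mh in auto)
      have b3: "\<bar>(s * \<rho>) * (\<xi> \<bullet> north + (yaw p - yaw q))\<bar> \<le> \<rho> * (e * X + 2 * e * N)"
        unfolding abs_mult s1 using cd(4) \<rho> by (simp add: \<xi>_def X_def N_def)
      have b4: "\<bar>(s * (mI \<bullet> e3)) * (\<xi> \<bullet> e3)\<bar> \<le> h3 * (e * X + H)"
        unfolding abs_mult s1 h3_def mult_1 using cd(3) unfolding \<xi>_def X_def H_def
        by (intro mult_left_mono) auto
      have "\<bar>T2 + s * \<rho> * (yaw p - yaw q)\<bar> \<le> (((X * m) * (2 * e) + (2 * e * m) * (X * 1))
          + \<rho> * (e * X + 2 * e * N)) + h3 * (e * X + H)"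
        unfolding split
        by (rule order.trans[OF abs_triangle_ineq add_mono[OF order.trans[OF abs_triangle_ineq
              add_mono[OF order.trans[OF abs_triangle_ineq add_mono[OF b1 b2]] b3]] b4]])
      also have "\<dots> = 4 * m * (e * X) + \<rho> * (e * X + 2 * (e * N)) + h3 * (e * X + H)"
        by (simp add: algebra_simps)
      also have "\<dots> \<le> 4 * m * (2 * (e * U) + 3 * H) + \<rho> * ((2 * (e * U) + 3 * H) + 2 * (2 * (e * U) + 2 * H))
          + h3 * ((2 * (e * U) + 3 * H) + H)"
        using mh \<rho> by (intro add_mono mult_left_mono eX eN) auto
      also have "\<dots> = c2 * (e * U) + D2 * H" by (simp add: c2_def D2_def algebra_simps)
      finally show ?thesis .
    qed
    have "yaw (f p) - yaw (f q) + s * (k2r * \<rho>\<^sup>2) * (yaw p - yaw q)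
        = (- k1r) * T1 + (k2r * \<rho>) * (T2 + s * \<rho> * (yaw p - yaw q))"
      by (simp add: yaw_f M T1_def T2_def power2_eq_square algebra_simps)
    also have "\<bar>\<dots>\<bar> \<le> k1r * (2 * (1 + b) * (e * U) + D1 * (Z + H)) + (k2r * \<rho>) * (c2 * (e * U) + D2 * H)"
      by (rule order.trans[OF abs_triangle_ineq add_mono])
        (use T1 T2 k1r k2r \<rho> in \<open>auto simp: abs_mult\<close>)
    also have "\<dots> \<le> k1r * (2 * (1 + b) * (e * U) + D1 * (Z + H)) + (k2r * \<rho>) * (c2 * (e * U) + D2 * (Z + H))"
      using k2r \<rho> mh pos by (intro add_mono mult_left_mono order.refl) (auto simp: D2_def)
    also have "\<dots> = C * (Z + H) + (e * \<kappa>) * U" by (simp add: C_def \<kappa>_def algebra_simps)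
    also have "\<dots> \<le> C * (Z + H) + (k2r * \<rho>\<^sup>2 / 2) * U"
      using e\<kappa> pos by (intro add_mono mult_right_mono order.refl) auto
    finally show "\<bar>(yaw (f p) - yaw (f q)) + s * (k2r * \<rho>\<^sup>2) * (yaw p - yaw q)\<bar>
      \<le> C * (norm (zl p - zl q) + norm (gam p - gam q)) + (k2r * \<rho>\<^sup>2 / 2) * \<bar>yaw p - yaw q\<bar>"
      by (simp only: Z_def H_def U_def)
  qed
qed

text \<open>The yaw difference is forced by the reduced variables, but not conversely. A large
  weight \<open>K\<close> on the reduced form therefore absorbs the cross term whatever the size of
  \<open>C\<close>. For \<open>s = -1\<close> the yaw term enters with a minus sign, and the
  decreasing form is indefinite.\<close>

lemma upright_difference:
  assumes s: "s = 1 \<or> s = -1"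
  obtains e r K where "0 < e" "e \<le> 1/4" "0 < r" "0 < K"
    "\<And>p q. near_upright s e p \<Longrightarrow> near_upright s e q \<Longrightarrow>
      K * ((zl p - zl q) \<bullet> (zl (f p) - zl (f q)) + \<mu> * ((gam p - gam q) \<bullet> (gam (f p) - gam (f q))))
        + s * ((yaw p - yaw q) * (yaw (f p) - yaw (f q)))
      \<le> - r * ((norm (zl p - zl q))\<^sup>2 + (norm (gam p - gam q))\<^sup>2 + (yaw p - yaw q)\<^sup>2)"
proof -
  define lam where "lam = k2r * \<rho>\<^sup>2"
  have lam: "0 < lam" using k2r \<rho> by (simp add: lam_def)
  obtain e1 where e1: "0 < e1" "\<And>p q. near_axis 1 e1 p \<Longrightarrow> near_axis 1 e1 q \<Longrightarrow>
      (zl p - zl q) \<bullet> (zl (f p) - zl (f q)) + 1 * (\<mu> * ((gam p - gam q) \<bullet> (gam (f p) - gam (f q))))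
      \<le> - (k1v / 4) * ((norm (zl p - zl q))\<^sup>2 + b\<^sup>2 * (norm (gam p - gam q))\<^sup>2)"
    using axis_difference[of 1] by auto
  obtain e2 C where e2: "0 < e2" "e2 \<le> 1/4" "0 \<le> C"
    "\<And>p q. near_upright s e2 p \<Longrightarrow> near_upright s e2 q \<Longrightarrow>
      \<bar>(yaw (f p) - yaw (f q)) + s * (k2r * \<rho>\<^sup>2) * (yaw p - yaw q)\<bar>
      \<le> C * (norm (zl p - zl q) + norm (gam p - gam q)) + (k2r * \<rho>\<^sup>2 / 2) * \<bar>yaw p - yaw q\<bar>"
    using yaw_difference[OF s] by blast
  \<comment> \<open>\<open>2 * C\<^sup>2 / lam\<close> is what Young's inequality takes from the
    reduced variables; the summand 1 is what remains of their decay. \<open>K\<close> rescales the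
    decay rate of \<open>axis_difference\<close> to \<open>L\<close>.\<close>
  define L where "L = 2 * C\<^sup>2 / lam + 1"
  have L: "1 \<le> L" using lam by (simp add: L_def)
  define bb where "bb = min 1 (b\<^sup>2)"
  have bb: "0 < bb" "bb \<le> 1" "bb \<le> b\<^sup>2" using b by (auto simp: bb_def)
  define K where "K = L * (4 / (k1v * bb))"
  have K: "0 < K" using L k1v bb by (simp add: K_def)
  define r where "r = min (lam / 4) 1"
  have r: "0 < r" "r \<le> lam / 4" "r \<le> 1" using lam by (auto simp: r_def)
  show ?thesis
  proof (rule that[of "min e1 e2" r K])
    fix p q assume near: "near_upright s (min e1 e2) p" "near_upright s (min e1 e2) q"
    define z h u where "z = norm (zl p - zl q)" and "h = norm (gam p - gam q)" and "u = yaw p - yaw q"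
    define w where "w = yaw (f p) - yaw (f q)"
    have pos: "0 \<le> z" "0 \<le> h" by (simp_all add: z_def h_def)
    have near': "near_axis 1 e1 p" "near_axis 1 e1 q" "near_upright s e2 p" "near_upright s e2 q"
      using near by (simp_all add: near_upright_def near_axis_def)
    have A: "(zl p - zl q) \<bullet> (zl (f p) - zl (f q)) + \<mu> * ((gam p - gam q) \<bullet> (gam (f p) - gam (f q)))
        \<le> - (k1v / 4) * (z\<^sup>2 + b\<^sup>2 * h\<^sup>2)"
      using e1(2)[OF near'(1,2)] by (simp only: z_def h_def mult_1)
    have B: "\<bar>w + s * lam * u\<bar> \<le> C * (z + h) + (lam / 2) * \<bar>u\<bar>"
      using e2(4)[OF near'(3,4)] by (simp only: z_def h_def u_def w_def lam_def)
    have "- (k1v / 4) * (z\<^sup>2 + b\<^sup>2 * h\<^sup>2) \<le> - (k1v / 4) * (bb * z\<^sup>2 + bb * h\<^sup>2)"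
      using bb k1v mult_right_mono[of bb 1 "z\<^sup>2"] mult_right_mono[of bb "b\<^sup>2" "h\<^sup>2"]
      by (intro mult_left_mono_neg add_mono) auto
    also have "\<dots> = - (k1v * bb / 4) * (z\<^sup>2 + h\<^sup>2)" by (simp add: algebra_simps)
    finally have "K * ((zl p - zl q) \<bullet> (zl (f p) - zl (f q)) + \<mu> * ((gam p - gam q) \<bullet> (gam (f p) - gam (f q))))
        \<le> K * (- (k1v * bb / 4) * (z\<^sup>2 + h\<^sup>2))"
      using A K by (intro mult_left_mono) auto
    also have "\<dots> = - L * (z\<^sup>2 + h\<^sup>2)" using k1v bb by (simp add: K_def)
    finally have part1: "K * ((zl p - zl q) \<bullet> (zl (f p) - zl (f q)) + \<mu> * ((gam p - gam q) \<bullet> (gam (f p) - gam (f q))))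
        \<le> - L * (z\<^sup>2 + h\<^sup>2)" .
    have "s * (u * w) = - lam * u\<^sup>2 + (s * u) * (w + s * lam * u)"
      using s by (auto simp: power2_eq_square algebra_simps)
    moreover have "(s * u) * (w + s * lam * u) \<le> \<bar>u\<bar> * (C * (z + h) + (lam / 2) * \<bar>u\<bar>)"
    proof -
      have "\<bar>(s * u) * (w + s * lam * u)\<bar> \<le> \<bar>u\<bar> * (C * (z + h) + (lam / 2) * \<bar>u\<bar>)"
        unfolding abs_mult using s B by (intro mult_mono) auto
      then show ?thesis by linarith
    qed
    moreover have "\<bar>u\<bar> * (C * (z + h) + (lam / 2) * \<bar>u\<bar>) = C * \<bar>u\<bar> * (z + h) + (lam / 2) * u\<^sup>2"
      by (simp add: power2_eq_square algebra_simps flip: abs_mult)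
    \<comment> \<open>The square is weighted to use \<open>lam / 4\<close> of the yaw rate;
      \<open>lam / 2\<close> has gone into the error term, and \<open>lam / 4\<close> is
      left.\<close>
    moreover have "C * \<bar>u\<bar> * (z + h) \<le> (lam / 4) * u\<^sup>2 + (2 * C\<^sup>2 / lam) * (z\<^sup>2 + h\<^sup>2)"
    proof -
      have "0 \<le> (lam / 2 * \<bar>u\<bar> - C * (z + h))\<^sup>2 / lam" using lam by simp
      also have "\<dots> = (lam / 4) * u\<^sup>2 - C * \<bar>u\<bar> * (z + h) + (C\<^sup>2 / lam) * (z + h)\<^sup>2"
        using lam by (simp add: power2_diff power_mult_distrib field_simps) (simp add: power2_eq_square field_simps)
      finally have 1: "C * \<bar>u\<bar> * (z + h) \<le> (lam / 4) * u\<^sup>2 + (C\<^sup>2 / lam) * (z + h)\<^sup>2" by simp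
      have "(z + h)\<^sup>2 \<le> 2 * (z\<^sup>2 + h\<^sup>2)"
        using sum_squares_bound[of z h] by (simp add: power2_sum)
      then have "(C\<^sup>2 / lam) * (z + h)\<^sup>2 \<le> (C\<^sup>2 / lam) * (2 * (z\<^sup>2 + h\<^sup>2))"
        using lam by (intro mult_left_mono) auto
      also have "\<dots> = (2 * C\<^sup>2 / lam) * (z\<^sup>2 + h\<^sup>2)" by simp
      finally show ?thesis using 1 by linarith
    qed
    ultimately have part2: "s * (u * w) \<le> - (lam / 4) * u\<^sup>2 + (2 * C\<^sup>2 / lam) * (z\<^sup>2 + h\<^sup>2)" by simp
    have "- L * (z\<^sup>2 + h\<^sup>2) + (- (lam / 4) * u\<^sup>2 + (2 * C\<^sup>2 / lam) * (z\<^sup>2 + h\<^sup>2)) = - 1 * (z\<^sup>2 + h\<^sup>2) - (lam / 4) * u\<^sup>2"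
      by (simp add: L_def algebra_simps)
    also have "\<dots> \<le> - r * (z\<^sup>2 + h\<^sup>2) - r * u\<^sup>2"
      using r by (intro diff_mono mult_right_mono) auto
    also have "\<dots> = - r * (z\<^sup>2 + h\<^sup>2 + u\<^sup>2)" by (simp add: algebra_simps)
    finally show "K * ((zl p - zl q) \<bullet> (zl (f p) - zl (f q)) + \<mu> * ((gam p - gam q) \<bullet> (gam (f p) - gam (f q))))
        + s * ((yaw p - yaw q) * (yaw (f p) - yaw (f q)))
      \<le> - r * ((norm (zl p - zl q))\<^sup>2 + (norm (gam p - gam q))\<^sup>2 + (yaw p - yaw q)\<^sup>2)"
      using part1 part2 unfolding z_def[symmetric] h_def[symmetric] u_def[symmetric] w_def[symmetric] by linarith
  qed (use e1 e2 r K in auto)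
qed

text \<open>A matrix is determined by the images of the frame, so the coordinates form an injective
  linear map, which is bounded below in finite dimension.\<close>

lemma state_norm_le:
  obtains B where "0 < B" "\<And>p. norm p \<le> B * (norm (zl p) + norm (gam p) + norm (nor p) + norm (eas p))"
proof -
  define J where "J p = ((zl p, gam p), (nor p, eas p))" for p
  have J: "linear J"
    unfolding J_def by (intro bounded_linear.linear bounded_linear_Pair bounded_linear_coords)
  have "inj J"
    unfolding linear_injective_0[OF J]
  proof (intro allI impI)
    fix p assume "J p = 0"
    then have z: "zl p = 0" "gam p = 0" "nor p = 0" "eas p = 0" by (simp_all add: J_def zero_prod_def)
    have "snd p *v x = 0" for x
      using z unfolding gam_def nor_def eas_def
      by (subst frame_expansion[of x]) (simp add: matrix_vector_right_distrib matrix_vector_mult_scaleR)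
    then have "snd p = 0" by (intro matrix_eq3) simp
    moreover have "fst p = 0" using z by (simp add: zl_def)
    ultimately show "p = 0" by (simp add: prod_eq_iff)
  qed
  then obtain B where B: "0 < B" "\<And>p. B * norm p \<le> norm (J p)"
    using linear_inj_bounded_below_pos[OF J] by blast
  have "norm p \<le> (1 / B) * (norm (zl p) + norm (gam p) + norm (nor p) + norm (eas p))" for p
  proof -
    have "norm (J p) \<le> (norm (zl p) + norm (gam p)) + (norm (nor p) + norm (eas p))"
      unfolding J_def by (rule order.trans[OF norm_Pair_le add_mono[OF norm_Pair_le norm_Pair_le]])
    then have "B * norm p \<le> norm (zl p) + norm (gam p) + norm (nor p) + norm (eas p)"
      using B(2)[of p] by simp
    then show ?thesis using B(1) by (simp add: pos_le_divide_eq mult.commute)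
  qed
  then show ?thesis using that[of "1 / B"] B(1) by simp
qed


section \<open>The equilibria\<close>

text \<open>Takes \<open>north\<close>, \<open>east\<close>, \<open>e3\<close> to \<open>n\<close>,
  \<open>\<gamma> \<times> n\<close>, \<open>\<gamma>\<close>. It produces rotations with prescribed
  \<open>nor\<close> and \<open>gam\<close>, both for the equilibria and for states near
  them.\<close>

definition frame_matrix :: "real^3 \<Rightarrow> real^3 \<Rightarrow> real^3^3" where
  "frame_matrix n \<gamma> = matrix (\<lambda>x. (x \<bullet> north) *\<^sub>R n + (x \<bullet> east) *\<^sub>R (\<gamma> \<times> n) + (x \<bullet> e3) *\<^sub>R \<gamma>)"

lemma frame_matrix_mult:
  "frame_matrix n \<gamma> *v x = (x \<bullet> north) *\<^sub>R n + (x \<bullet> east) *\<^sub>R (\<gamma> \<times> n) + (x \<bullet> e3) *\<^sub>R \<gamma>"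
proof -
  have "linear (\<lambda>x. (x \<bullet> north) *\<^sub>R n + (x \<bullet> east) *\<^sub>R (\<gamma> \<times> n) + (x \<bullet> e3) *\<^sub>R \<gamma>)"
    by (rule linearI) (simp_all add: inner_add_left algebra_simps)
  then show ?thesis unfolding frame_matrix_def by (simp add: matrix_works)
qed

lemma frame_matrix_frame:
  "frame_matrix n \<gamma> *v north = n" "frame_matrix n \<gamma> *v east = \<gamma> \<times> n" "frame_matrix n \<gamma> *v e3 = \<gamma>"
  by (simp_all add: frame_matrix_mult frame inner_e3)

lemma frame_matrix_SO3:
  assumes "n \<bullet> n = 1" "\<gamma> \<bullet> \<gamma> = 1" "\<gamma> \<bullet> n = 0"
  shows "frame_matrix n \<gamma> \<in> SO3"
proof -
  define A where "A = frame_matrix n \<gamma>"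
  have ee: "(\<gamma> \<times> n) \<bullet> (\<gamma> \<times> n) = 1" by (simp add: dot_cross assms inner_commute)
  have "(A *v x) \<bullet> (A *v y) = x \<bullet> y" for x y
  proof -
    have "(A *v x) \<bullet> (A *v y) = (x \<bullet> north) * (y \<bullet> north) + (x \<bullet> east) * (y \<bullet> east) + (x \<bullet> e3) * (y \<bullet> e3)"
      using assms ee
      by (simp add: A_def frame_matrix_mult inner_add_left inner_add_right dot_cross_self inner_commute)
    also have "\<dots> = x \<bullet> y"
      by (subst (4) frame_expansion[of y]) (simp add: inner_add_right mult.commute)
    finally show ?thesis .
  qed
  then have "orthogonal_transformation ((*v) A)"
    by (simp add: orthogonal_transformation_def)
  then have orth: "orthogonal_matrix A"
    by (metis orthogonal_transformation_matrix matrix_of_matrix_vector_mul)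
  \<comment> \<open>Orthogonal matrices respect the cross product up to the determinant; the image
    of \<open>east\<close> is defined as a cross product, which forces determinant 1.\<close>
  have "(A *v e3) \<times> (A *v north) = det A *\<^sub>R (A *v (e3 \<times> north))"
    by (rule cross_orthogonal_matrix[OF orth])
  then have "\<gamma> \<times> n = det A *\<^sub>R (\<gamma> \<times> n)"
    by (simp add: A_def frame_matrix_frame frame)
  then have "1 = det A"
    using ee by (metis inner_scaleR_left mult.right_neutral)
  then show ?thesis
    using orth by (simp add: SO3_def rotation_matrix_def A_def)
qed

text \<open>The velocity is the one for which \<open>zl\<close> has its equilibrium value
  \<open>b *\<^sub>R e3\<close>, so that only the attitude can be displaced.\<close>

definition frame_state :: "real^3 \<Rightarrow> real^3 \<Rightarrow> state" where
  "frame_state n \<gamma> = (b *\<^sub>R (e3 - \<gamma>), frame_matrix n \<gamma>)"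

lemma frame_state:
  assumes "n \<bullet> n = 1" "\<gamma> \<bullet> \<gamma> = 1" "\<gamma> \<bullet> n = 0"
  shows "frame_state n \<gamma> \<in> state_space" "zl (frame_state n \<gamma>) = b *\<^sub>R e3"
    "gam (frame_state n \<gamma>) = \<gamma>" "nor (frame_state n \<gamma>) = n"
  using frame_matrix_SO3[OF assms]
  by (simp_all add: frame_state_def state_space_def zl_def gam_def nor_def frame_matrix_frame algebra_simps)

lemma eas_diff_le:
  assumes "p \<in> state_space" "q \<in> state_space"
  shows "norm (eas p - eas q) \<le> norm (gam p - gam q) + norm (nor p - nor q)"
proof -
  have "eas p - eas q = (gam p - gam q) \<times> nor p + gam q \<times> (nor p - nor q)"
    by (simp add: coords_inner assms cross.diff_left cross.diff_right)
  also have "norm \<dots> \<le> norm (gam p - gam q) * 1 + 1 * norm (nor p - nor q)"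
    by (rule order.trans[OF norm_triangle_ineq add_mono[OF norm_cross_le norm_cross_le]])
      (simp_all add: coords_norm assms)
  finally show ?thesis by simp
qed

text \<open>On rotations \<open>eas\<close> is the cross product of \<open>gam\<close> and
  \<open>nor\<close>, so its differences are controlled by theirs.\<close>

lemma state_dist_le:
  obtains B where "0 < B" "\<And>p q. p \<in> state_space \<Longrightarrow> q \<in> state_space \<Longrightarrow>
    norm (p - q) \<le> B * (norm (zl p - zl q) + norm (gam p - gam q) + norm (nor p - nor q))"
proof -
  obtain B where B: "0 < B" "\<And>p. norm p \<le> B * (norm (zl p) + norm (gam p) + norm (nor p) + norm (eas p))"
    using state_norm_le by blast
  have "norm (p - q) \<le> (2 * B) * (norm (zl p - zl q) + norm (gam p - gam q) + norm (nor p - nor q))"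
    if "p \<in> state_space" "q \<in> state_space" for p q
  proof -
    have "norm (p - q) \<le> B * (norm (zl p - zl q) + norm (gam p - gam q) + norm (nor p - nor q) + norm (eas p - eas q))"
      using B(2)[of "p - q"] by (simp add: coords_diff)
    also have "\<dots> \<le> B * (2 * (norm (zl p - zl q) + norm (gam p - gam q) + norm (nor p - nor q)))"
    proof (intro mult_left_mono)
      show "norm (zl p - zl q) + norm (gam p - gam q) + norm (nor p - nor q) + norm (eas p - eas q)
          \<le> 2 * (norm (zl p - zl q) + norm (gam p - gam q) + norm (nor p - nor q))"
        using eas_diff_le[OF that] norm_ge_zero[of "zl p - zl q"] unfolding distrib_left by linarith
    qed (use B(1) in simp)
    finally show ?thesis by (simp add: algebra_simps)
  qed
  then show ?thesis using that[of "2 * B"] B(1) by simp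
qed

lemma state_eqI:
  assumes "p \<in> state_space" "q \<in> state_space" "zl p = zl q" "gam p = gam q" "nor p = nor q"
  shows "p = q"
proof -
  obtain B where "norm (p - q) \<le> B * (norm (zl p - zl q) + norm (gam p - gam q) + norm (nor p - nor q))"
    using state_dist_le assms by metis
  then show ?thesis using assms by simp
qed

lemma frame_eq_unit:
  assumes "x \<bullet> x = 1" "x \<bullet> y = 0" "x \<bullet> z = 0"
    and "(y = north \<and> z = e3 \<and> u = east) \<or> (y = north \<and> z = east \<and> u = e3) \<or> (y = east \<and> z = e3 \<and> u = north)"
  shows "x = u \<or> x = - u"
proof -
  define c where "c = x \<bullet> u"
  have x: "x = c *\<^sub>R u"
    using assms(2-4) unfolding c_def by (subst frame_expansion[of x]) auto
  have "u \<bullet> u = 1" using assms(4) by (auto simp: frame inner_e3)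
  then have "c * c = 1" using assms(1) by (simp add: x)
  then have "c = 1 \<or> c = -1" by (metis square_eq_1_iff)
  then show ?thesis using x by auto
qed

text \<open>At an equilibrium \<open>V_decrease\<close> gives \<open>W p \<le> 0\<close>, so both
  nonnegative terms of \<open>W\<close> vanish: \<open>zl\<close> is at rest and \<open>gam\<close>
  at a pole. The magnetic correction vanishes too, and with \<open>gam\<close> vertical this makes
  \<open>eas\<close> orthogonal to \<open>north\<close>.\<close>

lemma equilibrium_coords:
  assumes p: "p \<in> state_space"
  shows "f p = 0 \<longleftrightarrow> zl p = b *\<^sub>R e3 \<and> (gam p = e3 \<or> gam p = - e3) \<and> (nor p = north \<or> nor p = - north)"
proof
  assume 0: "f p = 0"
  have "W p \<le> 0" using V_decrease[OF p] by (simp add: 0 coords_zero)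
  moreover have c: "(gam p \<bullet> e3)\<^sup>2 \<le> 1"
    using Cauchy_Schwarz_ineq[of "gam p" e3] by (simp add: coords_inner[OF p] inner_e3)
  moreover have "W p \<ge> (k1v / 2) * (norm (zl p - b *\<^sub>R e3))\<^sup>2" "W p \<ge> (k1v / 2) * (b\<^sup>2 * (1 - (gam p \<bullet> e3)\<^sup>2))"
    unfolding W_def using k1v c by (simp_all add: mult_left_mono)
  ultimately have "(k1v / 2) * (norm (zl p - b *\<^sub>R e3))\<^sup>2 \<le> 0" "(k1v / 2) * (b\<^sup>2 * (1 - (gam p \<bullet> e3)\<^sup>2)) \<le> 0"
    by linarith+
  then have zl: "zl p = b *\<^sub>R e3" and "(gam p \<bullet> e3)\<^sup>2 = 1"
    using k1v b c by (auto simp: mult_le_0_iff zero_le_mult_iff dest: antisym)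
  define s where "s = gam p \<bullet> e3"
  have s: "s = 1 \<or> s = -1" using \<open>(gam p \<bullet> e3)\<^sup>2 = 1\<close> by (simp add: s_def power2_eq_1_iff)
  have "(gam p - s *\<^sub>R e3) \<bullet> (gam p - s *\<^sub>R e3) = 1 - s * s"
    by (simp add: inner_diff_left inner_diff_right coords_inner[OF p] inner_e3 s_def inner_commute)
  then have "(gam p - s *\<^sub>R e3) \<bullet> (gam p - s *\<^sub>R e3) = 0" using s by auto
  then have gam: "gam p = s *\<^sub>R e3" by (simp only: inner_eq_zero_iff right_minus_eq)
  \<comment> \<open>Pairing with \<open>eas p\<close> isolates the magnetic correction in
    \<open>nor_f\<close>.\<close>
  have "nor (f p) \<bullet> eas p = 0" by (simp add: 0 coords_zero)
  then have "eas p \<bullet> mI = 0"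
    using k2r \<rho> by (simp add: nor_f[OF p] inner_add_left inner_diff_left coords_inner[OF p])
  moreover have e: "eas p \<bullet> e3 = 0" using coords_inner(7)[OF p] s by (auto simp: gam)
  moreover have "eas p \<bullet> mI = \<rho> * (eas p \<bullet> north) + (mI \<bullet> e3) * (eas p \<bullet> e3)"
    by (subst mI_eq) (simp add: inner_add_right)
  ultimately have "eas p \<bullet> north = 0" using \<rho> by simp
  then have "eas p = east \<or> eas p = - east"
    using e coords_inner(3)[OF p] by (intro frame_eq_unit[of _ north e3]) auto
  then have "nor p = north \<or> nor p = - north"
    using s coords_inner(12)[OF p, symmetric] by (auto simp: gam frame)
  then show "zl p = b *\<^sub>R e3 \<and> (gam p = e3 \<or> gam p = - e3) \<and> (nor p = north \<or> nor p = - north)"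
    using zl gam s by auto
next
  assume *: "zl p = b *\<^sub>R e3 \<and> (gam p = e3 \<or> gam p = - e3) \<and> (nor p = north \<or> nor p = - north)"
  then obtain s where s: "s = 1 \<or> s = -1" "gam p = s *\<^sub>R e3" by (metis scaleR_one scaleR_minus1_left)
  have fst: "fst p = (b - b * s) *\<^sub>R e3" using * s(2) by (simp add: zl_def algebra_simps)
  have "eas p \<bullet> mI = 0"
    using * by (subst mI_eq) (auto simp: coords_inner(10)[OF p, symmetric] inner_add_right frame)
  then have "sig p = 0" by (simp add: sig_def fst s(2) cross_mult_left cross_mult_right)
  then have "snd (f p) = 0" by (intro matrix_eq3) (simp add: error_dynamics_rotation[OF p])
  moreover have "hh p = 0" using * s by (auto simp: hh_def inner_e3)
  then have "fst (f p) = 0"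
    unfolding fst_f[OF p] fst s(2) using k1v by (simp add: b_def algebra_simps)
  ultimately show "f p = 0" by (simp add: prod_eq_iff)
qed

lemma equilibria_eq:
  "equilibria f state_space =
    {frame_state north e3, frame_state (- north) e3, frame_state north (- e3), frame_state (- north) (- e3)}"
  (is "_ = ?E")
proof (rule set_eqI)
  fix p
  have fs: "frame_state (s *\<^sub>R north) (t *\<^sub>R e3) \<in> state_space \<and> zl (frame_state (s *\<^sub>R north) (t *\<^sub>R e3)) = b *\<^sub>R e3
      \<and> gam (frame_state (s *\<^sub>R north) (t *\<^sub>R e3)) = t *\<^sub>R e3 \<and> nor (frame_state (s *\<^sub>R north) (t *\<^sub>R e3)) = s *\<^sub>R north"
    if "s * s = 1" "t * t = 1" for s t
    using frame_state[of "s *\<^sub>R north" "t *\<^sub>R e3"] that by (simp add: frame inner_e3)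
  note fs' = fs[of 1 1] fs[of "-1" 1] fs[of 1 "-1"] fs[of "-1" "-1"]
  show "p \<in> equilibria f state_space \<longleftrightarrow> p \<in> ?E"
  proof
    assume "p \<in> equilibria f state_space"
    then have p: "p \<in> state_space" and "f p = 0" by (auto simp: equilibria_def)
    then have "zl p = b *\<^sub>R e3 \<and> (gam p = e3 \<or> gam p = - e3) \<and> (nor p = north \<or> nor p = - north)"
      using equilibrium_coords by blast
    then show "p \<in> ?E" using fs' by (auto intro: state_eqI[OF p])
  next
    assume "p \<in> ?E"
    then have "p \<in> state_space" "zl p = b *\<^sub>R e3 \<and> (gam p = e3 \<or> gam p = - e3) \<and> (nor p = north \<or> nor p = - north)"
      using fs' by auto
    then show "p \<in> equilibria f state_space" using equilibrium_coords by (simp add: equilibria_def)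
  qed
qed

lemma identity_coords:
  "(0, mat 1) \<in> state_space" "zl (0, mat 1) = b *\<^sub>R e3" "gam (0, mat 1) = e3" "nor (0, mat 1) = north"
  "yaw (0, mat 1) = 0"
  by (simp_all add: state_space_def SO3_mat1 zl_def gam_def nor_def yaw_def frame)

lemma identity_eq: "(0, mat 1) = frame_state north e3"
  by (rule state_eqI) (simp_all add: identity_coords frame_state frame inner_e3)

lemma card_equilibria: "card (equilibria f state_space) = 4"
proof -
  have "e3 \<noteq> - e3" "north \<noteq> - north"
    using inner_e3 frame(1) by (metis inner_minus_left one_neq_neg_one)+
  moreover have inj: "frame_state n \<gamma> = frame_state n' \<gamma>' \<Longrightarrow> \<gamma> = \<gamma>' \<and> n = n'" for n n' \<gamma> \<gamma>'
    unfolding frame_state_def by (metis frame_matrix_frame(1,3) snd_conv)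
  ultimately show ?thesis unfolding equilibria_eq by (auto simp: card_insert_if dest!: inj)
qed

lemma equilibria_isolated:
  assumes "p \<in> equilibria f state_space"
  shows "p isolated_in equilibria f state_space"
proof -
  have "finite (equilibria f state_space)" by (simp add: equilibria_eq)
  then show ?thesis using assms by (simp add: isolated_in_islimpt_iff islimpt_finite)
qed

section \<open>Local analysis at the equilibria\<close>

lemma coords_bound:
  obtains K where "0 < K" "\<And>p. norm (zl p) \<le> K * norm p" "\<And>p. norm (gam p) \<le> K * norm p"
    "\<And>p. norm (nor p) \<le> K * norm p"
proof -
  obtain K1 where K1: "\<And>p. norm (zl p) \<le> norm p * K1" "0 < K1"
    using bounded_linear.pos_bounded[OF bounded_linear_coords(4)] by blast
  obtain K2 where K2: "\<And>p. norm (gam p) \<le> norm p * K2" "0 < K2"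
    using bounded_linear.pos_bounded[OF bounded_linear_coords(1)] by blast
  obtain K3 where K3: "\<And>p. norm (nor p) \<le> norm p * K3" "0 < K3"
    using bounded_linear.pos_bounded[OF bounded_linear_coords(2)] by blast
  define K where "K = max K1 (max K2 K3)"
  have "norm p * K1 \<le> K * norm p" "norm p * K2 \<le> K * norm p" "norm p * K3 \<le> K * norm p" for p :: state
    by (subst mult.commute, intro mult_right_mono, simp_all add: K_def)+
  then show ?thesis using that[of K] K1 K2 K3 by (metis K_def less_max_iff_disj order.trans)
qed

lemma near_axisI:
  assumes "0 < e" "zl p = b *\<^sub>R e3" "gam p = s *\<^sub>R e3"
  obtains r where "0 < r" "\<And>y. y \<in> state_space \<Longrightarrow> dist y p < r \<Longrightarrow> near_axis s e y"
    "\<And>y t. y \<in> state_space \<Longrightarrow> dist y p < r \<Longrightarrow> s = 1 \<Longrightarrow> nor p = t *\<^sub>R north \<Longrightarrow> near_upright t e y"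
proof -
  obtain K where K: "0 < K" "\<And>p. norm (zl p) \<le> K * norm p" "\<And>p. norm (gam p) \<le> K * norm p"
    "\<And>p. norm (nor p) \<le> K * norm p" using coords_bound by blast
  have "norm (zl y - zl p) \<le> e \<and> norm (gam y - gam p) \<le> e \<and> norm (nor y - nor p) \<le> e" if "dist y p < e / K" for y
  proof -
    have "K * norm (y - p) \<le> K * (e / K)" using that K(1) by (intro mult_left_mono) (auto simp: dist_norm)
    then have "K * norm (y - p) \<le> e" using K(1) by simp
    then show ?thesis using K(2-4)[of "y - p"] by (auto simp: coords_diff intro: order.trans)
  qed
  note close = this
  show ?thesis
  proof (rule that[of "e / K"])
    show "0 < e / K" using K(1) assms(1) by simp
    fix y t assume y: "y \<in> state_space" "dist y p < e / K"
    show "near_axis s e y" using close[OF y(2)] y(1) assms by (simp add: near_axis_def)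
    show "near_upright t e y" if "s = 1" "nor p = t *\<^sub>R north"
      using close[OF y(2)] y(1) assms that by (simp add: near_upright_def near_axis_def)
  qed
qed

text \<open>The form of \<open>upright_difference\<close> with \<open>s = 1\<close> is definite in
  \<open>zl\<close>, \<open>gam\<close> and yaw, and the second state is taken to be the
  equilibrium. The vector \<open>nor\<close> does not appear in the form; near the identity it is
  controlled through \<open>upright_coords_difference\<close>.\<close>

lemma identity_locally_exponentially_stable: "locally_exponentially_stable f state_space (0, mat 1)"
proof -
  let ?p = "(0, mat 1) :: state"
  obtain e r K where e: "0 < e" "e \<le> 1/4" and r: "0 < r" and K: "0 < K" and
    diff: "\<And>p q. near_upright 1 e p \<Longrightarrow> near_upright 1 e q \<Longrightarrow>
      K * ((zl p - zl q) \<bullet> (zl (f p) - zl (f q)) + \<mu> * ((gam p - gam q) \<bullet> (gam (f p) - gam (f q))))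
        + 1 * ((yaw p - yaw q) * (yaw (f p) - yaw (f q)))
      \<le> - r * ((norm (zl p - zl q))\<^sup>2 + (norm (gam p - gam q))\<^sup>2 + (yaw p - yaw q)\<^sup>2)"
    using upright_difference[of 1] by blast
  have f0: "f ?p = 0" using equilibrium_coords[OF identity_coords(1)] by (simp add: identity_coords)
  have near_p: "near_upright 1 e ?p"
    using e by (simp add: near_upright_def near_axis_def identity_coords)
  obtain \<delta> where \<delta>: "0 < \<delta>" "\<And>y. y \<in> state_space \<Longrightarrow> dist y ?p < \<delta> \<Longrightarrow> near_upright 1 e y"
    using near_axisI[OF e(1) identity_coords(2), of 1] identity_coords(3,4) by (metis scaleR_one)
  obtain B where B: "0 < B" "\<And>p q. p \<in> state_space \<Longrightarrow> q \<in> state_space \<Longrightarrow>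
      norm (p - q) \<le> B * (norm (zl p - zl q) + norm (gam p - gam q) + norm (nor p - nor q))"
    using state_dist_le by blast
  \<comment> \<open>The square roots make \<open>(norm (S p))\<^sup>2\<close> the weighted form, as
    the stability criterion expects.\<close>
  define S where "S p = (sqrt K *\<^sub>R zl p, (sqrt (K * \<mu>) *\<^sub>R gam p, yaw p))" for p
  have S: "bounded_linear S" unfolding S_def
    by (intro bounded_linear_Pair bounded_linear_coords bounded_linear_const_scaleR)
  have S_inner: "S p \<bullet> S q = K * (zl p \<bullet> zl q + \<mu> * (gam p \<bullet> gam q)) + yaw p * yaw q" for p q
    using K \<mu> by (simp add: S_def algebra_simps flip: real_sqrt_mult)
  \<comment> \<open>An upper bound of the three weights 1, \<open>K\<close> and
    \<open>K * \<mu>\<close>, to pass from plain squares to weighted ones.\<close>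
  define c where "c = 1 + K + K * \<mu>"
  have c: "0 < c" "1 \<le> c" "K \<le> c" "K * \<mu> \<le> c" using K \<mu> by (simp_all add: c_def add_pos_nonneg)
  define B' where "B' = B * (1 / sqrt K + 3 / sqrt (K * \<mu>) + 2)"
  show ?thesis
  proof (rule locally_exponentially_stableI[OF S \<delta>(1), of "r / c" B'])
    fix y assume y: "y \<in> state_space" "dist y ?p < \<delta>"
    define z h u where "z = norm (zl y - zl ?p)" and "h = norm (gam y - gam ?p)" and "u = yaw y - yaw ?p"
    have SS: "(norm (S (y - ?p)))\<^sup>2 = K * z\<^sup>2 + K * \<mu> * h\<^sup>2 + u\<^sup>2"
      unfolding z_def h_def u_def power2_norm_eq_inner S_inner coords_diff
      by (simp add: algebra_simps power2_eq_square)
    have "S (y - ?p) \<bullet> S (f y) \<le> - r * (z\<^sup>2 + h\<^sup>2 + u\<^sup>2)"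
      using diff[OF \<delta>(2)[OF y] near_p]
      by (simp add: S_inner coords_diff f0 coords_zero z_def h_def u_def)
    also have "\<dots> = - (r / c) * (c * z\<^sup>2 + c * h\<^sup>2 + c * u\<^sup>2)" using c by (simp add: algebra_simps)
    also have "\<dots> \<le> - (r / c) * (K * z\<^sup>2 + K * \<mu> * h\<^sup>2 + u\<^sup>2)"
      using r c mult_right_mono[OF c(2), of "u\<^sup>2"]
      by (intro mult_left_mono_neg add_mono mult_right_mono) auto
    finally show "S (y - ?p) \<bullet> S (f y) \<le> - (r / c) * (norm (S (y - ?p)))\<^sup>2" by (simp only: SS)
    have nS: "z \<le> (1 / sqrt K) * norm (S (y - ?p))" "h \<le> (1 / sqrt (K * \<mu>)) * norm (S (y - ?p))"
      "\<bar>u\<bar> \<le> norm (S (y - ?p))"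
    proof -
      have n: "norm a \<le> norm (a, q)" "norm q \<le> norm (a, q)" for a :: "real^3" and q :: "(real^3) \<times> real"
        using norm_fst_le[of a q] norm_snd_le[of q a] by simp_all
      have n': "norm a \<le> norm (a, q)" "norm q \<le> norm (a, q)" for a :: "real^3" and q :: real
        using norm_fst_le[of a q] norm_snd_le[of q a] by simp_all
      have "sqrt K * z \<le> norm (S (y - ?p))"
        using n(1)[of "sqrt K *\<^sub>R zl (y - ?p)"] K by (simp add: S_def z_def coords_diff)
      then show "z \<le> (1 / sqrt K) * norm (S (y - ?p))" using K by (simp add: field_simps)
      have "sqrt (K * \<mu>) * h \<le> norm (S (y - ?p))"
        using order.trans[OF n'(1)[of "sqrt (K * \<mu>) *\<^sub>R gam (y - ?p)"] n(2)] K \<mu>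
        by (simp add: S_def h_def coords_diff)
      then show "h \<le> (1 / sqrt (K * \<mu>)) * norm (S (y - ?p))" using K \<mu> by (simp add: field_simps)
      show "\<bar>u\<bar> \<le> norm (S (y - ?p))"
        using order.trans[OF n'(2)[of "yaw (y - ?p)"] n(2)] by (simp add: S_def u_def coords_diff)
    qed
    have "norm (y - ?p) \<le> B * (z + h + norm (nor y - nor ?p))"
      using B(2)[OF y(1) identity_coords(1)] by (simp add: z_def h_def)
    also have "\<dots> \<le> B * (z + h + (2 * \<bar>u\<bar> + 2 * h))"
      using B(1) upright_coords_difference(1)[OF _ e(2) \<delta>(2)[OF y] near_p]
      by (intro mult_left_mono add_left_mono) (auto simp: u_def h_def)
    also have "\<dots> = B * (z + 3 * h + 2 * \<bar>u\<bar>)" by simp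
    also have "\<dots> \<le> B * ((1 / sqrt K) * norm (S (y - ?p)) + 3 * ((1 / sqrt (K * \<mu>)) * norm (S (y - ?p))) + 2 * norm (S (y - ?p)))"
      using B(1) nS by (intro mult_left_mono add_mono) auto
    also have "\<dots> = B' * norm (S (y - ?p))" by (simp add: B'_def algebra_simps)
    finally show "norm (y - ?p) \<le> B' * norm (S (y - ?p))" .
  qed (use r c B K \<mu> in \<open>auto simp: B'_def intro!: mult_pos_pos add_nonneg_pos\<close>)
qed

end

section \<open>Solutions of the error dynamics\<close>

lemma bounded_lipschitz_linear_comp:
  fixes F :: "'a::real_normed_vector \<Rightarrow> 'b::real_normed_vector" and h :: "'c::metric_space \<Rightarrow> 'a"
  assumes "bounded_linear F" "bounded_lipschitz h"
  shows "bounded_lipschitz (\<lambda>x. F (h x))"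
  unfolding bounded_lipschitz_def
proof (intro allI impI)
  fix S :: "'c set"
  assume "bounded S"
  then obtain L where "L-lipschitz_on S h" using assms(2) unfolding bounded_lipschitz_def by blast
  moreover obtain M where "M-lipschitz_on (h ` S) F"
    using bounded_linear.lipschitz_boundE[OF assms(1)] by metis
  ultimately show "\<exists>L. L-lipschitz_on S (\<lambda>x. F (h x))"
    using lipschitz_on_compose2 by blast
qed

context error_system
begin

text \<open>The field is polynomial in the state, that is, composed of linear and bilinear
  maps.\<close>

lemma error_dynamics_bounded_lipschitz: "bounded_lipschitz f"
proof -
  have eq: "f = (\<lambda>p. (g *\<^sub>R ((mat 1 - snd p) *v e3)
      - (k1v *\<^sub>R fst p - k2v *\<^sub>R ((snd p *v e3) \<times> ((snd p *v e3) \<times> fst p))),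
      (- skew (k1r *\<^sub>R (fst p \<times> (snd p *v e3))
        + (k2r * ((mI \<times> (snd p *v mI)) \<bullet> (snd p *v e3))) *\<^sub>R (snd p *v e3))) ** snd p))"
    by (simp add: fun_eq_iff error_dynamics_def sigma_v_def sigma_R_def)
  show ?thesis
    unfolding eq
    by (intro bounded_lipschitz_Pair bounded_lipschitz_diff bounded_lipschitz_add bounded_lipschitz_minus
        bounded_lipschitz_linear_comp[OF bounded_linear_skew]
        bounded_lipschitz_bilinear[OF bounded_bilinear_matrix_mult]
        bounded_lipschitz_bilinear[OF bounded_bilinear_matrix_vector_mult]
        bounded_lipschitz_bilinear[OF bounded_bilinear_cross]
        bounded_lipschitz_bilinear[OF bounded_bilinear_inner]
        bounded_lipschitz_bilinear[OF bounded_bilinear_mult]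
        bounded_lipschitz_bilinear[OF bounded_bilinear_scaleR]
        bounded_lipschitz_const bounded_lipschitz_linear[OF bounded_linear_fst]
        bounded_lipschitz_linear[OF bounded_linear_snd])
qed

text \<open>The factor \<open>c\<close> covers the cut-off equation; actual solutions have
  \<open>c = 1\<close>.\<close>

lemma V_derivative:
  assumes "(x has_vector_derivative c *\<^sub>R f (x t)) (at t within J)"
  shows "((\<lambda>t. V (x t)) has_real_derivative
    c * ((zl (x t) - b *\<^sub>R e3) \<bullet> zl (f (x t)) - \<mu> * (gam (f (x t)) \<bullet> e3))) (at t within J)"
proof -
  have z: "((\<lambda>t. zl (x t) - b *\<^sub>R e3) has_vector_derivative c *\<^sub>R zl (f (x t))) (at t within J)"
    using bounded_linear.has_vector_derivative[OF bounded_linear_coords(4) assms]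
    by (auto intro!: derivative_eq_intros simp: coords_scale)
  have "((\<lambda>t. gam (x t) \<bullet> e3) has_vector_derivative c * (gam (f (x t)) \<bullet> e3)) (at t within J)"
    using bounded_linear.has_vector_derivative[OF bounded_linear_compose[OF bounded_linear_inner_left bounded_linear_coords(1)] assms, of e3]
    by (simp add: coords_scale)
  then have g: "((\<lambda>t. gam (x t) \<bullet> e3) has_real_derivative c * (gam (f (x t)) \<bullet> e3)) (at t within J)"
    by (simp add: has_real_derivative_iff_has_vector_derivative)
  have "((\<lambda>t. \<mu> * (1 - gam (x t) \<bullet> e3)) has_real_derivative \<mu> * (0 - c * (gam (f (x t)) \<bullet> e3))) (at t within J)"
    by (intro DERIV_cmult DERIV_diff DERIV_const g)
  from DERIV_add[OF DERIV_cdivide[OF inner_self_derivative[OF bounded_linear_ident z], of 2] this]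
  show ?thesis
    unfolding V_def power2_norm_eq_inner by (rule DERIV_cong) (simp add: right_diff_distrib)
qed

lemma V_bounds:
  assumes "p \<in> state_space"
  shows "0 \<le> V p" "(norm (zl p - b *\<^sub>R e3))\<^sup>2 \<le> 2 * V p" "\<mu> * (1 - gam p \<bullet> e3) \<le> V p"
    "\<bar>gam p \<bullet> e3\<bar> \<le> 1"
proof -
  show c: "\<bar>gam p \<bullet> e3\<bar> \<le> 1"
    using Cauchy_Schwarz_ineq2[of "gam p" e3] by (simp add: coords_norm[OF assms] frame_norm)
  then have "0 \<le> \<mu> * (1 - gam p \<bullet> e3)" using \<mu> by (simp add: abs_le_iff)
  then show "0 \<le> V p" "(norm (zl p - b *\<^sub>R e3))\<^sup>2 \<le> 2 * V p" "\<mu> * (1 - gam p \<bullet> e3) \<le> V p"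
    by (simp_all add: V_def)
qed

text \<open>The frame vectors have unit length and \<open>V\<close> bounds \<open>zl\<close>. The
  bound serves as the radius up to which the cut-off is inactive.\<close>

lemma V_norm_bound:
  assumes "0 \<le> c"
  obtains K where "0 < K" "\<And>p. p \<in> state_space \<Longrightarrow> V p \<le> c \<Longrightarrow> norm p \<le> K"
proof -
  obtain B where B: "0 < B" "\<And>p. norm p \<le> B * (norm (zl p) + norm (gam p) + norm (nor p) + norm (eas p))"
    using state_norm_le by blast
  have "norm p \<le> B * (sqrt (2 * c) + b + 3)" if p: "p \<in> state_space" "V p \<le> c" for p
  proof -
    have "(norm (zl p - b *\<^sub>R e3))\<^sup>2 \<le> 2 * c" using V_bounds(2)[OF p(1)] p(2) by linarith
    then have "norm (zl p - b *\<^sub>R e3) \<le> sqrt (2 * c)" by (rule real_le_rsqrt)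
    moreover have "norm (zl p) \<le> norm (zl p - b *\<^sub>R e3) + b"
      using norm_triangle_sub[of "zl p" "b *\<^sub>R e3"] b by simp
    ultimately have "norm (zl p) + norm (gam p) + norm (nor p) + norm (eas p) \<le> sqrt (2 * c) + b + 3"
      by (simp add: coords_norm[OF p(1)])
    then show ?thesis using B by (meson mult_left_mono less_imp_le order.trans)
  qed
  moreover have "0 < B * (sqrt (2 * c) + b + 3)" using B b assms by (simp add: add_nonneg_pos)
  ultimately show ?thesis using that by blast
qed

lemma W_nonneg: "p \<in> state_space \<Longrightarrow> 0 \<le> W p"
  unfolding W_def using V_bounds(4)[of p] k1v by (simp add: abs_square_le_1)

text \<open>The cut-off solution follows \<open>f\<close> up to a nonnegative factor. Rotations are
  preserved and \<open>V\<close> still does not increase, so the solution stays in its initial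
  sublevel set; the cut-off radius contains this set, and the factor is 1 throughout.\<close>

lemma solution_exists:
  assumes p0: "p0 \<in> state_space"
  shows "\<exists>x. solution x \<and> x 0 = p0"
proof -
  obtain K where K: "0 < K" "\<And>p. p \<in> state_space \<Longrightarrow> V p \<le> V p0 \<Longrightarrow> norm p \<le> K"
    using V_norm_bound[OF V_bounds(1)[OF p0]] by blast
  obtain x c where x0: "x 0 = p0" and xc: "\<forall>t\<ge>0. 0 \<le> c t \<and> (norm (x t) \<le> K \<longrightarrow> c t = 1) \<and>
      (x has_vector_derivative c t *\<^sub>R f (x t)) (at t within {0..})"
    using cutoff_solution_exists[OF error_dynamics_bounded_lipschitz K(1), of p0] by blast
  have c: "0 \<le> c t" "norm (x t) \<le> K \<Longrightarrow> c t = 1"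
    and x': "(x has_vector_derivative c t *\<^sub>R f (x t)) (at t within {0..})" if "0 \<le> t" for t
    using xc that by blast+
  define R where "R t = snd (x t)" for t
  \<comment> \<open>The derivative of \<open>R\<close> is a skew matrix times \<open>R\<close>, so
    the two terms of the product rule cancel.\<close>
  have const: "((\<lambda>t. transpose (R t) ** R t) has_vector_derivative 0) (at t within {0..})" if "t \<in> {0..}" for t
  proof -
    define S where "S = skew (sigma_R k1r k2r (fst (x t)) (R t *v e3) mI (R t *v mI))"
    have d: "(R has_vector_derivative c t *\<^sub>R ((- S) ** R t)) (at t within {0..})"
      using bounded_linear.has_vector_derivative[OF bounded_linear_snd x'[of t]] that
      by (simp add: R_def[abs_def] error_dynamics_def case_prod_beta S_def)
    have "((\<lambda>t. transpose (R t) ** R t) has_vector_derivative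
        transpose (R t) ** (c t *\<^sub>R ((- S) ** R t)) + transpose (c t *\<^sub>R ((- S) ** R t)) ** R t) (at t within {0..})"
      by (rule bounded_bilinear.has_vector_derivative[OF bounded_bilinear_matrix_mult
            bounded_linear.has_vector_derivative[OF bounded_linear_transpose d] d])
    moreover have "transpose (c t *\<^sub>R ((- S) ** R t)) = c t *\<^sub>R (transpose (R t) ** S)"
      using linear_neg[OF bounded_linear.linear[OF bounded_linear_transpose], of S]
      by (simp add: transpose_scalar matrix_transpose_mul S_def transpose_skew)
    ultimately show ?thesis
      by (simp add: matmul.scaleR_left matmul.scaleR_right matmul.minus_left matmul.minus_right matrix_mul_assoc)
  qed
  obtain C where "\<And>t. t \<in> {0..} \<Longrightarrow> transpose (R t) ** R t = C"
    using has_vector_derivative_zero_constant[OF convex_real_interval(1) const] by blast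
  then have "transpose (R t) ** R t = transpose (R 0) ** R 0" if "0 \<le> t" for t
    using that by simp
  then have orth: "orthogonal_matrix (R t)" if "0 \<le> t" for t
    using that SO3_transpose_mult[OF state_spaceD[OF p0]] x0 by (simp add: orthogonal_matrix R_def)
  have xc: "continuous_on {0..} x" using x' by (intro continuous_on_vector_derivative) auto
  have detc: "continuous_on {0..} (\<lambda>t. det (R t))"
    unfolding det_3 R_def by (intro continuous_intros continuous_on_component xc)
  \<comment> \<open>An orthogonal matrix has determinant 1 or -1, and continuity excludes a change
    of sign.\<close>
  have "det (R t) = 1" if t: "0 \<le> t" for t
  proof (rule ccontr)
    assume "det (R t) \<noteq> 1"
    then have "det (R t) = -1" using det_orthogonal_matrix[OF orth[OF t]] by simp
    moreover have "det (R 0) = 1"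
      using state_spaceD[OF p0] by (simp add: R_def x0 SO3_def rotation_matrix_def)
    ultimately have "\<exists>s\<ge>0. s \<le> t \<and> det (R s) = 0"
      using t by (intro IVT2' continuous_on_subset[OF detc]) auto
    then obtain s where "0 \<le> s" "det (R s) = 0" by blast
    then show False using det_orthogonal_matrix[OF orth[of s]] by simp
  qed
  then have M: "x t \<in> state_space" if "0 \<le> t" for t
    using orth that by (simp add: state_space_def SO3_def rotation_matrix_def R_def case_prod_beta)
  have "V (x t) \<le> V p0" if t: "0 \<le> t" for t
  proof -
    have "- V (x 0) \<le> - V (x t)"
    proof (rule derivative_nonneg_imp_mono[where J = "{0..}" and \<phi> = "\<lambda>t. - V (x t)"])
      fix s assume "s \<in> {0..t}"
      then have s: "0 \<le> s" by simp
      show "((\<lambda>t. - V (x t)) has_real_derivative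
          - (c s * ((zl (x s) - b *\<^sub>R e3) \<bullet> zl (f (x s)) - \<mu> * (gam (f (x s)) \<bullet> e3)))) (at s within {0..})"
        by (intro DERIV_minus V_derivative x' s)
      have "(zl (x s) - b *\<^sub>R e3) \<bullet> zl (f (x s)) - \<mu> * (gam (f (x s)) \<bullet> e3) \<le> 0"
        using V_decrease[OF M[OF s]] W_nonneg[OF M[OF s]] by linarith
      then show "0 \<le> - (c s * ((zl (x s) - b *\<^sub>R e3) \<bullet> zl (f (x s)) - \<mu> * (gam (f (x s)) \<bullet> e3)))"
        using c(1)[OF s] by (simp add: mult_nonneg_nonpos)
    qed (use t in auto)
    then show ?thesis by (simp add: x0)
  qed
  then have "c t = 1" if "0 \<le> t" for t using that by (intro c(2) K(2) M)
  then have "solution x"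
    unfolding ode_solution_def using M x' by (metis atLeast_iff scaleR_one)
  then show ?thesis using x0 by blast
qed

text \<open>The last term is a nonnegative multiple of a square, and the other one is of the order
  of \<open>hh p\<close>. When \<open>hh\<close> decays exponentially, the alignment of the magnetic
  field with its rotated copy can therefore decrease only by an integrable amount.\<close>

lemma magnetic_f:
  assumes "p \<in> state_space"
  shows "mI \<bullet> (snd (f p) *v mI) =
    k1r * ((hh p \<times> gam p) \<bullet> (mI \<times> (snd p *v mI))) + k2r * \<rho>\<^sup>2 * (eas p \<bullet> mI)\<^sup>2"
proof -
  have h: "fst p \<times> gam p = hh p \<times> gam p"
    by (simp add: hh_eq(1)[OF assms] cross.diff_left cross_mult_left)
  have "gam p \<bullet> (mI \<times> (snd p *v mI)) = \<rho> * ((mI \<times> nor p) \<bullet> gam p)"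
    by (simp add: mult_mI cross_add_right cross_mult_right inner_add_right dot_cross_self inner_commute)
  also have "(mI \<times> nor p) \<bullet> gam p = (nor p \<times> gam p) \<bullet> mI" by (rule cross_triple)
  also have "nor p \<times> gam p = - eas p" by (subst cross_skew) (simp add: coords_inner[OF assms])
  finally have g: "gam p \<bullet> (mI \<times> (snd p *v mI)) = - (\<rho> * (eas p \<bullet> mI))" by simp
  have "mI \<bullet> (snd (f p) *v mI) = - (mI \<bullet> (sig p \<times> (snd p *v mI)))"
    by (simp add: error_dynamics_rotation[OF assms])
  also have "\<dots> = sig p \<bullet> (mI \<times> (snd p *v mI))"
    by (simp add: cross3_simps)
  also have "\<dots> = k1r * ((hh p \<times> gam p) \<bullet> (mI \<times> (snd p *v mI))) + k2r * \<rho>\<^sup>2 * (eas p \<bullet> mI)\<^sup>2"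
    by (simp add: sig_def h inner_diff_left g power2_eq_square)
  finally show ?thesis .
qed

text \<open>\<open>hh p\<close> splits into the projections of z and of b e3 orthogonal to \<gamma>.
  That of \<open>e3\<close> has squared norm \<open>(1 - c) * (1 + c)\<close>, at most
  \<open>2 * (1 - c)\<close>, which \<open>V\<close> bounds.\<close>

lemma hh_V_bound:
  obtains k where "0 < k" "\<And>p. p \<in> state_space \<Longrightarrow> norm (hh p) \<le> k * sqrt (V p)"
proof -
  have "norm (hh p) \<le> (2 * sqrt 2 + b * sqrt (2 / \<mu>)) * sqrt (V p)" if p: "p \<in> state_space" for p
  proof -
    define z where "z = zl p - b *\<^sub>R e3"
    define c where "c = gam p \<bullet> e3"
    have "norm z \<le> sqrt (2 * V p)" using V_bounds(2)[OF p] by (intro real_le_rsqrt) (simp add: z_def)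
    moreover have "norm ((gam p \<bullet> z) *\<^sub>R gam p) \<le> norm z"
      using Cauchy_Schwarz_ineq2[of "gam p" z] by (simp add: coords_norm[OF p])
    ultimately have 1: "norm (z - (gam p \<bullet> z) *\<^sub>R gam p) \<le> 2 * sqrt 2 * sqrt (V p)"
      using norm_triangle_ineq4[of z "(gam p \<bullet> z) *\<^sub>R gam p"] by (simp add: real_sqrt_mult)
    have "norm (e3 - c *\<^sub>R gam p) \<le> sqrt (2 / \<mu>) * sqrt (V p)"
    proof -
      have "(norm (e3 - c *\<^sub>R gam p))\<^sup>2 = (1 - c) * (1 + c)"
        unfolding power2_norm_eq_inner
        by (simp add: inner_diff_left inner_diff_right inner_e3 coords_inner[OF p] c_def inner_commute algebra_simps)
      also have "\<dots> \<le> (1 - c) * 2"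
        using V_bounds(4)[OF p] by (intro mult_left_mono) (auto simp: c_def)
      also have "\<dots> \<le> 2 / \<mu> * V p"
        using V_bounds(3)[OF p] \<mu> by (simp add: c_def field_simps)
      finally have "norm (e3 - c *\<^sub>R gam p) \<le> sqrt (2 / \<mu> * V p)" by (rule real_le_rsqrt)
      then show ?thesis by (simp only: real_sqrt_mult)
    qed
    then have 2: "norm (b *\<^sub>R (e3 - c *\<^sub>R gam p)) \<le> b * (sqrt (2 / \<mu>) * sqrt (V p))"
      using b by simp
    have "hh p = (z - (gam p \<bullet> z) *\<^sub>R gam p) + b *\<^sub>R (e3 - c *\<^sub>R gam p)"
      by (simp add: hh_def z_def c_def inner_diff_right algebra_simps)
    then have "norm (hh p) \<le> 2 * sqrt 2 * sqrt (V p) + b * (sqrt (2 / \<mu>) * sqrt (V p))"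
      by (simp only:) (rule order.trans[OF norm_triangle_ineq add_mono[OF 1 2]])
    then show ?thesis by (simp only: distrib_right mult.assoc)
  qed
  moreover have "0 < 2 * sqrt 2 + b * sqrt (2 / \<mu>)" using b \<mu> by (simp add: add_pos_nonneg)
  ultimately show ?thesis using that by blast
qed

end

section \<open>Convergence of the error trajectories\<close>

lemma tendsto_zero_if_sq:
  fixes h :: "real \<Rightarrow> 'a::real_normed_vector"
  assumes "((\<lambda>t. (norm (h t))\<^sup>2) \<longlongrightarrow> 0) F"
  shows "(h \<longlongrightarrow> 0) F"
proof -
  have "((\<lambda>t. sqrt ((norm (h t))\<^sup>2)) \<longlongrightarrow> sqrt 0) F" by (intro tendsto_real_sqrt assms)
  then show ?thesis by (simp add: tendsto_norm_zero_iff)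
qed

lemma tendsto_zero_if_le:
  fixes h :: "real \<Rightarrow> real"
  assumes "(k \<longlongrightarrow> 0) at_top" "\<And>t. T \<le> t \<Longrightarrow> \<bar>h t\<bar> \<le> k t"
  shows "(h \<longlongrightarrow> 0) at_top"
proof (rule Lim_null_comparison[OF _ assms(1)])
  show "\<forall>\<^sub>F t in at_top. norm (h t) \<le> k t"
    using assms(2) by (intro eventually_at_top_linorderI[of T]) auto
qed

text \<open>For unit vectors and \<open>s * s = 1\<close>, the squared norm of
  \<open>h t - s *\<^sub>R u\<close> is \<open>2 - 2 * s * (h t \<bullet> u)\<close>, so one
  component decides the limit.\<close>

lemma tendsto_unit:
  fixes h :: "real \<Rightarrow> 'a::real_inner"
  assumes "((\<lambda>t. h t \<bullet> u) \<longlongrightarrow> s) F" "\<forall>\<^sub>F t in F. h t \<bullet> h t = 1" "u \<bullet> u = 1" "s * s = 1"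
  shows "(h \<longlongrightarrow> s *\<^sub>R u) F"
proof -
  have "((\<lambda>t. 2 - 2 * s * (h t \<bullet> u)) \<longlongrightarrow> 2 - 2 * s * s) F"
    by (intro tendsto_intros assms)
  then have "((\<lambda>t. 2 - 2 * s * (h t \<bullet> u)) \<longlongrightarrow> 0) F" using assms(4) by (simp add: mult.assoc)
  moreover have "\<forall>\<^sub>F t in F. 2 - 2 * s * (h t \<bullet> u) = (norm (h t - s *\<^sub>R u))\<^sup>2"
    using assms(2)
  proof eventually_elim
    case (elim t)
    have "(h t - s *\<^sub>R u) \<bullet> (h t - s *\<^sub>R u) = h t \<bullet> h t - 2 * s * (h t \<bullet> u) + (s * s) * (u \<bullet> u)"
      by (simp add: inner_diff_left inner_diff_right inner_commute algebra_simps)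
    then show ?case using elim assms(3,4) by (simp add: power2_norm_eq_inner)
  qed
  ultimately have "((\<lambda>t. (norm (h t - s *\<^sub>R u))\<^sup>2) \<longlongrightarrow> 0) F"
    using tendsto_cong by force
  then have "((\<lambda>t. h t - s *\<^sub>R u) \<longlongrightarrow> 0) F" by (rule tendsto_zero_if_sq)
  then show ?thesis by (simp add: LIM_zero_iff)
qed

context error_system
begin

context
  fixes x assumes sol: "solution x"
begin

lemma sol_in: "0 \<le> t \<Longrightarrow> x t \<in> state_space"
  and sol_deriv: "0 \<le> t \<Longrightarrow> (x has_vector_derivative f (x t)) (at t within {0..})"
  using sol unfolding ode_solution_def by auto

lemma sol_V:
  assumes "0 \<le> t"
  shows "((\<lambda>t. V (x t)) has_real_derivative
    ((zl (x t) - b *\<^sub>R e3) \<bullet> zl (f (x t)) - \<mu> * (gam (f (x t)) \<bullet> e3))) (at t within {0..})"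
    "(zl (x t) - b *\<^sub>R e3) \<bullet> zl (f (x t)) - \<mu> * (gam (f (x t)) \<bullet> e3) \<le> - W (x t)"
  using V_derivative[of x 1 t "{0..}"] sol_deriv[OF assms] V_decrease[OF sol_in[OF assms]] by simp_all

lemma sol_V_mono: "0 \<le> t \<Longrightarrow> V (x t) \<le> V (x 0)"
proof -
  assume t: "0 \<le> t"
  have "- V (x 0) \<le> - V (x t)"
  proof (rule derivative_nonneg_imp_mono[where J = "{0..}" and \<phi> = "\<lambda>t. - V (x t)"])
    fix s assume "s \<in> {0..t}"
    then have s: "0 \<le> s" by simp
    show "((\<lambda>t. - V (x t)) has_real_derivative
        - ((zl (x s) - b *\<^sub>R e3) \<bullet> zl (f (x s)) - \<mu> * (gam (f (x s)) \<bullet> e3))) (at s within {0..})"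
      by (intro DERIV_minus sol_V s)
    show "0 \<le> - ((zl (x s) - b *\<^sub>R e3) \<bullet> zl (f (x s)) - \<mu> * (gam (f (x s)) \<bullet> e3))"
      using sol_V(2)[OF s] W_nonneg[OF sol_in[OF s]] by linarith
  qed (use t in auto)
  then show ?thesis by simp
qed

text \<open>Barbalat's lemma needs dissipation terms with bounded derivatives, both for
  \<open>W\<close> and for the magnetic term.\<close>

lemma sol_f_bounded: "\<exists>K>0. \<forall>t\<ge>0. norm (f (x t)) \<le> K \<and> norm (zl (f (x t))) \<le> K \<and>
  norm (gam (f (x t))) \<le> K \<and> norm (eas (f (x t))) \<le> K"
proof -
  obtain K1 where K1: "\<And>p. p \<in> state_space \<Longrightarrow> V p \<le> V (x 0) \<Longrightarrow> norm p \<le> K1"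
    using V_norm_bound[OF V_bounds(1)[OF sol_in]] by (metis order.refl)
  obtain K2 where K2: "0 \<le> K2" "\<And>p. p \<in> cball 0 K1 \<Longrightarrow> norm (f p) \<le> K2"
    using bounded_lipschitz_bound[OF error_dynamics_bounded_lipschitz bounded_cball] by metis
  have f: "norm (f (x t)) \<le> K2" if "0 \<le> t" for t
    using K1[OF sol_in sol_V_mono] that by (intro K2) auto
  obtain Kz where Kz: "0 < Kz" "\<And>p. norm (zl p) \<le> norm p * Kz"
    using bounded_linear.pos_bounded[OF bounded_linear_coords(4)] by blast
  obtain Kg where Kg: "0 < Kg" "\<And>p. norm (gam p) \<le> norm p * Kg"
    using bounded_linear.pos_bounded[OF bounded_linear_coords(1)] by blast
  obtain Ke where Ke: "0 < Ke" "\<And>p. norm (eas p) \<le> norm p * Ke"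
    using bounded_linear.pos_bounded[OF bounded_linear_coords(3)] by blast
  define K where "K = (K2 + 1) * (1 + Kz + Kg + Ke)"
  have bnd: "norm (f (x t)) * k \<le> K" if "0 \<le> t" "0 \<le> k" "k \<le> 1 + Kz + Kg + Ke" for t k
    unfolding K_def using f[OF that(1)] K2 that by (intro mult_mono) auto
  have "norm (f (x t)) \<le> K \<and> norm (zl (f (x t))) \<le> K \<and> norm (gam (f (x t))) \<le> K \<and> norm (eas (f (x t))) \<le> K"
    if t: "0 \<le> t" for t
  proof (intro conjI)
    show "norm (f (x t)) \<le> K" using bnd[OF t, of 1] Kz Kg Ke by simp
    show "norm (zl (f (x t))) \<le> K" by (rule order.trans[OF Kz(2) bnd[OF t]]) (use Kz Kg Ke in auto)
    show "norm (gam (f (x t))) \<le> K" by (rule order.trans[OF Kg(2) bnd[OF t]]) (use Kz Kg Ke in auto)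
    show "norm (eas (f (x t))) \<le> K" by (rule order.trans[OF Ke(2) bnd[OF t]]) (use Kz Kg Ke in auto)
  qed
  moreover have "0 < K" unfolding K_def using K2 Kz Kg Ke by (intro mult_pos_pos) auto
  ultimately show ?thesis by blast
qed

lemma sol_W_limit: "((\<lambda>t. W (x t)) \<longlongrightarrow> 0) at_top" "\<exists>l. ((\<lambda>t. V (x t)) \<longlongrightarrow> l) at_top"
proof -
  obtain K where K: "0 < K" "\<And>t. 0 \<le> t \<Longrightarrow> norm (zl (f (x t))) \<le> K" "\<And>t. 0 \<le> t \<Longrightarrow> norm (gam (f (x t))) \<le> K"
    using sol_f_bounded by blast
  define z where "z t = zl (x t) - b *\<^sub>R e3" for t
  define c where "c t = gam (x t) \<bullet> e3" for t
  define w' where "w' t = (k1v / 2) * (2 * (z t \<bullet> zl (f (x t))) + b\<^sup>2 * (0 - 2 * c t * (gam (f (x t)) \<bullet> e3)))" for t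
  have V0: "0 \<le> V (x 0)" by (intro V_bounds sol_in) simp
  have W': "((\<lambda>t. W (x t)) has_real_derivative w' t) (at t within {0..})" if t: "0 \<le> t" for t
  proof -
    have dz: "(z has_vector_derivative zl (f (x t))) (at t within {0..})"
      unfolding z_def using bounded_linear.has_vector_derivative[OF bounded_linear_coords(4) sol_deriv[OF t]]
      by (auto intro!: derivative_eq_intros)
    have "(c has_vector_derivative gam (f (x t)) \<bullet> e3) (at t within {0..})"
      unfolding c_def
      by (rule bounded_linear.has_vector_derivative[OF bounded_linear_compose[OF bounded_linear_inner_left bounded_linear_coords(1)] sol_deriv[OF t]])
    then have dc: "(c has_real_derivative gam (f (x t)) \<bullet> e3) (at t within {0..})"
      by (simp add: has_real_derivative_iff_has_vector_derivative)
    have "((\<lambda>t. 1 - c t * c t) has_real_derivative 0 - 2 * c t * (gam (f (x t)) \<bullet> e3)) (at t within {0..})"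
      by (rule derivative_eq_intros dc refl)+ simp
    from DERIV_cmult[OF DERIV_add[OF inner_self_derivative[OF bounded_linear_ident dz] DERIV_cmult[OF this]]]
    show ?thesis
      unfolding W_def w'_def power2_norm_eq_inner z_def c_def power2_eq_square[of "gam _ \<bullet> e3"] .
  qed
  define L where "L = (k1v / 2) * (2 * (sqrt (2 * V (x 0)) * K) + b\<^sup>2 * (2 * K))"
  have L: "\<bar>w' t\<bar> \<le> L" if t: "0 \<le> t" for t
  proof -
    have "(norm (z t))\<^sup>2 \<le> 2 * V (x 0)"
      unfolding z_def using V_bounds(2)[OF sol_in[OF t]] sol_V_mono[OF t] by linarith
    then have "norm (z t) \<le> sqrt (2 * V (x 0))" by (rule real_le_rsqrt)
    then have 1: "\<bar>z t \<bullet> zl (f (x t))\<bar> \<le> sqrt (2 * V (x 0)) * K" using K t by (intro abs_inner_le)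
    have "\<bar>gam (f (x t)) \<bullet> e3\<bar> \<le> K * 1" using K t frame_norm by (intro abs_inner_le) auto
    moreover have "\<bar>c t\<bar> \<le> 1" unfolding c_def by (intro V_bounds sol_in t)
    ultimately have "\<bar>c t * (gam (f (x t)) \<bullet> e3)\<bar> \<le> 1 * K" unfolding abs_mult using K by (intro mult_mono) auto
    then have 2: "\<bar>b\<^sup>2 * (0 - 2 * c t * (gam (f (x t)) \<bullet> e3))\<bar> \<le> b\<^sup>2 * (2 * K)"
      by (simp add: abs_mult mult.assoc mult_left_mono)
    have "\<bar>2 * (z t \<bullet> zl (f (x t))) + b\<^sup>2 * (0 - 2 * c t * (gam (f (x t)) \<bullet> e3))\<bar>
        \<le> 2 * (sqrt (2 * V (x 0)) * K) + b\<^sup>2 * (2 * K)"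
      using 1 by (intro order.trans[OF abs_triangle_ineq add_mono[OF _ 2]]) (simp add: abs_mult)
    then show ?thesis unfolding w'_def L_def abs_mult[of "k1v / 2"] using k1v by (intro mult_mono) auto
  qed
  show "((\<lambda>t. W (x t)) \<longlongrightarrow> 0) at_top" "\<exists>l. ((\<lambda>t. V (x t)) \<longlongrightarrow> l) at_top"
    using Barbalat[OF sol_V V_bounds(1)[OF sol_in] W' L W_nonneg[OF sol_in]] by auto
qed

text \<open>Vanishing dissipation gives only that the square of
  \<open>gam (x t) \<bullet> e3\<close> tends to 1. That the component itself converges, rather than
  alternating between the poles, follows from the limit of \<open>V\<close>, of which it is an
  affine function up to a vanishing term.\<close>

lemma sol_axis_limit:
  obtains s where "s = 1 \<or> s = -1" "((\<lambda>t. zl (x t)) \<longlongrightarrow> b *\<^sub>R e3) at_top" "((\<lambda>t. gam (x t)) \<longlongrightarrow> s *\<^sub>R e3) at_top"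
proof -
  obtain l where l: "((\<lambda>t. V (x t)) \<longlongrightarrow> l) at_top" using sol_W_limit(2) by blast
  define c where "c t = gam (x t) \<bullet> e3" for t
  have "((\<lambda>t. (norm (zl (x t) - b *\<^sub>R e3))\<^sup>2) \<longlongrightarrow> 0) at_top"
  proof (rule tendsto_zero_if_le[where T = 0])
    show "((\<lambda>t. 2 / k1v * W (x t)) \<longlongrightarrow> 0) at_top" by (intro tendsto_mult_right_zero sol_W_limit)
    fix t :: real assume t: "0 \<le> t"
    have "0 \<le> b\<^sup>2 * (1 - (gam (x t) \<bullet> e3)\<^sup>2)"
      using V_bounds(4)[OF sol_in[OF t]] by (simp add: abs_square_le_1)
    then show "\<bar>(norm (zl (x t) - b *\<^sub>R e3))\<^sup>2\<bar> \<le> 2 / k1v * W (x t)" using k1v by (simp add: W_def)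
  qed
  note z2 = this
  have "((\<lambda>t. 1 - c t * c t) \<longlongrightarrow> 0) at_top"
  proof (rule tendsto_zero_if_le[where T = 0])
    show "((\<lambda>t. 2 / (k1v * b\<^sup>2) * W (x t)) \<longlongrightarrow> 0) at_top" by (intro tendsto_mult_right_zero sol_W_limit)
    fix t :: real assume t: "0 \<le> t"
    have "0 \<le> 1 - (c t)\<^sup>2"
      using V_bounds(4)[OF sol_in[OF t]] by (simp add: abs_square_le_1 c_def)
    moreover have "b\<^sup>2 * (1 - (c t)\<^sup>2) \<le> 2 / k1v * W (x t)" using k1v by (simp add: W_def c_def)
    then have "1 - (c t)\<^sup>2 \<le> 2 / k1v * W (x t) / b\<^sup>2" using b by (subst pos_le_divide_eq) (simp_all add: mult.commute)
    ultimately show "\<bar>1 - c t * c t\<bar> \<le> 2 / (k1v * b\<^sup>2) * W (x t)" by (simp add: power2_eq_square)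
  qed
  note c2 = this
  have c_eq: "c t = 1 - (V (x t) - (norm (zl (x t) - b *\<^sub>R e3))\<^sup>2 / 2) / \<mu>" for t
    using \<mu> by (simp add: V_def c_def)
  define s where "s = 1 - (l - 0 / 2) / \<mu>"
  have c: "(c \<longlongrightarrow> s) at_top"
    unfolding c_eq[abs_def] s_def using \<mu> by (intro tendsto_intros l z2) auto
  have "((\<lambda>t. 1 - c t * c t) \<longlongrightarrow> 1 - s * s) at_top" by (intro tendsto_intros c)
  then have "1 - s * s = 0" using c2 tendsto_unique trivial_limit_at_top_linorder by blast
  then have ss: "s * s = 1" by simp
  have "((\<lambda>t. gam (x t)) \<longlongrightarrow> s *\<^sub>R e3) at_top"
  proof (rule tendsto_unit[OF _ _ inner_e3 ss])
    show "((\<lambda>t. gam (x t) \<bullet> e3) \<longlongrightarrow> s) at_top" using c by (simp add: c_def[abs_def])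
    show "\<forall>\<^sub>F t in at_top. gam (x t) \<bullet> gam (x t) = 1"
      by (intro eventually_at_top_linorderI[of 0] coords_inner sol_in)
  qed
  moreover have "((\<lambda>t. zl (x t)) \<longlongrightarrow> b *\<^sub>R e3) at_top"
    using tendsto_zero_if_sq[OF z2] by (simp add: LIM_zero_iff)
  moreover have "s = 1 \<or> s = -1" using ss by (simp add: square_eq_1_iff)
  ultimately show ?thesis using that by blast
qed

text \<open>Once \<open>c = gam (x t) \<bullet> e3\<close> is positive,
  \<open>1 - c\<^sup>2 \<ge> 1 - c\<close>, so \<open>W\<close> dominates a multiple of
  \<open>V\<close>.\<close>

lemma sol_V_exp:
  assumes "((\<lambda>t. gam (x t)) \<longlongrightarrow> e3) at_top"
  obtains r M where "0 < r" "0 \<le> M" "\<And>t. 0 \<le> t \<Longrightarrow> sqrt (V (x t)) \<le> M * exp (- r * t)"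
proof -
  define r where "r = min k1v (k1v * b\<^sup>2 / (2 * \<mu>))"
  have r: "0 < r" "r \<le> k1v" "r * \<mu> \<le> k1v * b\<^sup>2 / 2"
  proof -
    show "0 < r" "r \<le> k1v" using k1v b \<mu> by (auto simp: r_def)
    have "r * \<mu> \<le> k1v * b\<^sup>2 / (2 * \<mu>) * \<mu>" unfolding r_def using \<mu> by (intro mult_right_mono) auto
    then show "r * \<mu> \<le> k1v * b\<^sup>2 / 2" using \<mu> by simp
  qed
  have "((\<lambda>t. gam (x t) \<bullet> e3) \<longlongrightarrow> e3 \<bullet> e3) at_top" by (intro tendsto_intros assms)
  then have "\<forall>\<^sub>F t in at_top. 0 < gam (x t) \<bullet> e3"
    by (rule order_tendstoD) (simp add: inner_e3)
  then obtain T0 where T0: "\<And>t. T0 \<le> t \<Longrightarrow> 0 < gam (x t) \<bullet> e3" by (auto simp: eventually_at_top_linorder)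
  define T where "T = max 0 T0"
  have T: "0 \<le> T" "\<And>t. T \<le> t \<Longrightarrow> 0 < gam (x t) \<bullet> e3" using T0 by (auto simp: T_def)
  have decay: "V (x t) \<le> V (x T) * exp (- r * (t - T))" if t: "T \<le> t" for t
  proof (rule exponential_bound[where J = "{0..}"])
    fix u assume "u \<in> {T..t}"
    then have u: "0 \<le> u" "T \<le> u" using T(1) by auto
    show "((\<lambda>t. V (x t)) has_real_derivative
      ((zl (x u) - b *\<^sub>R e3) \<bullet> zl (f (x u)) - \<mu> * (gam (f (x u)) \<bullet> e3))) (at u within {0..})"
      by (rule sol_V[OF u(1)])
    define c Z where "c = gam (x u) \<bullet> e3" and "Z = (norm (zl (x u) - b *\<^sub>R e3))\<^sup>2"
    have c: "0 \<le> 1 - c" "0 < c" using V_bounds(4)[OF sol_in[OF u(1)]] T(2)[OF u(2)] by (auto simp: c_def)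
    have "r * V (x u) = r * (Z / 2) + (r * \<mu>) * (1 - c)" by (simp add: V_def Z_def c_def algebra_simps)
    also have "\<dots> \<le> k1v * (Z / 2) + (k1v * b\<^sup>2 / 2) * (1 - c)"
      using r c by (intro add_mono mult_right_mono) (auto simp: Z_def)
    also have "\<dots> \<le> k1v * (Z / 2) + (k1v * b\<^sup>2 / 2) * (1 - c\<^sup>2)"
    proof -
      have "c * c \<le> c * 1" using c by (intro mult_left_mono) auto
      then show ?thesis using k1v by (intro add_left_mono mult_left_mono) (auto simp: power2_eq_square)
    qed
    also have "\<dots> = W (x u)" by (simp add: W_def Z_def c_def algebra_simps)
    finally show "(zl (x u) - b *\<^sub>R e3) \<bullet> zl (f (x u)) - \<mu> * (gam (f (x u)) \<bullet> e3) \<le> - r * V (x u)"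
      using sol_V(2)[OF u(1)] by simp
  qed (use t T in auto)
  \<comment> \<open>The factor \<open>exp (r * T)\<close> extends the bound to times before
    \<open>T\<close>, where \<open>V\<close> is merely at most its initial value.\<close>
  define M where "M = V (x 0) * exp (r * T)"
  have V0: "0 \<le> V (x 0)" by (intro V_bounds sol_in) simp
  have "sqrt (V (x t)) \<le> sqrt M * exp (- (r / 2) * t)" if t: "0 \<le> t" for t
  proof -
    have "V (x t) \<le> M * exp (- r * t)"
    proof (cases "T \<le> t")
      case True
      have "V (x t) \<le> V (x T) * exp (- r * (t - T))" by (rule decay[OF True])
      also have "\<dots> \<le> V (x 0) * exp (- r * (t - T))" using sol_V_mono[OF T(1)] by (intro mult_right_mono) auto
      also have "exp (- r * (t - T)) = exp (r * T) * exp (- r * t)" by (simp add: algebra_simps flip: exp_add)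
      finally show ?thesis by (simp add: M_def mult.assoc)
    next
      case False
      have "V (x t) \<le> V (x 0) * 1" using sol_V_mono[OF t] by simp
      also have "\<dots> \<le> V (x 0) * exp (r * T - r * t)"
        using V0 r False by (intro mult_left_mono) auto
      also have "exp (r * T - r * t) = exp (r * T) * exp (- r * t)" by (simp flip: exp_add)
      finally show ?thesis by (simp add: M_def mult.assoc)
    qed
    also have "\<dots> = M * (exp (- (r / 2) * t))\<^sup>2" by (simp flip: exp_double)
    finally have "sqrt (V (x t)) \<le> sqrt (M * (exp (- (r / 2) * t))\<^sup>2)" by (rule real_sqrt_le_mono)
    then show ?thesis by (simp add: real_sqrt_mult)
  qed
  then show ?thesis using that[of "r / 2" "sqrt M"] r V0 by (simp add: M_def)
qed

text \<open>The exponential added to \<open>- C t\<close> in \<open>U\<close> compensates the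
  integrable error, so Barbalat's lemma applies with the squared magnetic term as dissipation. Then
  \<open>eas (x t) \<bullet> mI\<close> tends to 0, and \<open>C t\<close> has a limit, which
  excludes alternation between the two directions.\<close>

lemma sol_yaw_limit:
  assumes gam_lim: "((\<lambda>t. gam (x t)) \<longlongrightarrow> e3) at_top"
  obtains s where "s = 1 \<or> s = -1" "((\<lambda>t. nor (x t)) \<longlongrightarrow> s *\<^sub>R north) at_top"
proof -
  obtain r M where r: "0 < r" "0 \<le> M" "\<And>t. 0 \<le> t \<Longrightarrow> sqrt (V (x t)) \<le> M * exp (- r * t)"
    using sol_V_exp[OF gam_lim] by blast
  obtain k where k: "0 < k" "\<And>p. p \<in> state_space \<Longrightarrow> norm (hh p) \<le> k * sqrt (V p)" using hh_V_bound by blast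
  obtain K where K: "0 < K" "\<And>t. 0 \<le> t \<Longrightarrow> norm (eas (f (x t))) \<le> K" using sol_f_bounded by blast
  define m where "m = norm mI"
  define D where "D = k1r * (k * M * m\<^sup>2)"
  have D: "0 \<le> D" using k1r k r by (simp add: D_def)
  define C where "C t = mI \<bullet> (snd (x t) *v mI)" for t
  define U where "U t = - C t + (D / r) * exp (- r * t)" for t
  define U' where "U' t = - (mI \<bullet> (snd (f (x t)) *v mI)) - D * exp (- r * t)" for t
  define w where "w t = k2r * \<rho>\<^sup>2 * (eas (x t) \<bullet> mI)\<^sup>2" for t
  define w' where "w' t = k2r * \<rho>\<^sup>2 * (2 * (eas (x t) \<bullet> mI) * (eas (f (x t)) \<bullet> mI))" for t
  have Rm: "norm (snd (x t) *v mI) = m" if "0 \<le> t" for t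
    unfolding m_def by (rule SO3_norm[OF state_spaceD[OF sol_in[OF that]]])
  have dU: "(U has_real_derivative U' t) (at t within {0..})" if t: "0 \<le> t" for t
  proof -
    have "(C has_vector_derivative mI \<bullet> (snd (f (x t)) *v mI)) (at t within {0..})"
      unfolding C_def
      by (rule bounded_linear.has_vector_derivative[OF bounded_linear_compose[OF bounded_linear_inner_right
              bounded_linear_compose[OF matvec.bounded_linear_left bounded_linear_snd]] sol_deriv[OF t]])
    then have dC: "(C has_real_derivative mI \<bullet> (snd (f (x t)) *v mI)) (at t within {0..})"
      by (simp add: has_real_derivative_iff_has_vector_derivative)
    show ?thesis unfolding U_def U'_def
      using r by (auto intro!: derivative_eq_intros dC)
  qed
  have U'w: "U' t \<le> - w t" if t: "0 \<le> t" for t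
  proof -
    have "\<bar>(hh (x t) \<times> gam (x t)) \<bullet> (mI \<times> (snd (x t) *v mI))\<bar> \<le> ((k * (M * exp (- r * t))) * 1) * (m * m)"
    proof (intro abs_inner_le norm_cross_le)
      show "norm (hh (x t)) \<le> k * (M * exp (- r * t))"
        using k(2)[OF sol_in[OF t]] mult_left_mono[OF r(3)[OF t], of k] k(1) by linarith
      show "norm (gam (x t)) \<le> 1" using coords_norm[OF sol_in[OF t]] by simp
    qed (use Rm[OF t] in \<open>auto simp: m_def\<close>)
    then have "k1r * - ((hh (x t) \<times> gam (x t)) \<bullet> (mI \<times> (snd (x t) *v mI))) \<le> k1r * (((k * (M * exp (- r * t))) * 1) * (m * m))"
      using k1r by (intro mult_left_mono) auto
    also have "\<dots> = D * exp (- r * t)" by (simp add: D_def power2_eq_square)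
    finally have "- (k1r * ((hh (x t) \<times> gam (x t)) \<bullet> (mI \<times> (snd (x t) *v mI)))) \<le> D * exp (- r * t)"
      by simp
    then show ?thesis unfolding U'_def w_def magnetic_f[OF sol_in[OF t]] by linarith
  qed
  have low: "- (m * m) \<le> U t" if t: "0 \<le> t" for t
  proof -
    have "\<bar>C t\<bar> \<le> m * m" unfolding C_def by (rule abs_inner_le) (use Rm[OF t] in \<open>auto simp: m_def\<close>)
    moreover have "0 \<le> (D / r) * exp (- r * t)" using D r by simp
    ultimately show ?thesis unfolding U_def by linarith
  qed
  have dw: "(w has_real_derivative w' t) (at t within {0..})" if t: "0 \<le> t" for t
  proof -
    have "((\<lambda>t. eas (x t) \<bullet> mI) has_vector_derivative eas (f (x t)) \<bullet> mI) (at t within {0..})"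
      by (rule bounded_linear.has_vector_derivative[OF bounded_linear_compose[OF bounded_linear_inner_left bounded_linear_coords(3)] sol_deriv[OF t]])
    then have d: "((\<lambda>t. eas (x t) \<bullet> mI) has_real_derivative eas (f (x t)) \<bullet> mI) (at t within {0..})"
      by (simp add: has_real_derivative_iff_has_vector_derivative)
    show ?thesis unfolding w_def w'_def
      by (rule DERIV_cmult) (auto intro!: derivative_eq_intros d)
  qed
  have w'L: "\<bar>w' t\<bar> \<le> k2r * \<rho>\<^sup>2 * (2 * (1 * m) * (K * m))" if t: "0 \<le> t" for t
  proof -
    have "\<bar>eas (x t) \<bullet> mI\<bar> \<le> 1 * m" "\<bar>eas (f (x t)) \<bullet> mI\<bar> \<le> K * m"
      using coords_norm[OF sol_in[OF t]] K(2)[OF t] by (intro abs_inner_le; simp add: m_def)+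
    then have "2 * \<bar>eas (x t) \<bullet> mI\<bar> * \<bar>eas (f (x t)) \<bullet> mI\<bar> \<le> 2 * (1 * m) * (K * m)"
      by (intro mult_mono) (auto simp: m_def)
    then show ?thesis unfolding w'_def using k2r by (simp add: abs_mult mult_left_mono mult.assoc)
  qed
  have wpos: "0 \<le> w t" for t using k2r by (simp add: w_def)
  note Bar = Barbalat[OF dU U'w low dw w'L wpos]
  obtain l where l: "(U \<longlongrightarrow> l) at_top" using Bar(2) by blast
  have "((\<lambda>t. exp (- r * t)) \<longlongrightarrow> 0) at_top"
  proof -
    have "filterlim (\<lambda>t. r * t) at_top at_top"
      using r(1) by (intro filterlim_tendsto_pos_mult_at_top[OF tendsto_const _ filterlim_ident]) auto
    then have "filterlim (\<lambda>t. - (r * t)) at_bot at_top" by (simp add: filterlim_uminus_at_bot)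
    then have "((\<lambda>t. exp (- (r * t))) \<longlongrightarrow> 0) at_top" by (rule filterlim_compose[OF exp_at_bot])
    then show ?thesis by simp
  qed
  then have "((\<lambda>t. (D / r) * exp (- r * t) - U t) \<longlongrightarrow> (D / r) * 0 - l) at_top" by (intro tendsto_intros l)
  then have C: "(C \<longlongrightarrow> - l) at_top" by (simp add: U_def)
  have "((\<lambda>t. w t / (k2r * \<rho>\<^sup>2)) \<longlongrightarrow> 0 / (k2r * \<rho>\<^sup>2)) at_top"
    using k2r \<rho> by (intro tendsto_divide Bar(1) tendsto_const) auto
  then have "((\<lambda>t. (norm (eas (x t) \<bullet> mI))\<^sup>2) \<longlongrightarrow> 0) at_top"
    using k2r \<rho> by (simp add: w_def)
  then have em: "((\<lambda>t. eas (x t) \<bullet> mI) \<longlongrightarrow> 0) at_top" by (rule tendsto_zero_if_sq)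
  have "((\<lambda>t. norm (gam (x t) - e3)) \<longlongrightarrow> 0) at_top"
    using gam_lim by (simp add: LIM_zero tendsto_norm_zero)
  then have ge: "((\<lambda>t. 1 * norm (gam (x t) - e3)) \<longlongrightarrow> 0) at_top" by simp
  have e_down: "((\<lambda>t. eas (x t) \<bullet> e3) \<longlongrightarrow> 0) at_top"
  proof (rule tendsto_zero_if_le[OF ge, of 0])
    fix t :: real assume t: "0 \<le> t"
    have "eas (x t) \<bullet> e3 = - (eas (x t) \<bullet> (gam (x t) - e3))"
      by (simp add: inner_diff_right coords_inner[OF sol_in[OF t]])
    moreover have "\<bar>eas (x t) \<bullet> (gam (x t) - e3)\<bar> \<le> 1 * norm (gam (x t) - e3)"
      using coords_norm[OF sol_in[OF t]] by (intro abs_inner_le) auto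
    ultimately show "\<bar>eas (x t) \<bullet> e3\<bar> \<le> 1 * norm (gam (x t) - e3)" by simp
  qed
  have n_down: "((\<lambda>t. nor (x t) \<bullet> e3) \<longlongrightarrow> 0) at_top"
  proof (rule tendsto_zero_if_le[OF ge, of 0])
    fix t :: real assume t: "0 \<le> t"
    have "nor (x t) \<bullet> e3 = - (nor (x t) \<bullet> (gam (x t) - e3))"
      by (simp add: inner_diff_right coords_inner[OF sol_in[OF t]])
    moreover have "\<bar>nor (x t) \<bullet> (gam (x t) - e3)\<bar> \<le> 1 * norm (gam (x t) - e3)"
      using coords_norm[OF sol_in[OF t]] by (intro abs_inner_le) auto
    ultimately show "\<bar>nor (x t) \<bullet> e3\<bar> \<le> 1 * norm (gam (x t) - e3)" by simp
  qed
  have "eas (x t) \<bullet> north = (eas (x t) \<bullet> mI - (mI \<bullet> e3) * (eas (x t) \<bullet> e3)) / \<rho>" for t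
  proof -
    have "eas (x t) \<bullet> mI = \<rho> * (eas (x t) \<bullet> north) + (mI \<bullet> e3) * (eas (x t) \<bullet> e3)"
      by (subst mI_eq) (simp add: inner_add_right)
    then show ?thesis using \<rho> by simp
  qed
  moreover have "((\<lambda>t. (eas (x t) \<bullet> mI - (mI \<bullet> e3) * (eas (x t) \<bullet> e3)) / \<rho>) \<longlongrightarrow> (0 - (mI \<bullet> e3) * 0) / \<rho>) at_top"
    using \<rho> by (intro tendsto_intros em e_down) auto
  ultimately have e_north: "((\<lambda>t. eas (x t) \<bullet> north) \<longlongrightarrow> 0) at_top" by simp
  have n_east: "((\<lambda>t. nor (x t) \<bullet> east) \<longlongrightarrow> 0) at_top"
  proof (rule tendsto_zero_if_le[where T = 0])
    have "((\<lambda>t. 1 * norm (gam (x t) - e3) + \<bar>eas (x t) \<bullet> north\<bar>) \<longlongrightarrow> 0 + 0) at_top"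
      by (intro tendsto_add ge tendsto_rabs_zero e_north)
    then show "((\<lambda>t. 1 * norm (gam (x t) - e3) + \<bar>eas (x t) \<bullet> north\<bar>) \<longlongrightarrow> 0) at_top" by simp
    fix t :: real assume t: "0 \<le> t"
    have "nor (x t) \<bullet> east = (eas (x t) \<times> gam (x t)) \<bullet> east"
      by (simp add: coords_inner[OF sol_in[OF t]])
    also have "\<dots> = (gam (x t) \<times> east) \<bullet> eas (x t)" by (rule cross_triple)
    also have "\<dots> = eas (x t) \<bullet> ((gam (x t) - e3) \<times> east) + eas (x t) \<bullet> (e3 \<times> east)"
      by (simp add: cross.diff_left inner_diff_right inner_commute)
    also have "e3 \<times> east = - north" using cross_skew[of e3 east] by (simp add: frame)
    finally have "nor (x t) \<bullet> east = eas (x t) \<bullet> ((gam (x t) - e3) \<times> east) - eas (x t) \<bullet> north" by simp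
    moreover have "\<bar>eas (x t) \<bullet> ((gam (x t) - e3) \<times> east)\<bar> \<le> 1 * (norm (gam (x t) - e3) * 1)"
      using coords_norm[OF sol_in[OF t]] frame_norm by (intro abs_inner_le norm_cross_le) auto
    ultimately show "\<bar>nor (x t) \<bullet> east\<bar> \<le> 1 * norm (gam (x t) - e3) + \<bar>eas (x t) \<bullet> north\<bar>" by linarith
  qed
  \<comment> \<open>The limit of \<open>nor (x t) \<bullet> north\<close>, found by solving the
    formula for \<open>C t\<close> for it and inserting the limits of the other terms.\<close>
  define s where "s = ((- l) - \<rho> * ((mI \<bullet> e3) * 0) - (mI \<bullet> e3) * (mI \<bullet> e3)) / (\<rho> * \<rho>)"
  have "nor (x t) \<bullet> north = (C t - \<rho> * ((mI \<bullet> e3) * (nor (x t) \<bullet> e3)) - (mI \<bullet> e3) * (mI \<bullet> gam (x t))) / (\<rho> * \<rho>)" for t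
  proof -
    have "C t = \<rho> * (mI \<bullet> nor (x t)) + (mI \<bullet> e3) * (mI \<bullet> gam (x t))"
      by (simp add: C_def mult_mI inner_add_right)
    also have "mI \<bullet> nor (x t) = \<rho> * (nor (x t) \<bullet> north) + (mI \<bullet> e3) * (nor (x t) \<bullet> e3)"
      by (subst (1) mI_eq) (simp add: inner_add_left inner_commute[of north] inner_commute[of e3])
    finally have "nor (x t) \<bullet> north * (\<rho> * \<rho>) = C t - \<rho> * ((mI \<bullet> e3) * (nor (x t) \<bullet> e3)) - (mI \<bullet> e3) * (mI \<bullet> gam (x t))"
      by (simp add: algebra_simps)
    then show ?thesis using \<rho> by (subst nonzero_eq_divide_eq) auto
  qed
  moreover have "((\<lambda>t. (C t - \<rho> * ((mI \<bullet> e3) * (nor (x t) \<bullet> e3)) - (mI \<bullet> e3) * (mI \<bullet> gam (x t))) / (\<rho> * \<rho>)) \<longlongrightarrow> s) at_top"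
    unfolding s_def using \<rho> by (intro tendsto_intros C n_down gam_lim) auto
  ultimately have n_north: "((\<lambda>t. nor (x t) \<bullet> north) \<longlongrightarrow> s) at_top" by simp
  \<comment> \<open>The components along \<open>east\<close> and \<open>e3\<close> vanish in the
    limit, so unit length leaves \<open>s * s = 1\<close>.\<close>
  have "((\<lambda>t. (nor (x t) \<bullet> north) * (nor (x t) \<bullet> north) + (nor (x t) \<bullet> east) * (nor (x t) \<bullet> east)
      + (nor (x t) \<bullet> e3) * (nor (x t) \<bullet> e3)) \<longlongrightarrow> s * s + 0 * 0 + 0 * 0) at_top"
    by (intro tendsto_intros n_north n_east n_down)
  moreover have one: "\<forall>\<^sub>F t in at_top. nor (x t) \<bullet> nor (x t) = 1"
    by (intro eventually_at_top_linorderI[of 0] coords_inner sol_in)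
  then have "\<forall>\<^sub>F t in at_top. (nor (x t) \<bullet> north) * (nor (x t) \<bullet> north) + (nor (x t) \<bullet> east) * (nor (x t) \<bullet> east)
      + (nor (x t) \<bullet> e3) * (nor (x t) \<bullet> e3) = 1"
  proof eventually_elim
    case (elim t)
    have "nor (x t) \<bullet> nor (x t) = nor (x t) \<bullet> ((nor (x t) \<bullet> north) *\<^sub>R north + (nor (x t) \<bullet> east) *\<^sub>R east
        + (nor (x t) \<bullet> e3) *\<^sub>R e3)"
      by (rule arg_cong[OF frame_expansion])
    then show ?case using elim by (simp add: inner_add_right)
  qed
  ultimately have "((\<lambda>t::real. 1) \<longlongrightarrow> s * s + 0 * 0 + 0 * 0) at_top" by (rule Lim_transform_eventually)
  then have ss: "s * s = 1"
    by (simp add: tendsto_const_iff)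
  then have "s = 1 \<or> s = -1" by (simp add: square_eq_1_iff)
  moreover have "((\<lambda>t. nor (x t)) \<longlongrightarrow> s *\<^sub>R north) at_top"
    by (rule tendsto_unit[OF n_north one frame(1) ss])
  ultimately show ?thesis using that by blast
qed

lemma sol_identity_limit:
  assumes "((\<lambda>t. zl (x t)) \<longlongrightarrow> b *\<^sub>R e3) at_top" "((\<lambda>t. gam (x t)) \<longlongrightarrow> e3) at_top"
    "((\<lambda>t. nor (x t)) \<longlongrightarrow> north) at_top"
  shows "(x \<longlongrightarrow> (0, mat 1)) at_top"
proof -
  obtain B where B: "\<And>p q. p \<in> state_space \<Longrightarrow> q \<in> state_space \<Longrightarrow>
      norm (p - q) \<le> B * (norm (zl p - zl q) + norm (gam p - gam q) + norm (nor p - nor q))"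
    using state_dist_le by metis
  have "((\<lambda>t. B * (norm (zl (x t) - b *\<^sub>R e3) + norm (gam (x t) - e3) + norm (nor (x t) - north))) \<longlongrightarrow> B * (0 + 0 + 0)) at_top"
    by (intro tendsto_intros tendsto_norm_zero LIM_zero assms)
  moreover have "\<forall>\<^sub>F t in at_top. norm (x t - (0, mat 1)) \<le>
      B * (norm (zl (x t) - b *\<^sub>R e3) + norm (gam (x t) - e3) + norm (nor (x t) - north))"
    using B[OF sol_in identity_coords(1)]
    by (intro eventually_at_top_linorderI[of 0]) (simp add: identity_coords)
  ultimately have "((\<lambda>t. x t - (0, mat 1)) \<longlongrightarrow> 0) at_top"
    by (simp only: add_0_left mult_zero_right) (rule Lim_null_comparison[rotated])
  then show ?thesis by (rule LIM_zero_cancel)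
qed

end

end

section \<open>Null basins and instability of the other equilibria\<close>

text \<open>The rational parametrisation of the circle at \<open>t = e / 4\<close>, where the chord
  is at most \<open>2 * t\<close>. It supplies displaced frame vectors for the instability
  proofs.\<close>

lemma small_rotation:
  fixes x y :: "'a::real_inner"
  assumes "x \<bullet> x = 1" "y \<bullet> y = 1" "x \<bullet> y = 0" "0 < e"
  obtains a c :: real where "a * a + c * c = 1" "c \<noteq> 0" "norm ((a *\<^sub>R x + c *\<^sub>R y) - x) < e"
proof -
  define t where "t = e / 4"
  have t: "0 < t" using assms by (simp add: t_def)
  define D where "D = 1 + t * t"
  have D: "1 \<le> D" "0 < D" using t by (simp_all add: D_def add_pos_pos)
  define a c where "a = (1 - t * t) / D" and "c = 2 * t / D"
  have ac: "a * a + c * c = 1"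
  proof -
    have "a * a + c * c = ((1 - t * t) * (1 - t * t) + 2 * t * (2 * t)) / (D * D)"
      by (simp add: a_def c_def add_divide_distrib)
    also have "(1 - t * t) * (1 - t * t) + 2 * t * (2 * t) = D * D" by (simp add: D_def algebra_simps)
    finally show ?thesis using D by simp
  qed
  have "1 - a = 2 * (t * t) / D" using D by (simp add: a_def diff_divide_distrib[symmetric] eq_divide_eq divide_simps) (simp add: D_def)
  also have "\<dots> \<le> 2 * (t * t) / 1" using D t by (intro divide_left_mono) auto
  finally have a: "2 - 2 * a \<le> 4 * (t * t)" by simp
  have "(norm ((a *\<^sub>R x + c *\<^sub>R y) - x))\<^sup>2 = a * a + c * c - 2 * a + 1"
    unfolding power2_norm_eq_inner
    using assms by (simp add: inner_diff_left inner_diff_right inner_add_left inner_add_right inner_commute)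
  also have "\<dots> \<le> (2 * t)\<^sup>2" using a ac by (simp add: power2_eq_square)
  finally have "norm ((a *\<^sub>R x + c *\<^sub>R y) - x) \<le> 2 * t" by (rule power2_le_imp_le) (use t in simp)
  also have "\<dots> < e" using assms by (simp add: t_def)
  finally show ?thesis using that[OF ac] t D by (simp add: c_def)
qed

lemma norm_horizontal_le:
  fixes x :: "real^3"
  assumes "\<bar>x \<bullet> e3\<bar> \<le> (1/4) * norm x + h"
  shows "norm x \<le> 2 * norm (x - (x \<bullet> e3) *\<^sub>R e3) + 2 * h"
proof -
  have "norm x \<le> norm (x - (x \<bullet> e3) *\<^sub>R e3) + \<bar>x \<bullet> e3\<bar>"
    using norm_triangle_sub[of x "(x \<bullet> e3) *\<^sub>R e3"] by simp
  then have "norm x * (3/4) \<le> norm (x - (x \<bullet> e3) *\<^sub>R e3) + h" using assms by linarith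
  moreover have "0 \<le> norm (x - (x \<bullet> e3) *\<^sub>R e3) + h" using calculation norm_ge_zero[of x] by linarith
  ultimately show ?thesis by (simp add: algebra_simps)
qed

context error_system
begin

text \<open>The initial value of \<open>V\<close> is bounded in terms of \<open>k\<close>, and
  \<open>V\<close> does not increase.\<close>

lemma solutions_bounded:
  "\<exists>K. \<forall>x. solution x \<and> norm (x 0) \<le> k \<longrightarrow> (\<forall>t\<ge>0. norm (x t) \<le> K)"
proof -
  obtain Kz where Kz: "0 < Kz" "\<And>p. norm (zl p) \<le> norm p * Kz"
    using bounded_linear.pos_bounded[OF bounded_linear_coords(4)] by blast
  define c where "c = (k * Kz + b)\<^sup>2 / 2 + \<mu> * 2"
  have "0 \<le> c" using \<mu> by (simp add: c_def)
  then obtain K where K: "\<And>p. p \<in> state_space \<Longrightarrow> V p \<le> c \<Longrightarrow> norm p \<le> K" using V_norm_bound by metis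
  have "norm (x t) \<le> K" if x: "solution x" "norm (x 0) \<le> k" and t: "0 \<le> t" for x t
  proof (rule K[OF sol_in[OF x(1) t]])
    have M: "x 0 \<in> state_space" by (rule sol_in[OF x(1)]) simp
    have "norm (zl (x 0) - b *\<^sub>R e3) \<le> norm (zl (x 0)) + b"
      using norm_triangle_ineq4[of "zl (x 0)" "b *\<^sub>R e3"] b by simp
    also have "\<dots> \<le> k * Kz + b"
      using order.trans[OF Kz(2) mult_right_mono[OF x(2)]] Kz(1) by simp
    finally have "(norm (zl (x 0) - b *\<^sub>R e3))\<^sup>2 \<le> (k * Kz + b)\<^sup>2" by (intro power_mono) auto
    moreover have "\<mu> * (1 - gam (x 0) \<bullet> e3) \<le> \<mu> * 2"
      using V_bounds(4)[OF M] \<mu> by (intro mult_left_mono) auto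
    ultimately have "V (x 0) \<le> c" by (simp add: V_def c_def)
    then show "V (x t) \<le> c" using sol_V_mono[OF x(1) t] by linarith
  qed
  then show ?thesis by blast
qed

lemma unit_mean_orthogonal:
  assumes "p \<in> state_space" "q \<in> state_space"
  shows "(gam p - gam q) \<bullet> ((1/2) *\<^sub>R (gam p + gam q)) = 0"
    "(nor p - nor q) \<bullet> ((1/2) *\<^sub>R (gam p + gam q)) = - (((1/2) *\<^sub>R (nor p + nor q)) \<bullet> (gam p - gam q))"
  using inner_diff_mean[of "gam p" "gam p" "gam q" "gam q"] inner_diff_mean[of "nor p" "gam p" "nor q" "gam q"]
  by (simp_all add: coords_inner assms inner_commute)

text \<open>\<open>gam p - gam q\<close> is orthogonal to the mean of \<open>gam p\<close> and
  \<open>gam q\<close>, which is close to a pole, so its horizontal part controls it; for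
  \<open>nor\<close> this holds up to \<open>gam p - gam q\<close>. Three components are replaced by
  two, and the freed one places the graph in a hyperplane.\<close>

lemma axis_graph:
  assumes near: "near_axis s e p" "near_axis s e q" and e: "e \<le> 1/4" and s: "s = 1 \<or> s = -1"
  shows "norm (gam p - gam q) \<le> 2 * norm ((gam p - gam q) - ((gam p - gam q) \<bullet> e3) *\<^sub>R e3)"
    and "norm (nor p - nor q) \<le> 2 * norm ((nor p - nor q) - ((nor p - nor q) \<bullet> e3) *\<^sub>R e3) + 2 * norm (gam p - gam q)"
proof -
  have M: "p \<in> state_space" "q \<in> state_space" using near by (auto simp: near_axis_def)
  define \<gamma> n where "\<gamma> = (1/2) *\<^sub>R (gam p + gam q)" and "n = (1/2) *\<^sub>R (nor p + nor q)"
  have \<gamma>: "norm (\<gamma> - s *\<^sub>R e3) \<le> 1/4"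
    unfolding \<gamma>_def using near e by (intro norm_mean_le) (auto simp: near_axis_def)
  have n: "norm n \<le> 1"
    using coords_norm[OF M(1)] coords_norm[OF M(2)] unfolding n_def
    by (intro norm_mean_le[where c = 0, unfolded diff_zero]; simp)
  have s1: "\<bar>s\<bar> = 1" using s by auto
  have bound: "\<bar>x \<bullet> e3\<bar> \<le> (1/4) * norm x + \<bar>x \<bullet> \<gamma>\<bar>" for x
  proof -
    have "\<bar>x \<bullet> e3\<bar> = \<bar>x \<bullet> (s *\<^sub>R e3)\<bar>" by (simp add: abs_mult s1)
    also have "x \<bullet> (s *\<^sub>R e3) = x \<bullet> \<gamma> - x \<bullet> (\<gamma> - s *\<^sub>R e3)" by (simp add: inner_diff_right)
    also have "\<bar>\<dots>\<bar> \<le> \<bar>x \<bullet> \<gamma>\<bar> + \<bar>x \<bullet> (\<gamma> - s *\<^sub>R e3)\<bar>" by (rule abs_triangle_ineq4)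
    also have "\<bar>x \<bullet> (\<gamma> - s *\<^sub>R e3)\<bar> \<le> norm x * (1/4)" using \<gamma> by (intro abs_inner_le) auto
    finally show ?thesis by simp
  qed
  show "norm (gam p - gam q) \<le> 2 * norm ((gam p - gam q) - ((gam p - gam q) \<bullet> e3) *\<^sub>R e3)"
    using norm_horizontal_le[of "gam p - gam q" 0] bound[of "gam p - gam q"] unit_mean_orthogonal(1)[OF M]
    by (simp add: \<gamma>_def)
  have "\<bar>(nor p - nor q) \<bullet> \<gamma>\<bar> = \<bar>n \<bullet> (gam p - gam q)\<bar>"
    unfolding \<gamma>_def n_def unit_mean_orthogonal(2)[OF M] by (rule abs_minus_cancel)
  also have "\<dots> \<le> 1 * norm (gam p - gam q)" using n by (intro abs_inner_le) auto
  finally show "norm (nor p - nor q) \<le> 2 * norm ((nor p - nor q) - ((nor p - nor q) \<bullet> e3) *\<^sub>R e3) + 2 * norm (gam p - gam q)"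
    using bound[of "nor p - nor q"] by (intro norm_horizontal_le) simp
qed

section \<open>Null basins\<close>

lemma pair_norm_bounds: "norm x \<le> norm (x, y)" "norm y \<le> norm (x, y)" for x y :: "real^3"
  using norm_fst_le[of x y] norm_snd_le[of y x] by simp_all

text \<open>The case \<open>s = -1\<close> of \<open>axis_difference\<close> with the decay of
  \<open>zl\<close> discarded: the form is positive in \<open>zl\<close> and negative in
  \<open>gam\<close>.\<close>

lemma inverted_decrease:
  obtains e r where "0 < e" "e \<le> 1/4" "0 < r"
    "\<And>p q. near_axis (-1) e p \<Longrightarrow> near_axis (-1) e q \<Longrightarrow>
      zl (p - q) \<bullet> zl (f p - f q) - (sqrt \<mu> *\<^sub>R gam (p - q)) \<bullet> (sqrt \<mu> *\<^sub>R gam (f p - f q))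
        \<le> - r * (norm (sqrt \<mu> *\<^sub>R gam (p - q)))\<^sup>2"
proof -
  obtain e1 where e1: "0 < e1" "\<And>p q. near_axis (-1) e1 p \<Longrightarrow> near_axis (-1) e1 q \<Longrightarrow>
      (zl p - zl q) \<bullet> (zl (f p) - zl (f q)) + (-1) * (\<mu> * ((gam p - gam q) \<bullet> (gam (f p) - gam (f q))))
      \<le> - (k1v / 4) * ((norm (zl p - zl q))\<^sup>2 + b\<^sup>2 * (norm (gam p - gam q))\<^sup>2)"
    using axis_difference[of "-1"] by auto
  define e where "e = min e1 (1/4)"
  define r where "r = k1v * b\<^sup>2 / (4 * \<mu>)"
  show ?thesis
  proof (rule that[of e r])
    show "0 < e" "e \<le> 1/4" "0 < r" using e1(1) k1v b \<mu> by (auto simp: e_def r_def)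
    fix p q assume "near_axis (-1) e p" "near_axis (-1) e q"
    then have "near_axis (-1) e1 p" "near_axis (-1) e1 q" by (auto intro: near_axis_mono simp: e_def)
    then have "(zl p - zl q) \<bullet> (zl (f p) - zl (f q)) + (-1) * (\<mu> * ((gam p - gam q) \<bullet> (gam (f p) - gam (f q))))
      \<le> - (k1v / 4) * ((norm (zl p - zl q))\<^sup>2 + b\<^sup>2 * (norm (gam p - gam q))\<^sup>2)" by (rule e1(2))
    also have "\<dots> \<le> - (k1v / 4) * (b\<^sup>2 * (norm (gam p - gam q))\<^sup>2)"
      using k1v by (intro mult_left_mono_neg) auto
    also have "\<dots> = - r * (\<mu> * (norm (gam p - gam q))\<^sup>2)" using \<mu> by (simp add: r_def)
    finally show "zl (p - q) \<bullet> zl (f p - f q) - (sqrt \<mu> *\<^sub>R gam (p - q)) \<bullet> (sqrt \<mu> *\<^sub>R gam (f p - f q))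
        \<le> - r * (norm (sqrt \<mu> *\<^sub>R gam (p - q)))\<^sup>2"
      using \<mu> by (simp add: coords_diff power_mult_distrib mult.assoc[symmetric, of "sqrt \<mu>"])
  qed
qed

text \<open>In the cone, differences of \<open>gam\<close> are bounded by those of
  \<open>zl\<close>. A trapped state is thus determined by \<open>zl\<close> and the horizontal part
  of \<open>nor\<close>, five numbers on a six-dimensional manifold. Since \<open>near_axis\<close>
  leaves yaw free, both inverted equilibria are covered.\<close>

lemma inverted_basin_null:
  obtains e where "0 < e" "\<And>E c. (\<And>p q. p \<in> state_space \<Longrightarrow> q \<in> state_space \<Longrightarrow> norm (p - q) \<le> c * norm (E p - E q)) \<Longrightarrow>
    measure_zero {p \<in> state_space. \<exists>x. solution x \<and> x 0 = E p \<and>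
      (\<exists>T. \<forall>t\<ge>T. x t \<in> {y. near_axis (-1) e y})}"
proof -
  obtain e r where e: "0 < e" "e \<le> 1/4" and r: "0 < r" and
    decr: "\<And>p q. near_axis (-1) e p \<Longrightarrow> near_axis (-1) e q \<Longrightarrow>
      zl (p - q) \<bullet> zl (f p - f q) - (sqrt \<mu> *\<^sub>R gam (p - q)) \<bullet> (sqrt \<mu> *\<^sub>R gam (f p - f q))
        \<le> - r * (norm (sqrt \<mu> *\<^sub>R gam (p - q)))\<^sup>2"
    using inverted_decrease by blast
  obtain B where B: "0 < B" "\<And>p q. p \<in> state_space \<Longrightarrow> q \<in> state_space \<Longrightarrow>
      norm (p - q) \<le> B * (norm (zl p - zl q) + norm (gam p - gam q) + norm (nor p - nor q))"
    using state_dist_le by metis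
  define G where "G p = (zl p, nor p - (nor p \<bullet> e3) *\<^sub>R e3)" for p
  show ?thesis
  proof (rule that[OF e(1)], rule trapped_measure_zero[where S = zl and U = "\<lambda>p. sqrt \<mu> *\<^sub>R gam p"
        and r = r and ?K0.0 = "sqrt \<mu>" and G = G and a = "(0, e3)" and B = "B * (3 + 3 / sqrt \<mu>)"])
    show "bounded_linear zl" "bounded_linear (\<lambda>p. sqrt \<mu> *\<^sub>R gam p)"
      by (intro bounded_linear_coords bounded_linear_const_scaleR)+
    show "norm (sqrt \<mu> *\<^sub>R gam p) \<le> sqrt \<mu>" if "p \<in> {y. near_axis (-1) e y}" for p
      using that \<mu> by (simp add: near_axis_def coords_norm)
    show "(0, e3) \<noteq> (0 :: (real^3) \<times> (real^3))" using inner_e3 by (auto simp: zero_prod_def)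
    show "(0, e3) \<bullet> G p = 0" for p
      by (simp add: G_def inner_diff_right inner_e3 inner_commute)
    fix p q assume near: "p \<in> {y. near_axis (-1) e y}" "q \<in> {y. near_axis (-1) e y}"
      and cone: "norm (sqrt \<mu> *\<^sub>R gam (p - q)) \<le> norm (zl (p - q))"
    have near': "near_axis (-1) e p" "near_axis (-1) e q" using near by auto
    define D where "D = norm (G p - G q)"
    have "G p - G q = (zl p - zl q, (nor p - nor q) - ((nor p - nor q) \<bullet> e3) *\<^sub>R e3)"
      by (simp add: G_def inner_diff_left algebra_simps)
    then have D: "norm (zl p - zl q) \<le> D" "norm ((nor p - nor q) - ((nor p - nor q) \<bullet> e3) *\<^sub>R e3) \<le> D"
      unfolding D_def using pair_norm_bounds by simp_all
    have "sqrt \<mu> * norm (gam p - gam q) \<le> D" using cone D(1) \<mu> by (simp add: coords_diff)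
    then have \<eta>: "norm (gam p - gam q) \<le> (1 / sqrt \<mu>) * D" using \<mu> by (simp add: field_simps)
    have "norm (p - q) \<le> B * (norm (zl p - zl q) + norm (gam p - gam q) + norm (nor p - nor q))"
      using near' by (intro B) (auto simp: near_axis_def)
    also have "\<dots> \<le> B * (D + (1 / sqrt \<mu>) * D + (2 * D + 2 * ((1 / sqrt \<mu>) * D)))"
    proof (intro mult_left_mono add_mono D \<eta>)
      show "norm (nor p - nor q) \<le> 2 * D + 2 * ((1 / sqrt \<mu>) * D)"
        by (rule order.trans[OF axis_graph(2)[OF near' e(2)]])
          (use D \<eta> in \<open>auto intro!: add_mono\<close>)
    qed (use B in auto)
    also have "\<dots> = B * (3 + 3 / sqrt \<mu>) * D" by (simp add: algebra_simps add_divide_distrib)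
    finally show "norm (p - q) \<le> B * (3 + 3 / sqrt \<mu>) * norm (G p - G q)" unfolding D_def .
  qed (use r decr solutions_bounded error_dynamics_bounded_lipschitz in auto)
qed

lemma reversed_decrease:
  obtains e r K where "0 < e" "e \<le> 1/4" "0 < r" "0 < K"
    "\<And>p q. near_upright (-1) e p \<Longrightarrow> near_upright (-1) e q \<Longrightarrow>
      (sqrt K *\<^sub>R zl (p - q), sqrt (K * \<mu>) *\<^sub>R gam (p - q)) \<bullet> (sqrt K *\<^sub>R zl (f p - f q), sqrt (K * \<mu>) *\<^sub>R gam (f p - f q))
        - yaw (p - q) \<bullet> yaw (f p - f q) \<le> - r * (norm (yaw (p - q)))\<^sup>2"
proof -
  obtain e r K where *: "0 < e" "e \<le> 1/4" "0 < r" "0 < K"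
    "\<And>p q. near_upright (-1) e p \<Longrightarrow> near_upright (-1) e q \<Longrightarrow>
      K * ((zl p - zl q) \<bullet> (zl (f p) - zl (f q)) + \<mu> * ((gam p - gam q) \<bullet> (gam (f p) - gam (f q))))
        + (-1) * ((yaw p - yaw q) * (yaw (f p) - yaw (f q)))
      \<le> - r * ((norm (zl p - zl q))\<^sup>2 + (norm (gam p - gam q))\<^sup>2 + (yaw p - yaw q)\<^sup>2)"
    using upright_difference[of "-1"] by blast
  show ?thesis
  proof (rule that[OF *(1-4)])
    fix p q assume near: "near_upright (-1) e p" "near_upright (-1) e q"
    have sq: "sqrt K * (sqrt K * y) = K * y" "sqrt (K * \<mu>) * (sqrt (K * \<mu>) * y) = K * \<mu> * y" for y
      using *(4) \<mu> by (simp_all flip: mult.assoc real_sqrt_mult)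
    have "- r * ((norm (zl p - zl q))\<^sup>2 + (norm (gam p - gam q))\<^sup>2 + (yaw p - yaw q)\<^sup>2) \<le> - r * (yaw p - yaw q)\<^sup>2"
      using *(3) by (intro mult_left_mono_neg) auto
    with *(5)[OF near]
    have "K * ((zl p - zl q) \<bullet> (zl (f p) - zl (f q)) + \<mu> * ((gam p - gam q) \<bullet> (gam (f p) - gam (f q))))
        + (-1) * ((yaw p - yaw q) * (yaw (f p) - yaw (f q))) \<le> - r * (yaw p - yaw q)\<^sup>2"
      by (rule order.trans)
    then show "(sqrt K *\<^sub>R zl (p - q), sqrt (K * \<mu>) *\<^sub>R gam (p - q)) \<bullet> (sqrt K *\<^sub>R zl (f p - f q), sqrt (K * \<mu>) *\<^sub>R gam (f p - f q))
        - yaw (p - q) \<bullet> yaw (f p - f q) \<le> - r * (norm (yaw (p - q)))\<^sup>2"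
      unfolding coords_diff inner_Pair inner_scaleR_left inner_scaleR_right sq
      by (simp add: distrib_left mult.assoc)
  qed
qed

text \<open>Here the cone bounds the yaw difference by those of \<open>zl\<close> and
  \<open>gam\<close>, so that \<open>zl\<close> and the horizontal part of \<open>gam\<close>
  determine a trapped state.\<close>

lemma reversed_basin_null:
  obtains e where "0 < e" "\<And>E c. (\<And>p q. p \<in> state_space \<Longrightarrow> q \<in> state_space \<Longrightarrow> norm (p - q) \<le> c * norm (E p - E q)) \<Longrightarrow>
    measure_zero {p \<in> state_space. \<exists>x. solution x \<and> x 0 = E p \<and>
      (\<exists>T. \<forall>t\<ge>T. x t \<in> {y. near_upright (-1) e y})}"
proof -
  obtain e r K where e: "0 < e" "e \<le> 1/4" and r: "0 < r" and K: "0 < K" and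
    decr: "\<And>p q. near_upright (-1) e p \<Longrightarrow> near_upright (-1) e q \<Longrightarrow>
      (sqrt K *\<^sub>R zl (p - q), sqrt (K * \<mu>) *\<^sub>R gam (p - q)) \<bullet> (sqrt K *\<^sub>R zl (f p - f q), sqrt (K * \<mu>) *\<^sub>R gam (f p - f q))
        - yaw (p - q) \<bullet> yaw (f p - f q) \<le> - r * (norm (yaw (p - q)))\<^sup>2"
    using reversed_decrease by blast
  obtain B where B: "0 < B" "\<And>p q. p \<in> state_space \<Longrightarrow> q \<in> state_space \<Longrightarrow>
      norm (p - q) \<le> B * (norm (zl p - zl q) + norm (gam p - gam q) + norm (nor p - nor q))"
    using state_dist_le by metis
  define G where "G p = (zl p, gam p - (gam p \<bullet> e3) *\<^sub>R e3)" for p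
  \<comment> \<open>Sums the coefficients of \<open>D\<close>: 3 from \<open>zl\<close> and
    \<open>gam\<close>, and \<open>4 + 2 * sqrt K + 4 * sqrt (K * \<mu>)\<close> from
    \<open>nor\<close>.\<close>
  define k where "k = 7 + 2 * sqrt K + 4 * sqrt (K * \<mu>)"
  show ?thesis
  proof (rule that[OF e(1)], rule trapped_measure_zero[where S = "\<lambda>p. (sqrt K *\<^sub>R zl p, sqrt (K * \<mu>) *\<^sub>R gam p)"
        and U = yaw and r = r and ?K0.0 = 1 and G = G and a = "(0, e3)" and B = "B * k"])
    show "bounded_linear (\<lambda>p. (sqrt K *\<^sub>R zl p, sqrt (K * \<mu>) *\<^sub>R gam p))" "bounded_linear yaw"
      by (intro bounded_linear_coords bounded_linear_const_scaleR bounded_linear_Pair)+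
    show "norm (yaw p) \<le> 1" if "p \<in> {y. near_upright (-1) e y}" for p
      using that coords_norm[of p] frame_norm abs_inner_le[of "nor p" 1 east 1]
      by (simp add: near_upright_def near_axis_def yaw_def)
    show "(0, e3) \<noteq> (0 :: (real^3) \<times> (real^3))" using inner_e3 by (auto simp: zero_prod_def)
    show "(0, e3) \<bullet> G p = 0" for p
      by (simp add: G_def inner_diff_right inner_e3 inner_commute)
    fix p q assume near: "p \<in> {y. near_upright (-1) e y}" "q \<in> {y. near_upright (-1) e y}"
      and cone: "norm (yaw (p - q)) \<le> norm (sqrt K *\<^sub>R zl (p - q), sqrt (K * \<mu>) *\<^sub>R gam (p - q))"
    have near': "near_upright (-1) e p" "near_upright (-1) e q" "near_axis 1 e p" "near_axis 1 e q"
      using near by (auto simp: near_upright_def)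
    define D where "D = norm (G p - G q)"
    have "G p - G q = (zl p - zl q, (gam p - gam q) - ((gam p - gam q) \<bullet> e3) *\<^sub>R e3)"
      by (simp add: G_def inner_diff_left algebra_simps)
    then have D: "norm (zl p - zl q) \<le> D" "norm ((gam p - gam q) - ((gam p - gam q) \<bullet> e3) *\<^sub>R e3) \<le> D"
      unfolding D_def using pair_norm_bounds by simp_all
    have \<eta>: "norm (gam p - gam q) \<le> 2 * D"
      using axis_graph(1)[OF near'(3,4) e(2)] D(2) by linarith
    have "\<bar>yaw p - yaw q\<bar> \<le> norm (sqrt K *\<^sub>R zl (p - q)) + norm (sqrt (K * \<mu>) *\<^sub>R gam (p - q))"
      using order.trans[OF cone norm_Pair_le] by (simp add: coords_diff)
    also have "\<dots> \<le> sqrt K * D + sqrt (K * \<mu>) * (2 * D)"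
      unfolding norm_scaleR coords_diff using K \<mu> by (intro add_mono mult_mono D \<eta>) auto
    finally have u: "\<bar>yaw p - yaw q\<bar> \<le> sqrt K * D + sqrt (K * \<mu>) * (2 * D)" .
    have "norm (p - q) \<le> B * (norm (zl p - zl q) + norm (gam p - gam q) + norm (nor p - nor q))"
      using near' by (intro B) (auto simp: near_axis_def)
    also have "\<dots> \<le> B * (D + 2 * D + (2 * (sqrt K * D + sqrt (K * \<mu>) * (2 * D)) + 2 * (2 * D)))"
    proof (intro mult_left_mono add_mono D \<eta>)
      show "norm (nor p - nor q) \<le> 2 * (sqrt K * D + sqrt (K * \<mu>) * (2 * D)) + 2 * (2 * D)"
        by (rule order.trans[OF upright_coords_difference(1)[OF _ e(2) near'(1,2)] add_mono])
          (use u \<eta> in auto)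
    qed (use B in auto)
    also have "\<dots> = B * k * D" by (simp add: k_def algebra_simps)
    finally show "norm (p - q) \<le> B * k * norm (G p - G q)" unfolding D_def .
  qed (use r decr solutions_bounded error_dynamics_bounded_lipschitz in auto)
qed

text \<open>Every solution approaches a pole, and at the upright pole one of two yaw directions.
  Each undesired alternative keeps it eventually in one of the two trapping neighbourhoods, and so
  places the initial state in a null set.\<close>

lemma almost_global_convergence:
  assumes E: "\<And>p q. p \<in> state_space \<Longrightarrow> q \<in> state_space \<Longrightarrow> norm (p - q) \<le> c * norm (E p - E q)"
  obtains N where "measure_zero N"
    "\<And>p x. p \<in> state_space - N \<Longrightarrow> solution x \<Longrightarrow> x 0 = E p \<Longrightarrow>
      (x \<longlongrightarrow> (0, mat 1)) at_top"
proof -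
  obtain e1 where e1: "0 < e1" "\<And>E c. (\<And>p q. p \<in> state_space \<Longrightarrow> q \<in> state_space \<Longrightarrow> norm (p - q) \<le> c * norm (E p - E q)) \<Longrightarrow>
    measure_zero {p \<in> state_space. \<exists>x. solution x \<and> x 0 = E p \<and>
      (\<exists>T. \<forall>t\<ge>T. x t \<in> {y. near_axis (-1) e1 y})}" using inverted_basin_null by blast
  obtain e2 where e2: "0 < e2" "\<And>E c. (\<And>p q. p \<in> state_space \<Longrightarrow> q \<in> state_space \<Longrightarrow> norm (p - q) \<le> c * norm (E p - E q)) \<Longrightarrow>
    measure_zero {p \<in> state_space. \<exists>x. solution x \<and> x 0 = E p \<and>
      (\<exists>T. \<forall>t\<ge>T. x t \<in> {y. near_upright (-1) e2 y})}" using reversed_basin_null by blast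
  define N1 where "N1 = {p \<in> state_space. \<exists>x. solution x \<and> x 0 = E p \<and>
      (\<exists>T. \<forall>t\<ge>T. x t \<in> {y. near_axis (-1) e1 y})}"
  define N2 where "N2 = {p \<in> state_space. \<exists>x. solution x \<and> x 0 = E p \<and>
      (\<exists>T. \<forall>t\<ge>T. x t \<in> {y. near_upright (-1) e2 y})}"
  show ?thesis
  proof (rule that[of "N1 \<union> N2"])
    show "measure_zero (N1 \<union> N2)"
      unfolding N1_def N2_def by (intro measure_zero_Un e1(2)[OF E] e2(2)[OF E])
    fix p x assume p: "p \<in> state_space - (N1 \<union> N2)"
      and x: "solution x" and x0: "x 0 = E p"
    have ev_near: "\<forall>\<^sub>F t in at_top. norm (h t - l) \<le> e"
      if "(h \<longlongrightarrow> l) at_top" "0 < e" for h :: "real \<Rightarrow> real^3" and l e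
      using tendstoD[OF that] by eventually_elim (simp add: dist_norm)
    obtain s where s: "s = 1 \<or> s = -1" "((\<lambda>t. zl (x t)) \<longlongrightarrow> b *\<^sub>R e3) at_top" "((\<lambda>t. gam (x t)) \<longlongrightarrow> s *\<^sub>R e3) at_top"
      using sol_axis_limit[OF x] by blast
    have axis: "\<forall>\<^sub>F t in at_top. near_axis s e (x t)" if e: "0 < e" for e
      using ev_near[OF s(2) e] ev_near[OF s(3) e] eventually_ge_at_top[of 0]
      by eventually_elim (use sol_in[OF x] in \<open>auto simp: near_axis_def\<close>)
    have "s \<noteq> -1"
    proof
      assume "s = -1"
      then obtain T where "\<forall>t\<ge>T. near_axis (-1) e1 (x t)"
        using axis[OF e1(1)] by (auto simp: eventually_at_top_linorder)
      then have "p \<in> N1" unfolding N1_def using p x x0 by auto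
      then show False using p by simp
    qed
    then have s1: "s = 1" using s by simp
    then have gam_lim: "((\<lambda>t. gam (x t)) \<longlongrightarrow> e3) at_top" using s(3) by simp
    obtain s' where s': "s' = 1 \<or> s' = -1" "((\<lambda>t. nor (x t)) \<longlongrightarrow> s' *\<^sub>R north) at_top"
      using sol_yaw_limit[OF x gam_lim] by blast
    have "s' \<noteq> -1"
    proof
      assume "s' = -1"
      have "\<forall>\<^sub>F t in at_top. near_axis 1 e2 (x t)" using axis[OF e2(1)] by (simp only: s1)
      moreover have "\<forall>\<^sub>F t in at_top. norm (nor (x t) - (-1) *\<^sub>R north) \<le> e2"
        using ev_near[OF s'(2) e2(1)] by (simp only: \<open>s' = -1\<close>)
      ultimately have "\<forall>\<^sub>F t in at_top. near_upright (-1) e2 (x t)"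
        by eventually_elim (simp add: near_upright_def)
      then obtain T where "\<forall>t\<ge>T. near_upright (-1) e2 (x t)"
        by (auto simp: eventually_at_top_linorder)
      then have "p \<in> N2" unfolding N2_def using p x x0 by auto
      then show False using p by simp
    qed
    then have "((\<lambda>t. nor (x t)) \<longlongrightarrow> north) at_top" using s' by auto
    then show "(x \<longlongrightarrow> (0, mat 1)) at_top" by (rule sol_identity_limit[OF x s(2) gam_lim])
  qed
qed

lemma identity_almost_globally_asymptotically_stable:
  "almost_globally_asymptotically_stable f (0, mat 1)"
proof -
  obtain N where N: "measure_zero N"
    "\<And>p x. p \<in> state_space - N \<Longrightarrow> solution x \<Longrightarrow> x 0 = p \<Longrightarrow>
      (x \<longlongrightarrow> (0, mat 1)) at_top"
    using almost_global_convergence[of 1 "\<lambda>p. p"] by auto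
  then show ?thesis
    unfolding almost_globally_asymptotically_stable_def
    using locally_exponentially_stable_imp_lyapunov_stable[OF identity_locally_exponentially_stable] solution_exists
    by (intro conjI exI[of _ N]) auto
qed

section \<open>Instability of the three undesired equilibria\<close>

lemma frame_state_near:
  assumes "n \<bullet> n = 1" "\<gamma> \<bullet> \<gamma> = 1" "\<gamma> \<bullet> n = 0" "0 < e"
  obtains r where "0 < r" "\<And>n' \<gamma>'. n' \<bullet> n' = 1 \<Longrightarrow> \<gamma>' \<bullet> \<gamma>' = 1 \<Longrightarrow> \<gamma>' \<bullet> n' = 0 \<Longrightarrow>
    norm (\<gamma>' - \<gamma>) + norm (n' - n) < r \<Longrightarrow> dist (frame_state n' \<gamma>') (frame_state n \<gamma>) < e"
proof -
  obtain B where B: "0 < B" "\<And>p q. p \<in> state_space \<Longrightarrow> q \<in> state_space \<Longrightarrow>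
      norm (p - q) \<le> B * (norm (zl p - zl q) + norm (gam p - gam q) + norm (nor p - nor q))"
    using state_dist_le by metis
  show ?thesis
  proof (rule that[of "e / B"])
    show "0 < e / B" using B assms by simp
    fix n' \<gamma>' assume *: "n' \<bullet> n' = 1" "\<gamma>' \<bullet> \<gamma>' = 1" "\<gamma>' \<bullet> n' = 0" and r: "norm (\<gamma>' - \<gamma>) + norm (n' - n) < e / B"
    have "dist (frame_state n' \<gamma>') (frame_state n \<gamma>) \<le> B * (norm (\<gamma>' - \<gamma>) + norm (n' - n))"
      using B(2)[of "frame_state n' \<gamma>'" "frame_state n \<gamma>"] frame_state[OF *] frame_state[OF assms(1-3)]
      by (simp add: dist_norm)
    also have "\<dots> < e" using r B(1) by (simp add: pos_less_divide_eq mult.commute)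
    finally show "dist (frame_state n' \<gamma>') (frame_state n \<gamma>) < e" .
  qed
qed

text \<open>The witness keeps \<open>zl\<close> and \<open>nor\<close> at equilibrium and tilts
  \<open>gam\<close> from \<open>- e3\<close> towards \<open>east\<close>, which is orthogonal to
  \<open>n\<close>. Only the negative part of the form is then nonzero.\<close>

lemma inverted_unstable:
  assumes n: "n = north \<or> n = - north"
  shows "\<not> lyapunov_stable f state_space (frame_state n (- e3))"
proof -
  define p where "p = frame_state n (- e3)"
  have nn: "n \<bullet> n = 1" "(- e3) \<bullet> (- e3) = 1" "(- e3) \<bullet> n = 0"
    using n by (elim disjE; simp add: frame inner_e3)+
  have p: "p \<in> state_space" "zl p = b *\<^sub>R e3" "gam p = - e3" "nor p = n"
    unfolding p_def by (rule frame_state[OF nn])+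
  have fp: "f p = 0" using equilibrium_coords[OF p(1)] p n by auto
  obtain e r where e: "0 < e" "e \<le> 1/4" and r: "0 < r" and
    decr: "\<And>p q. near_axis (-1) e p \<Longrightarrow> near_axis (-1) e q \<Longrightarrow>
      zl (p - q) \<bullet> zl (f p - f q) - (sqrt \<mu> *\<^sub>R gam (p - q)) \<bullet> (sqrt \<mu> *\<^sub>R gam (f p - f q))
        \<le> - r * (norm (sqrt \<mu> *\<^sub>R gam (p - q)))\<^sup>2"
    using inverted_decrease by blast
  have near_p: "near_axis (-1) e p" using e(1) p by (simp add: near_axis_def)
  obtain \<delta> where \<delta>: "0 < \<delta>" "\<And>y. y \<in> state_space \<Longrightarrow> dist y p < \<delta> \<Longrightarrow> near_axis (-1) e y"
    using near_axisI[OF e(1) p(2), of "-1"] p(3) by (metis scaleR_minus1_left)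
  show ?thesis
    unfolding p_def[symmetric]
  proof (rule not_lyapunov_stableI[where S = zl and U = "\<lambda>p. sqrt \<mu> *\<^sub>R gam p" and r = r, OF _ _ \<delta>(1) r])
    show "bounded_linear zl" "bounded_linear (\<lambda>p. sqrt \<mu> *\<^sub>R gam p)"
      by (intro bounded_linear_coords bounded_linear_const_scaleR)+
    show "zl (y - p) \<bullet> zl (f y) - (sqrt \<mu> *\<^sub>R gam (y - p)) \<bullet> (sqrt \<mu> *\<^sub>R gam (f y))
        \<le> - r * (norm (sqrt \<mu> *\<^sub>R gam (y - p)))\<^sup>2" if "y \<in> state_space" "dist y p < \<delta>" for y
      using decr[OF \<delta>(2)[OF that] near_p] by (simp only: fp diff_zero)
    show "\<exists>x. solution x \<and> x 0 = q" if "q \<in> state_space" for q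
      by (rule solution_exists[OF that])
    fix e' :: real assume "0 < e'"
    then obtain r' where r': "0 < r'" "\<And>n' \<gamma>'. n' \<bullet> n' = 1 \<Longrightarrow> \<gamma>' \<bullet> \<gamma>' = 1 \<Longrightarrow> \<gamma>' \<bullet> n' = 0 \<Longrightarrow>
        norm (\<gamma>' - (- e3)) + norm (n' - n) < r' \<Longrightarrow> dist (frame_state n' \<gamma>') p < e'"
      using frame_state_near[OF nn] unfolding p_def by metis
    have me: "(- e3) \<bullet> (- e3) = 1" "east \<bullet> east = 1" "(- e3) \<bullet> east = 0" "east \<bullet> n = 0"
      using n by (elim disjE; simp add: frame inner_e3)+
    obtain a c where ac: "a * a + c * c = 1" "c \<noteq> 0" "norm ((a *\<^sub>R (- e3) + c *\<^sub>R east) - (- e3)) < r'"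
      using small_rotation[OF me(1-3) r'(1)] by blast
    define \<gamma> where "\<gamma> = a *\<^sub>R (- e3) + c *\<^sub>R east"
    have \<gamma>: "\<gamma> \<bullet> \<gamma> = 1" "\<gamma> \<bullet> n = 0"
      using ac(1) me nn(3) by (simp_all add: \<gamma>_def inner_diff_left inner_diff_right inner_add_left inner_add_right inner_commute frame inner_e3)
    have ne: "\<gamma> \<noteq> - e3"
    proof
      assume "\<gamma> = - e3"
      then have "\<gamma> \<bullet> east = (- e3) \<bullet> east" by simp
      then show False using ac(2) by (simp add: \<gamma>_def inner_diff_left frame)
    qed
    define q where "q = frame_state n \<gamma>"
    have q: "q \<in> state_space" "zl q = b *\<^sub>R e3" "gam q = \<gamma>"
      unfolding q_def using frame_state[OF nn(1) \<gamma>] by auto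
    have "dist q p < e'" unfolding q_def using ac(3) by (intro r' nn \<gamma>) (simp add: \<gamma>_def)
    moreover have "norm (zl (q - p)) < norm (sqrt \<mu> *\<^sub>R gam (q - p))"
      using \<mu> ne by (simp add: coords_diff q p eq_neg_iff_add_eq_0)
    ultimately show "\<exists>q\<in>state_space. dist q p < e' \<and> norm (zl (q - p)) < norm (sqrt \<mu> *\<^sub>R gam (q - p))"
      using q(1) by blast
  qed
qed

text \<open>The witness turns \<open>nor\<close> about \<open>e3\<close> with \<open>zl\<close> and
  \<open>gam\<close> unchanged, so that yaw is the only coordinate in the form that differs from the
  equilibrium.\<close>

lemma reversed_unstable: "\<not> lyapunov_stable f state_space (frame_state (- north) e3)"
proof -
  define p where "p = frame_state (- north) e3"
  have nn: "(- north) \<bullet> (- north) = 1" "e3 \<bullet> e3 = 1" "e3 \<bullet> (- north) = 0" by (simp_all add: frame inner_e3)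
  have p: "p \<in> state_space" "zl p = b *\<^sub>R e3" "gam p = e3" "nor p = - north"
    unfolding p_def by (rule frame_state[OF nn])+
  have fp: "f p = 0" using equilibrium_coords[OF p(1)] p by auto
  obtain e r K where e: "0 < e" and r: "0 < r" and K: "0 < K" and
    decr: "\<And>p q. near_upright (-1) e p \<Longrightarrow> near_upright (-1) e q \<Longrightarrow>
      (sqrt K *\<^sub>R zl (p - q), sqrt (K * \<mu>) *\<^sub>R gam (p - q)) \<bullet> (sqrt K *\<^sub>R zl (f p - f q), sqrt (K * \<mu>) *\<^sub>R gam (f p - f q))
        - yaw (p - q) \<bullet> yaw (f p - f q) \<le> - r * (norm (yaw (p - q)))\<^sup>2"
    using reversed_decrease by metis
  have near_p: "near_upright (-1) e p" using e p by (simp add: near_upright_def near_axis_def)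
  obtain \<delta> where \<delta>: "0 < \<delta>" "\<And>y. y \<in> state_space \<Longrightarrow> dist y p < \<delta> \<Longrightarrow> near_upright (-1) e y"
    using near_axisI[OF e p(2), of 1] p(3,4) by (metis scaleR_minus1_left scaleR_one)
  show ?thesis
    unfolding p_def[symmetric]
  proof (rule not_lyapunov_stableI[where S = "\<lambda>p. (sqrt K *\<^sub>R zl p, sqrt (K * \<mu>) *\<^sub>R gam p)" and U = yaw and r = r,
        OF _ _ \<delta>(1) r])
    show "bounded_linear (\<lambda>p. (sqrt K *\<^sub>R zl p, sqrt (K * \<mu>) *\<^sub>R gam p))" "bounded_linear yaw"
      by (intro bounded_linear_coords bounded_linear_const_scaleR bounded_linear_Pair)+
    show "(sqrt K *\<^sub>R zl (y - p), sqrt (K * \<mu>) *\<^sub>R gam (y - p)) \<bullet> (sqrt K *\<^sub>R zl (f y), sqrt (K * \<mu>) *\<^sub>R gam (f y))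
        - yaw (y - p) \<bullet> yaw (f y) \<le> - r * (norm (yaw (y - p)))\<^sup>2"
      if "y \<in> state_space" "dist y p < \<delta>" for y
      using decr[OF \<delta>(2)[OF that] near_p] by (simp only: fp diff_zero)
    show "\<exists>x. solution x \<and> x 0 = q" if "q \<in> state_space" for q
      by (rule solution_exists[OF that])
    fix e' :: real assume "0 < e'"
    then obtain r' where r': "0 < r'" "\<And>n' \<gamma>'. n' \<bullet> n' = 1 \<Longrightarrow> \<gamma>' \<bullet> \<gamma>' = 1 \<Longrightarrow> \<gamma>' \<bullet> n' = 0 \<Longrightarrow>
        norm (\<gamma>' - e3) + norm (n' - (- north)) < r' \<Longrightarrow> dist (frame_state n' \<gamma>') p < e'"
      using frame_state_near[OF nn] unfolding p_def by metis
    have "(- north) \<bullet> east = 0" by (simp add: frame)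
    then obtain a c where ac: "a * a + c * c = 1" "c \<noteq> 0" "norm ((a *\<^sub>R (- north) + c *\<^sub>R east) - (- north)) < r'"
      using small_rotation[OF nn(1) frame(4) _ r'(1)] by blast
    define n where "n = a *\<^sub>R (- north) + c *\<^sub>R east"
    have n: "n \<bullet> n = 1" "e3 \<bullet> n = 0"
      using ac(1) by (simp_all add: n_def inner_diff_left inner_diff_right inner_add_left inner_add_right frame)
    define q where "q = frame_state n e3"
    have q: "q \<in> state_space" "zl q = b *\<^sub>R e3" "gam q = e3" "nor q = n"
      unfolding q_def using frame_state[OF n(1) nn(2) n(2)] by auto
    have "dist q p < e'" unfolding q_def using ac(3) by (intro r' nn n) (simp add: n_def)
    moreover have "yaw (q - p) = c"
      by (simp add: coords_diff yaw_def q p n_def inner_diff_left inner_add_left frame)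
    ultimately show "\<exists>q\<in>state_space. dist q p < e' \<and>
        norm (sqrt K *\<^sub>R zl (q - p), sqrt (K * \<mu>) *\<^sub>R gam (q - p)) < norm (yaw (q - p))"
      using q(1) ac(2) by (intro bexI[of _ q]) (simp_all add: coords_diff q p)
  qed
qed

end

section \<open>The observer\<close>

text \<open>Innovations are built from cross and inner products and thus commute with rotations;
  this is what lets the error equation be written in inertial coordinates without
  \<open>R\<close>.\<close>

lemma sigma_v_rotate:
  assumes "S \<in> SO3"
  shows "S *v sigma_v k1 k2 u \<gamma> = sigma_v k1 k2 (S *v u) (S *v \<gamma>)"
  by (simp add: sigma_v_def SO3_cross[OF assms] matvec.diff_right matvec.scaleR_right)

lemma sigma_R_rotate:
  assumes "S \<in> SO3"
  shows "S *v sigma_R k1 k2 u \<gamma> m m' = sigma_R k1 k2 (S *v u) (S *v \<gamma>) (S *v m) (S *v m')"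
  by (simp add: sigma_R_def SO3_cross[OF assms] SO3_dot[OF assms] matvec.add_right matvec.scaleR_right)

lemma transpose_mult_skew: "transpose (R ** skew u) = - (skew u ** transpose R)" for R :: "real^3^3"
  by (simp add: matrix_transpose_mul transpose_skew matmul.minus_left)

lemma has_vector_derivative_fst: "(x has_vector_derivative x') F \<Longrightarrow> ((\<lambda>t. fst (x t)) has_vector_derivative fst x') F"
  by (rule bounded_linear.has_vector_derivative[OF bounded_linear_fst])

lemma has_vector_derivative_snd: "(x has_vector_derivative x') F \<Longrightarrow> ((\<lambda>t. snd (x t)) has_vector_derivative snd x') F"
  by (rule bounded_linear.has_vector_derivative[OF bounded_linear_snd])

section \<open>Passage between the observer and the error equation\<close>

lemma observer_derivatives:
  assumes "observer_trajectory g k1v k2v k1r k2r mI \<omega> aB v R vh Rh" and t: "0 \<le> t"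
  shows "Rh t \<in> SO3"
    "(vh has_vector_derivative vh t \<times> \<omega> t + aB t + g *\<^sub>R (transpose (Rh t) *v e3)
        + sigma_v k1v k2v (v t - vh t) (transpose (Rh t) *v e3)) (at t within {0..})"
    "(Rh has_vector_derivative Rh t ** skew (\<omega> t + sigma_R k1r k2r (v t - vh t) (transpose (Rh t) *v e3)
        (transpose (R t) *v mI) (transpose (Rh t) *v mI))) (at t within {0..})"
proof -
  have M: "(vh t, Rh t) \<in> state_space" and d: "((\<lambda>t. (vh t, Rh t)) has_vector_derivative
      observer g k1v k2v k1r k2r mI v \<omega> aB (\<lambda>t. transpose (R t) *v mI) t (vh t, Rh t)) (at t within {0..})"
    using assms unfolding observer_trajectory_def ode_solution_def by auto
  show "Rh t \<in> SO3" using M by (simp add: state_space_def)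
  show "(vh has_vector_derivative vh t \<times> \<omega> t + aB t + g *\<^sub>R (transpose (Rh t) *v e3)
        + sigma_v k1v k2v (v t - vh t) (transpose (Rh t) *v e3)) (at t within {0..})"
    using has_vector_derivative_fst[OF d] by (simp add: observer_def Let_def)
  show "(Rh has_vector_derivative Rh t ** skew (\<omega> t + sigma_R k1r k2r (v t - vh t) (transpose (Rh t) *v e3)
        (transpose (R t) *v mI) (transpose (Rh t) *v mI))) (at t within {0..})"
    using has_vector_derivative_snd[OF d] by (simp add: observer_def Let_def)
qed

lemma vehicle_derivatives:
  assumes "vehicle_trajectory g \<omega> aB v R" and t: "0 \<le> t"
  shows "R t \<in> SO3"
    "(v has_vector_derivative v t \<times> \<omega> t + aB t + g *\<^sub>R (transpose (R t) *v e3)) (at t within {0..})"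
    "(R has_vector_derivative R t ** skew (\<omega> t)) (at t within {0..})"
proof -
  have M: "(v t, R t) \<in> state_space" and d: "((\<lambda>t. (v t, R t)) has_vector_derivative
      vehicle g \<omega> aB t (v t, R t)) (at t within {0..})"
    using assms unfolding vehicle_trajectory_def ode_solution_def by auto
  show "R t \<in> SO3" using M by (simp add: state_space_def)
  show "(v has_vector_derivative v t \<times> \<omega> t + aB t + g *\<^sub>R (transpose (R t) *v e3)) (at t within {0..})"
    using has_vector_derivative_fst[OF d] by (simp add: vehicle_def)
  show "(R has_vector_derivative R t ** skew (\<omega> t)) (at t within {0..})"
    using has_vector_derivative_snd[OF d] by (simp add: vehicle_def)
qed

lemma observation_error_in: "p \<in> state_space \<Longrightarrow> q \<in> state_space \<Longrightarrow> observation_error p q \<in> state_space"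
  by (auto simp: observation_error_def state_space_def SO3_mult SO3_transpose)

text \<open>In inertial coordinates the angular velocity disappears, since the derivative of
  \<open>R t\<close> cancels \<open>u \<times> \<omega> t\<close>, and the acceleration is common to
  vehicle and observer. Equivariance of the innovations expresses the rest through the error
  alone.\<close>

lemma observation_error_solution:
  assumes veh: "vehicle_trajectory g \<omega> aB v R"
    and obs: "observer_trajectory g k1v k2v k1r k2r mI \<omega> aB v R vh Rh"
  shows "ode_solution (\<lambda>_. error_dynamics g k1v k2v k1r k2r mI) state_space {0..}
    (\<lambda>t. observation_error (v t, R t) (vh t, Rh t))"
  unfolding ode_solution_def
proof
  fix t :: real assume "t \<in> {0..}"
  then have t: "0 \<le> t" by simp
  note R = vehicle_derivatives[OF veh t] and Rh = observer_derivatives[OF obs t]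
  define \<gamma> u Rb where "\<gamma> = transpose (Rh t) *v e3" and "u = v t - vh t" and "Rb = R t ** transpose (Rh t)"
  define \<sigma> where "\<sigma> = sigma_R k1r k2r u \<gamma> (transpose (R t) *v mI) (transpose (Rh t) *v mI)"
  have Rb: "Rb *v w = R t *v (transpose (Rh t) *v w)" for w by (simp add: Rb_def matrix_vector_mul_assoc)
  have "((\<lambda>t. R t *v (v t - vh t)) has_vector_derivative
      R t *v ((v t \<times> \<omega> t + aB t + g *\<^sub>R (transpose (R t) *v e3)) - (vh t \<times> \<omega> t + aB t + g *\<^sub>R \<gamma> + sigma_v k1v k2v u \<gamma>))
      + (R t ** skew (\<omega> t)) *v u) (at t within {0..})"
    unfolding \<gamma>_def u_def
    by (intro bounded_bilinear.has_vector_derivative[OF bounded_bilinear_matrix_vector_mult]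
        has_vector_derivative_diff R Rh)
  also have "R t *v ((v t \<times> \<omega> t + aB t + g *\<^sub>R (transpose (R t) *v e3)) - (vh t \<times> \<omega> t + aB t + g *\<^sub>R \<gamma> + sigma_v k1v k2v u \<gamma>))
      + (R t ** skew (\<omega> t)) *v u
    = g *\<^sub>R ((mat 1 - Rb) *v e3) - sigma_v k1v k2v (R t *v u) (Rb *v e3)"
  proof -
    have rates: "(v t \<times> \<omega> t + aB t + g *\<^sub>R (transpose (R t) *v e3)) - (vh t \<times> \<omega> t + aB t + g *\<^sub>R \<gamma> + sigma_v k1v k2v u \<gamma>)
        = u \<times> \<omega> t + g *\<^sub>R (transpose (R t) *v e3 - \<gamma>) - sigma_v k1v k2v u \<gamma>"
      by (simp add: u_def cross.diff_left algebra_simps)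
    have spin: "(R t ** skew (\<omega> t)) *v u = - (R t *v (u \<times> \<omega> t))"
      using cross_skew[of "\<omega> t" u] by (simp add: skew_mult_vec matvec.minus_right flip: matrix_vector_mul_assoc)
    show ?thesis
      unfolding rates spin
      by (simp add: sigma_v_rotate[OF R(1)] SO3_cancel[OF R(1)] matvec.add_right matvec.diff_right
          matvec.diff_left matvec.scaleR_right Rb \<gamma>_def)
  qed
  finally have 1: "((\<lambda>t. R t *v (v t - vh t)) has_vector_derivative
      g *\<^sub>R ((mat 1 - Rb) *v e3) - sigma_v k1v k2v (R t *v u) (Rb *v e3)) (at t within {0..})" .
  have "((\<lambda>t. R t ** transpose (Rh t)) has_vector_derivative
      R t ** transpose (Rh t ** skew (\<omega> t + \<sigma>)) + (R t ** skew (\<omega> t)) ** transpose (Rh t)) (at t within {0..})"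
    unfolding \<sigma>_def \<gamma>_def u_def
    by (intro bounded_bilinear.has_vector_derivative[OF bounded_bilinear_matrix_mult]
        bounded_linear.has_vector_derivative[OF bounded_linear_transpose] R Rh)
  also have "R t ** transpose (Rh t ** skew (\<omega> t + \<sigma>)) + (R t ** skew (\<omega> t)) ** transpose (Rh t)
      = - (R t ** skew \<sigma> ** transpose (Rh t))"
    unfolding transpose_mult_skew
    by (simp add: linear_add[OF bounded_linear.linear[OF bounded_linear_skew]]
        matmul.add_left matmul.add_right matmul.diff_right matmul.minus_right matrix_mul_assoc)
  also have "R t ** skew \<sigma> ** transpose (Rh t) = skew (R t *v \<sigma>) ** Rb"
  proof -
    have "skew (R t *v \<sigma>) ** Rb = R t ** skew \<sigma> ** (transpose (R t) ** R t) ** transpose (Rh t)"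
      unfolding SO3_skew_conj[OF R(1), symmetric] Rb_def by (simp only: matrix_mul_assoc)
    then show ?thesis using SO3_transpose_mult[OF R(1)] by simp
  qed
  also have "R t *v \<sigma> = sigma_R k1r k2r (R t *v u) (Rb *v e3) mI (Rb *v mI)"
    unfolding \<sigma>_def sigma_R_rotate[OF R(1)] by (simp add: SO3_cancel[OF R(1)] Rb \<gamma>_def)
  finally have 2: "((\<lambda>t. R t ** transpose (Rh t)) has_vector_derivative
      - (skew (sigma_R k1r k2r (R t *v u) (Rb *v e3) mI (Rb *v mI)) ** Rb)) (at t within {0..})" .
  have "((\<lambda>t. observation_error (v t, R t) (vh t, Rh t)) has_vector_derivative
      error_dynamics g k1v k2v k1r k2r mI (observation_error (v t, R t) (vh t, Rh t))) (at t within {0..})"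
    using has_vector_derivative_Pair[OF 1 2]
    by (simp add: observation_error_def error_dynamics_def u_def Rb_def matmul.minus_left)
  then show "observation_error (v t, R t) (vh t, Rh t) \<in> state_space \<and>
      ((\<lambda>t. observation_error (v t, R t) (vh t, Rh t)) has_vector_derivative
      error_dynamics g k1v k2v k1r k2r mI (observation_error (v t, R t) (vh t, Rh t))) (at t within {0..})"
    using R(1) Rh(1) by (intro conjI observation_error_in) (auto simp: state_space_def)
qed

text \<open>The error map is inverted along the vehicle trajectory. Existence of observer
  trajectories for all times is thereby inherited from the autonomous error equation.\<close>

lemma observer_from_error_solution:
  assumes veh: "vehicle_trajectory g \<omega> aB v R"
    and x: "ode_solution (\<lambda>_. error_dynamics g k1v k2v k1r k2r mI) state_space {0..} x"
  shows "observer_trajectory g k1v k2v k1r k2r mI \<omega> aB v R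
    (\<lambda>t. v t - transpose (R t) *v fst (x t)) (\<lambda>t. transpose (snd (x t)) ** R t)"
  unfolding observer_trajectory_def ode_solution_def
proof
  fix t :: real assume "t \<in> {0..}"
  then have t: "0 \<le> t" by simp
  note R = vehicle_derivatives[OF veh t]
  have RT: "transpose (R t) \<in> SO3" by (rule SO3_transpose[OF R(1)])
  have M: "snd (x t) \<in> SO3" and dx: "(x has_vector_derivative error_dynamics g k1v k2v k1r k2r mI (x t)) (at t within {0..})"
    using x t unfolding ode_solution_def by (auto simp: state_space_def case_prod_beta)
  define vb Rb where "vb = fst (x t)" and "Rb = snd (x t)"
  define u Rh where "u = transpose (R t) *v vb" and "Rh = transpose Rb ** R t"
  define \<gamma> where "\<gamma> = transpose Rh *v e3"
  define \<sigma> where "\<sigma> = sigma_R k1r k2r vb (Rb *v e3) mI (Rb *v mI)"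
  have RhT: "transpose Rh *v w = transpose (R t) *v (Rb *v w)" for w
    by (simp add: Rh_def matrix_transpose_mul flip: matrix_vector_mul_assoc)
  have d1: "((\<lambda>t. fst (x t)) has_vector_derivative g *\<^sub>R ((mat 1 - Rb) *v e3) - sigma_v k1v k2v vb (Rb *v e3)) (at t within {0..})"
    using has_vector_derivative_fst[OF dx] by (simp add: error_dynamics_def case_prod_beta vb_def Rb_def)
  have d2: "((\<lambda>t. snd (x t)) has_vector_derivative - (skew \<sigma> ** Rb)) (at t within {0..})"
    using has_vector_derivative_snd[OF dx]
    by (simp add: error_dynamics_def case_prod_beta vb_def Rb_def \<sigma>_def matmul.minus_left)
  have dRT: "((\<lambda>t. transpose (R t)) has_vector_derivative - (skew (\<omega> t) ** transpose (R t))) (at t within {0..})"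
    using bounded_linear.has_vector_derivative[OF bounded_linear_transpose R(3)] by (simp add: transpose_mult_skew)
  have "((\<lambda>t. v t - transpose (R t) *v fst (x t)) has_vector_derivative
      (v t \<times> \<omega> t + aB t + g *\<^sub>R (transpose (R t) *v e3)) -
      (transpose (R t) *v (g *\<^sub>R ((mat 1 - Rb) *v e3) - sigma_v k1v k2v vb (Rb *v e3))
        + (- (skew (\<omega> t) ** transpose (R t))) *v fst (x t))) (at t within {0..})"
    by (intro has_vector_derivative_diff bounded_bilinear.has_vector_derivative[OF bounded_bilinear_matrix_vector_mult]
        R dRT d1)
  also have "(v t \<times> \<omega> t + aB t + g *\<^sub>R (transpose (R t) *v e3)) -
      (transpose (R t) *v (g *\<^sub>R ((mat 1 - Rb) *v e3) - sigma_v k1v k2v vb (Rb *v e3))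
        + (- (skew (\<omega> t) ** transpose (R t))) *v fst (x t))
      = (v t - u) \<times> \<omega> t + aB t + g *\<^sub>R \<gamma> + sigma_v k1v k2v u \<gamma>"
  proof -
    have "(- (skew (\<omega> t) ** transpose (R t))) *v fst (x t) = - (\<omega> t \<times> u)"
      by (simp add: matvec.minus_left skew_mult_vec u_def vb_def flip: matrix_vector_mul_assoc)
    also have "\<dots> = u \<times> \<omega> t" by (rule cross_skew[symmetric])
    finally have "(- (skew (\<omega> t) ** transpose (R t))) *v fst (x t) = u \<times> \<omega> t" .
    moreover have "transpose (R t) *v sigma_v k1v k2v vb (Rb *v e3) = sigma_v k1v k2v u \<gamma>"
      by (simp add: sigma_v_rotate[OF RT] u_def \<gamma>_def RhT)
    moreover have "transpose (R t) *v ((mat 1 - Rb) *v e3) = transpose (R t) *v e3 - \<gamma>"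
      by (simp add: matvec.diff_left matvec.diff_right \<gamma>_def RhT)
    ultimately show ?thesis
      by (simp add: matvec.diff_right matvec.scaleR_right cross.diff_left algebra_simps)
  qed
  finally have 1: "((\<lambda>t. v t - transpose (R t) *v fst (x t)) has_vector_derivative
      (v t - u) \<times> \<omega> t + aB t + g *\<^sub>R \<gamma> + sigma_v k1v k2v u \<gamma>) (at t within {0..})" .
  have "((\<lambda>t. transpose (snd (x t)) ** R t) has_vector_derivative
      transpose (snd (x t)) ** (R t ** skew (\<omega> t)) + transpose (- (skew \<sigma> ** Rb)) ** R t) (at t within {0..})"
    by (intro bounded_bilinear.has_vector_derivative[OF bounded_bilinear_matrix_mult]
        bounded_linear.has_vector_derivative[OF bounded_linear_transpose] R d2)
  also have "transpose (snd (x t)) ** (R t ** skew (\<omega> t)) + transpose (- (skew \<sigma> ** Rb)) ** R t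
      = Rh ** skew (\<omega> t + transpose (R t) *v \<sigma>)"
  proof -
    have "transpose (- (skew \<sigma> ** Rb)) = transpose Rb ** skew \<sigma>"
      using linear_neg[OF bounded_linear.linear[OF bounded_linear_transpose], of "skew \<sigma> ** Rb"]
      by (simp add: matrix_transpose_mul transpose_skew matmul.minus_right)
    moreover have "Rh ** skew (transpose (R t) *v \<sigma>) = transpose Rb ** skew \<sigma> ** R t"
    proof -
      have "Rh ** skew (transpose (R t) *v \<sigma>) = transpose Rb ** (R t ** transpose (R t)) ** skew \<sigma> ** R t"
        unfolding Rh_def SO3_skew_conj[OF RT, symmetric] by (simp only: matrix_mul_assoc transpose_transpose)
      then show ?thesis using SO3_mult_transpose[OF R(1)] by simp
    qed
    ultimately show ?thesis
      by (simp add: linear_add[OF bounded_linear.linear[OF bounded_linear_skew]] matmul.add_right Rh_def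
          Rb_def matrix_mul_assoc)
  qed
  also have "transpose (R t) *v \<sigma> = sigma_R k1r k2r u \<gamma> (transpose (R t) *v mI) (transpose Rh *v mI)"
    by (simp add: \<sigma>_def sigma_R_rotate[OF RT] u_def \<gamma>_def RhT)
  finally have 2: "((\<lambda>t. transpose (snd (x t)) ** R t) has_vector_derivative
      Rh ** skew (\<omega> t + sigma_R k1r k2r u \<gamma> (transpose (R t) *v mI) (transpose Rh *v mI))) (at t within {0..})" .
  show "(v t - transpose (R t) *v fst (x t), transpose (snd (x t)) ** R t) \<in> state_space \<and>
      ((\<lambda>t. (v t - transpose (R t) *v fst (x t), transpose (snd (x t)) ** R t)) has_vector_derivative
      observer g k1v k2v k1r k2r mI v \<omega> aB (\<lambda>t. transpose (R t) *v mI) t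
        (v t - transpose (R t) *v fst (x t), transpose (snd (x t)) ** R t)) (at t within {0..})"
  proof
    show "(v t - transpose (R t) *v fst (x t), transpose (snd (x t)) ** R t) \<in> state_space"
      using M R(1) by (simp add: state_space_def SO3_mult SO3_transpose)
    have "observer g k1v k2v k1r k2r mI v \<omega> aB (\<lambda>t. transpose (R t) *v mI) t
        (v t - transpose (R t) *v fst (x t), transpose (snd (x t)) ** R t)
      = ((v t - u) \<times> \<omega> t + aB t + g *\<^sub>R \<gamma> + sigma_v k1v k2v u \<gamma>,
        Rh ** skew (\<omega> t + sigma_R k1r k2r u \<gamma> (transpose (R t) *v mI) (transpose Rh *v mI)))"
      by (simp add: observer_def Let_def u_def vb_def Rb_def Rh_def \<gamma>_def)
    then show "((\<lambda>t. (v t - transpose (R t) *v fst (x t), transpose (snd (x t)) ** R t)) has_vector_derivative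
      observer g k1v k2v k1r k2r mI v \<omega> aB (\<lambda>t. transpose (R t) *v mI) t
        (v t - transpose (R t) *v fst (x t), transpose (snd (x t)) ** R t)) (at t within {0..})"
      using has_vector_derivative_Pair[OF 1 2] by (simp only:)
  qed
qed

text \<open>For a fixed vehicle state the error is affine in the observer state, with a linear part
  built from a rotation and transposition. The bound allows null sets to be obtained directly among
  initial observer states.\<close>

lemma observation_error_inverse_lipschitz:
  assumes "R0 \<in> SO3"
  shows "\<exists>c. \<forall>p q. norm (p - q) \<le> c * norm (observation_error (v0, R0) p - observation_error (v0, R0) q)"
proof -
  have lin: "bounded_linear (\<lambda>D :: real^3^3. transpose (transpose R0 ** D))"
    by (rule bounded_linear_compose[OF bounded_linear_transpose matmul.bounded_linear_right])
  obtain K where K: "0 < K" "\<And>D :: real^3^3. norm (transpose (transpose R0 ** D)) \<le> norm D * K"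
    using bounded_linear.pos_bounded[OF lin] by blast
  have "norm (p - q) \<le> (1 + K) * norm (observation_error (v0, R0) p - observation_error (v0, R0) q)" for p q
  proof -
    define D where "D = observation_error (v0, R0) p - observation_error (v0, R0) q"
    have D: "fst D = - (R0 *v (fst p - fst q))" "snd D = R0 ** transpose (snd p - snd q)"
      by (simp_all add: D_def observation_error_def case_prod_beta matvec.diff_right matmul.diff_right
          linear_diff[OF bounded_linear.linear[OF bounded_linear_transpose]])
    have "norm (fst D) = norm (fst p - fst q)" by (simp add: D SO3_norm[OF assms])
    moreover have "transpose (transpose R0 ** snd D) = snd p - snd q"
      using SO3_transpose_mult[OF assms] by (simp add: D matrix_mul_assoc)
    then have "norm (snd p - snd q) \<le> norm (snd D) * K" using K(2)[of "snd D"] by simp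
    moreover have "norm (fst D) \<le> norm D" "norm (snd D) \<le> norm D"
      by (metis norm_fst_le prod.collapse, metis norm_snd_le prod.collapse)
    then have "norm (snd D) * K \<le> norm D * K" using K(1) by simp
    moreover have "norm (p - q) \<le> norm (fst p - fst q) + norm (snd p - snd q)"
      by (metis norm_Pair_le prod.collapse fst_diff snd_diff)
    ultimately have "norm (p - q) \<le> norm D + norm D * K" using \<open>norm (fst D) \<le> norm D\<close> by linarith
    then show ?thesis by (simp add: D_def algebra_simps)
  qed
  then show ?thesis by blast
qed

text \<open>The error map at time 0 takes the role of \<open>E\<close>, so the exceptional set is
  formed among initial observer states rather than initial errors.\<close>

lemma (in error_system) observer_almost_global_convergence:
  assumes veh: "vehicle_trajectory g \<omega> aB v R"
  shows "\<exists>N. measure_zero N \<and>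
    (\<forall>(vh0, Rh0) \<in> state_space - N.
      (\<exists>vh Rh. observer_trajectory g k1v k2v k1r k2r mI \<omega> aB v R vh Rh \<and> vh 0 = vh0 \<and> Rh 0 = Rh0) \<and>
      (\<forall>vh Rh. observer_trajectory g k1v k2v k1r k2r mI \<omega> aB v R vh Rh \<and> vh 0 = vh0 \<and> Rh 0 = Rh0 \<longrightarrow>
        ((\<lambda>t. observation_error (v t, R t) (vh t, Rh t)) \<longlongrightarrow> (0, mat 1)) at_top))"
proof -
  define E where "E = observation_error (v 0, R 0)"
  have R0: "R 0 \<in> SO3" by (rule vehicle_derivatives(1)[OF veh]) simp
  have M0: "(v 0, R 0) \<in> state_space" using R0 by (simp add: state_space_def)
  obtain c where "\<And>p q. norm (p - q) \<le> c * norm (E p - E q)"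
    using observation_error_inverse_lipschitz[OF R0] unfolding E_def by blast
  then obtain N where N: "measure_zero N"
    "\<And>p x. p \<in> state_space - N \<Longrightarrow> solution x \<Longrightarrow> x 0 = E p \<Longrightarrow>
      (x \<longlongrightarrow> (0, mat 1)) at_top"
    using almost_global_convergence[of c E] by metis
  have exists: "\<exists>vh Rh. observer_trajectory g k1v k2v k1r k2r mI \<omega> aB v R vh Rh \<and> vh 0 = vh0 \<and> Rh 0 = Rh0"
    if p: "(vh0, Rh0) \<in> state_space" for vh0 Rh0
  proof -
    have "E (vh0, Rh0) \<in> state_space" unfolding E_def by (rule observation_error_in[OF M0 p])
    then obtain x where x: "solution x" "x 0 = E (vh0, Rh0)"
      using solution_exists by blast
    have "v 0 - transpose (R 0) *v fst (x 0) = vh0"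
      by (simp add: x(2) E_def observation_error_def SO3_transpose_cancel[OF R0])
    moreover have "transpose (snd (x 0)) ** R 0 = Rh0"
      using SO3_transpose_mult[OF R0]
      by (simp add: x(2) E_def observation_error_def matrix_transpose_mul flip: matrix_mul_assoc)
    ultimately show ?thesis using observer_from_error_solution[OF veh x(1)] by blast
  qed
  have converges: "((\<lambda>t. observation_error (v t, R t) (vh t, Rh t)) \<longlongrightarrow> (0, mat 1)) at_top"
    if "(vh 0, Rh 0) \<in> state_space - N" "observer_trajectory g k1v k2v k1r k2r mI \<omega> aB v R vh Rh" for vh Rh
    using that by (intro N(2)[OF that(1) observation_error_solution[OF veh that(2)]]) (simp add: E_def)
  show ?thesis
  proof (intro exI[of _ N] conjI N(1) ballI, clarify, intro conjI allI impI)
    fix vh0 Rh0 assume p: "(vh0, Rh0) \<in> state_space" "(vh0, Rh0) \<notin> N"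
    show "\<exists>vh Rh. observer_trajectory g k1v k2v k1r k2r mI \<omega> aB v R vh Rh \<and> vh 0 = vh0 \<and> Rh 0 = Rh0"
      by (rule exists[OF p(1)])
    fix vh Rh
    assume *: "observer_trajectory g k1v k2v k1r k2r mI \<omega> aB v R vh Rh \<and> vh 0 = vh0 \<and> Rh 0 = Rh0"
    then have "(vh 0, Rh 0) \<in> state_space - N" using p by simp
    then show "((\<lambda>t. observation_error (v t, R t) (vh t, Rh t)) \<longlongrightarrow> (0, mat 1)) at_top"
      using * by (intro converges) simp_all
  qed
qed

text \<open>The magnetic term of the innovation is parallel to \<open>transpose (Rh t) *v e3\<close>
  and disappears in the cross product with it.\<close>

lemma observer_magnetometer_independent:
  assumes "observer_trajectory g k1v k2v k1r k2r mI \<omega> aB v R vh Rh" and t: "0 \<le> t"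
  shows "((\<lambda>s. transpose (Rh s) *v e3) has_vector_derivative
    - ((\<omega> t + k1r *\<^sub>R ((v t - vh t) \<times> (transpose (Rh t) *v e3))) \<times> (transpose (Rh t) *v e3))) (at t within {0..})"
proof -
  define \<gamma> where "\<gamma> = transpose (Rh t) *v e3"
  define \<Omega> where "\<Omega> = \<omega> t + sigma_R k1r k2r (v t - vh t) \<gamma> (transpose (R t) *v mI) (transpose (Rh t) *v mI)"
  have "((\<lambda>s. transpose (Rh s) *v e3) has_vector_derivative transpose (Rh t ** skew \<Omega>) *v e3) (at t within {0..})"
    unfolding \<Omega>_def \<gamma>_def
    by (intro bounded_linear.has_vector_derivative[OF matvec.bounded_linear_left]
        bounded_linear.has_vector_derivative[OF bounded_linear_transpose] observer_derivatives[OF assms])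
  also have "transpose (Rh t ** skew \<Omega>) *v e3 = - (\<Omega> \<times> \<gamma>)"
    by (simp add: transpose_mult_skew matvec.minus_left skew_mult_vec \<gamma>_def flip: matrix_vector_mul_assoc)
  also have "\<Omega> \<times> \<gamma> = (\<omega> t + k1r *\<^sub>R ((v t - vh t) \<times> \<gamma>)) \<times> \<gamma>"
    by (simp add: \<Omega>_def sigma_R_def cross.add_left cross_mult_left)
  finally show ?thesis unfolding \<gamma>_def .
qed

theorem theorem1:
  fixes g k1v k2v k1r k2r :: real and mI :: "real^3"
  assumes "g > 0" and "mI \<times> e3 \<noteq> 0"
    and "k1v > 0" and "k2v > 0" and "k1r > 0" and "k2r > 0"
    and "k1r \<le> k1v * k2v / g"
  shows
   "(\<forall>\<omega> aB v R vh Rh.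
       vehicle_trajectory g \<omega> aB v R \<and>
       observer_trajectory g k1v k2v k1r k2r mI \<omega> aB v R vh Rh \<longrightarrow>
       ode_solution (\<lambda>_. error_dynamics g k1v k2v k1r k2r mI) state_space {0..}
         (\<lambda>t. observation_error (v t, R t) (vh t, Rh t))) \<and>

    card (equilibria (error_dynamics g k1v k2v k1r k2r mI) state_space) = 4 \<and>
    (\<forall>p \<in> equilibria (error_dynamics g k1v k2v k1r k2r mI) state_space.
       p isolated_in equilibria (error_dynamics g k1v k2v k1r k2r mI) state_space) \<and>
    (0, mat 1) \<in> equilibria (error_dynamics g k1v k2v k1r k2r mI) state_space \<and>

    locally_exponentially_stable (error_dynamics g k1v k2v k1r k2r mI) state_space (0, mat 1) \<and>
    almost_globally_asymptotically_stable (error_dynamics g k1v k2v k1r k2r mI) (0, mat 1) \<and>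
    (\<forall>p \<in> equilibria (error_dynamics g k1v k2v k1r k2r mI) state_space - {(0, mat 1)}.
       \<not> lyapunov_stable (error_dynamics g k1v k2v k1r k2r mI) state_space p) \<and>
    (\<forall>\<omega> aB v R.
       vehicle_trajectory g \<omega> aB v R \<longrightarrow>
       (\<exists>N. measure_zero N \<and>
         (\<forall>(vh0, Rh0) \<in> state_space - N.
            (\<exists>vh Rh. observer_trajectory g k1v k2v k1r k2r mI \<omega> aB v R vh Rh \<and>
               vh 0 = vh0 \<and> Rh 0 = Rh0) \<and>
            (\<forall>vh Rh. observer_trajectory g k1v k2v k1r k2r mI \<omega> aB v R vh Rh \<and>
               vh 0 = vh0 \<and> Rh 0 = Rh0 \<longrightarrow>
               ((\<lambda>t. observation_error (v t, R t) (vh t, Rh t)) \<longlongrightarrow> (0, mat 1)) at_top)))) \<and>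

    (\<exists>F G :: real^3 \<Rightarrow> real^3 \<Rightarrow> real^3 \<Rightarrow> real^3 \<Rightarrow> real^3 \<Rightarrow> real^3.
       \<forall>\<omega> aB v R vh Rh.
         vehicle_trajectory g \<omega> aB v R \<and>
         observer_trajectory g k1v k2v k1r k2r mI \<omega> aB v R vh Rh \<longrightarrow>
         (\<forall>t\<ge>0.
            (vh has_vector_derivative
               F (vh t) (transpose (Rh t) *v e3) (v t) (\<omega> t) (aB t)) (at t within {0..}) \<and>
            ((\<lambda>s. transpose (Rh s) *v e3) has_vector_derivative
               G (vh t) (transpose (Rh t) *v e3) (v t) (\<omega> t) (aB t)) (at t within {0..})))"
proof -
  interpret error_system g k1v k2v k1r k2r mI
    by (rule error_system.intro[OF assms])
  have unstable: "\<not> lyapunov_stable f state_space p"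
    if "p \<in> equilibria f state_space - {(0, mat 1)}" for p
  proof -
    have "p = frame_state (- north) e3 \<or> p = frame_state north (- e3) \<or> p = frame_state (- north) (- e3)"
      using that unfolding equilibria_eq identity_eq by blast
    then show ?thesis using inverted_unstable reversed_unstable by metis
  qed
  show ?thesis
  proof (intro conjI, goal_cases)
    case 1
    show ?case by (intro allI impI, elim conjE) (rule observation_error_solution)
  next
    case 2
    show ?case by (rule card_equilibria)
  next
    case 3
    show ?case by (intro ballI equilibria_isolated)
  next
    case 4
    show ?case by (simp add: equilibria_eq identity_eq)
  next
    case 5
    show ?case by (rule identity_locally_exponentially_stable)
  next
    case 6
    show ?case by (rule identity_almost_globally_asymptotically_stable)
  next
    case 7
    show ?case by (intro ballI unstable)
  next
    case 8
    show ?case by (intro allI impI observer_almost_global_convergence)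
  next
    case 9
    \<comment> \<open>The witnesses are the right-hand sides of the two equations, the second one
      after the magnetic term has dropped out.\<close>
    show ?case
      by (rule exI[of _ "\<lambda>vh \<gamma> v \<omega> aB. vh \<times> \<omega> + aB + g *\<^sub>R \<gamma> + sigma_v k1v k2v (v - vh) \<gamma>"],
          rule exI[of _ "\<lambda>vh \<gamma> v \<omega> aB. - ((\<omega> + k1r *\<^sub>R ((v - vh) \<times> \<gamma>)) \<times> \<gamma>)"],
          intro allI impI, elim conjE, intro conjI)
        (rule observer_derivatives(2) observer_magnetometer_independent; assumption)+
  qed
qed

end
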